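(* Let $H$ be the graph with the maximal signless Laplacian spectral radius among $\mathscr{B}(n,d)$. Then $H\cong B_3^*(n,d)$ for $d\ge 3$.
   Context: All graphs are finite, undirected and simple. The signless Laplacian spectral radius of a graph $G$ is the spectral radius of $Q(G)=D(G)+A(G)$, where $A(G)$ is the adjacency matrix and $D(G)$ the diagonal matrix of vertex degrees. A bicyclic graph is a connected graph with $n$ vertices and $n+1$ edges. $\mathscr{B}(n,d)$ is the set of all bicyclic graphs with $n$ vertices and diameter $d$. Let $\Theta$ be the unique bicyclic graph of order $4$, with vertices $w_1,w_2,w_3,w_4$ and edges $w_1w_2,w_2w_3,w_3w_4,w_4w_1,w_2w_4$ (so $w_1,w_3$ have degree $2$ and $w_2,w_4$ have degree $3$). $\Theta_3(s;a,b)$ is the graph obtained from $\Theta$ by attaching $s$ pendant edges and a pendant path of length $a$ at $w_2$, and a pendant path of length $b$ at $w_4$. $B_3^*(n,d)$ is the graph $\Theta_3(s;a,b)$ with $n$ vertices and diameter $d$ for which $0\le a-b\le 1$ and $d=a+b+1$.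
   Formalization: The theorem is stated for n ≥ d+3, exactly when B_3^*(n,d) exists; for n = d+2 the set B(n,d) is nonempty (e.g. n=5, d=3) but B_3^*(n,d) would need s = −1 and is undefined. *)

theory Defs
  imports "Jordan_Normal_Form.Spectral_Radius"
begin

record 'v ugraph =
  verts :: "'v set"
  edges :: "'v set set"

definition simple_graph :: "'v ugraph \<Rightarrow> bool" where
  "simple_graph G \<longleftrightarrow> finite (verts G) \<and> (\<forall>e\<in>edges G. e \<subseteq> verts G \<and> card e = 2)"

definition adj_rel :: "'v ugraph \<Rightarrow> ('v \<times> 'v) set" where
  "adj_rel G = {(u, v). {u, v} \<in> edges G}"

definition connected_graph :: "'v ugraph \<Rightarrow> bool" where
  "connected_graph G \<longleftrightarrow> verts G \<noteq> {} \<and> (\<forall>u\<in>verts G. \<forall>v\<in>verts G. (u, v) \<in> (adj_rel G)\<^sup>*)"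

text \<open>The next two definitions are meaningful for finite connected graphs only.\<close>

definition graph_dist :: "'v ugraph \<Rightarrow> 'v \<Rightarrow> 'v \<Rightarrow> nat" where
  "graph_dist G u v = (LEAST k. (u, v) \<in> adj_rel G ^^ k)"

definition graph_diameter :: "'v ugraph \<Rightarrow> nat" where
  "graph_diameter G = Max {graph_dist G u v |u v. u \<in> verts G \<and> v \<in> verts G}"

definition graph_iso :: "'v ugraph \<Rightarrow> 'w ugraph \<Rightarrow> bool" (infix "\<cong>\<^sub>g" 50) where
  "G \<cong>\<^sub>g H \<longleftrightarrow> (\<exists>f. bij_betw f (verts G) (verts H) \<and>
     (\<forall>u\<in>verts G. \<forall>v\<in>verts G. {u, v} \<in> edges G \<longleftrightarrow> {f u, f v} \<in> edges H))"

definition vertex_degree :: "'v ugraph \<Rightarrow> 'v \<Rightarrow> nat" where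
  "vertex_degree G v = card {e \<in> edges G. v \<in> e}"

text \<open>The matrices of a graph are defined for graphs whose vertex set is \<open>{0..<n}\<close>, so that
  vertices serve as row and column indices. The entries are complex because
  \<^const>\<open>spectral_radius\<close> is defined for complex matrices.\<close>

definition adjacency_matrix :: "nat ugraph \<Rightarrow> complex mat" where
  "adjacency_matrix G = mat (card (verts G)) (card (verts G))
     (\<lambda>(i, j). if {i, j} \<in> edges G then 1 else 0)"

definition degree_matrix :: "nat ugraph \<Rightarrow> complex mat" where
  "degree_matrix G = mat (card (verts G)) (card (verts G))
     (\<lambda>(i, j). if i = j then of_nat (vertex_degree G i) else 0)"

definition signless_laplacian :: "nat ugraph \<Rightarrow> complex mat" where
  "signless_laplacian G = degree_matrix G + adjacency_matrix G"

definition signless_laplacian_radius :: "nat ugraph \<Rightarrow> real" where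
  "signless_laplacian_radius G = spectral_radius (signless_laplacian G)"

definition bicyclic :: "'v ugraph \<Rightarrow> bool" where
  "bicyclic G \<longleftrightarrow> simple_graph G \<and> connected_graph G \<and> card (edges G) = card (verts G) + 1"

text \<open>Every finite graph is isomorphic to one with vertex set \<open>{0..<n}\<close>, so the
  class of all bicyclic graphs of order \<open>n\<close> and diameter \<open>d\<close> is represented, up
  to isomorphism, by the labelled ones.\<close>

definition bicyclic_graphs :: "nat \<Rightarrow> nat \<Rightarrow> nat ugraph set" where
  "bicyclic_graphs n d =
     {G. verts G = {0..<n} \<and> bicyclic G \<and> graph_diameter G = d}"

definition path_edges :: "'v list \<Rightarrow> 'v set set" where
  "path_edges xs = {{xs ! i, xs ! Suc i} |i. Suc i < length xs}"

text \<open>Here \<open>w\<^sub>1, w\<^sub>2, w\<^sub>3, w\<^sub>4\<close> are the vertices \<open>0, 1, 2, 3\<close>.\<close>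

definition Theta_edges :: "nat set set" where
  "Theta_edges = {{0, 1}, {1, 2}, {2, 3}, {3, 0}, {1, 3}}"

text \<open>The \<open>s\<close> pendant vertices at \<open>w\<^sub>2\<close> come first, then the \<open>a\<close> new vertices of
  the path at \<open>w\<^sub>2\<close>, then the \<open>b\<close> new vertices of the path at \<open>w\<^sub>4\<close>.\<close>

definition Theta3 :: "nat \<Rightarrow> nat \<Rightarrow> nat \<Rightarrow> nat ugraph" where
  "Theta3 s a b =
     \<lparr>verts = {0..<4 + s + a + b},
      edges = Theta_edges
        \<union> {{1, v} |v. v \<in> {4..<4 + s}}
        \<union> path_edges (1 # [4 + s..<4 + s + a])
        \<union> path_edges (3 # [4 + s + a..<4 + s + a + b])\<rparr>"

text \<open>For \<open>d \<ge> 3\<close> such a graph exists (and is then unique) precisely when \<open>n \<ge> d + 3\<close>,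
  as \<open>n = 4 + s + a + b = d + 3 + s\<close>. The inequalities encode \<open>0 \<le> a - b \<le> 1\<close>.\<close>

definition B3star :: "nat \<Rightarrow> nat \<Rightarrow> nat ugraph" where
  "B3star n d = (THE G. \<exists>s a b. G = Theta3 s a b \<and> card (verts G) = n \<and>
     graph_diameter G = d \<and> b \<le> a \<and> a \<le> b + 1 \<and> d = a + b + 1)"

end

theory Submission
  imports Defs "HOL-Analysis.Function_Topology"
begin

text \<open>
  For a vector \<open>x\<close> on the vertices, \<open>x\<^sup>T Q x\<close> is the sum of \<open>(x u + x v)\<^sup>2\<close> over the edges \<open>uv\<close>, its
  \<^emph>\<open>energy\<close>, and the signless Laplacian radius is the largest energy of a unit vector. So two
  graphs on the same vertices can be compared through a single vector: if a positive eigenvector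
  \<open>x\<close> of the first graph has no less energy on the second one, then the radius does not decrease,
  and it increases strictly as soon as the two vectors \<open>Q x\<close> differ at some vertex
  (\<open>rows_eq_of_comparison\<close>). Almost everything below is a sequence of such comparisons, made with
  the vector that belongs to the given graph.

  Let \<open>H\<close> be bicyclic of diameter \<open>d\<close>, \<open>x\<close> its Perron vector and \<open>h\<close> a vertex at which \<open>x\<close> is
  largest. Take a diametral geodesic, through \<open>h\<close> if there is one. Every vertex off the path owns an
  edge to a neighbour closer to \<open>h\<close>; redirecting these edges to \<open>h\<close> itself does not lower the energy.
  Counting shows that exactly two edges are neither on the path nor owned, so the result is a
  \<^emph>\<open>hub graph\<close>: a path through \<open>h\<close>, all other vertices attached to \<open>h\<close>, and two further edges, each
  with an end off the path. If the geodesic avoids \<open>h\<close>, then \<open>h\<close> can take over the place of one of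
  its vertices (\<open>graph_dominated_by_hub_graph\<close>).

  In a hub graph the tails of the path can be recombined so that the largest remaining value \<open>x c\<close>
  on the path occurs next to \<open>h\<close>, and then both further edges can be redirected to \<open>c\<close>. This gives
  a \<^emph>\<open>theta graph\<close>, which is \<open>\<Theta>\<^sub>3(s; a, b)\<close> with \<open>a + b + 1 = d\<close>. The redirection is impossible only
  when both further edges join one vertex off the path to two vertices of the path; then one arrives
  at a \<^emph>\<open>fan\<close>, where a single vertex is joined to \<open>h\<close> and to both neighbours of \<open>h\<close> on the path
  (\<open>hub_graph_dominated\<close>). A fan and its competing theta graph have hubs of equal degree, and their
  radii are close. Here the Perron vector of the fan is not merely rearranged: one solves the
  eigenvalue equations of the theta graph, with the eigenvalue of the fan, at all vertices but the
  hub; what is left is an inequality between rational functions (\<open>fan_less_theta\<close>).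

  Among theta graphs, exchanging end pieces of the two tails, or the roles of two vertices,
  increases the radius unless \<open>0 \<le> a - b \<le> 1\<close>, up to renaming \<open>w\<^sub>2\<close> and \<open>w\<^sub>4\<close> when \<open>s = 0\<close>
  (\<open>theta_balance_hub_tail\<close>, \<open>theta_balance_far_tail\<close>). The balanced theta graph of order \<open>n\<close> is unique
  up to isomorphism, and it belongs to the class of bicyclic graphs of diameter \<open>d\<close>. If \<open>H\<close> is
  optimal, then all the comparisons above are equalities, and the corresponding equalities of \<open>Q x\<close>
  at \<open>h\<close> and at \<open>c\<close> show that no step changed the graph.
\<close>

section \<open>Rayleigh quotients of the signless Laplacian\<close>

text \<open>
  The quadratic form \<open>x\<^sup>T Q x\<close>: an edge \<open>uv\<close> contributes \<open>x u\<^sup>2 + x v\<^sup>2\<close> through the degrees and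
  \<open>2 x u x v\<close> through the adjacency matrix.
\<close>
definition energy :: "'a set set \<Rightarrow> ('a \<Rightarrow> real) \<Rightarrow> real" where
  "energy E x = (\<Sum>e\<in>E. (\<Sum>u\<in>e. x u)\<^sup>2)"

text \<open>
  The entry of \<open>Q x\<close> at \<open>v\<close>. An edge \<open>vu\<close> contributes \<open>x v\<close> through the degree of \<open>v\<close> and \<open>x u\<close> through the
  adjacency matrix.
\<close>
definition Q_row :: "'a set set \<Rightarrow> ('a \<Rightarrow> real) \<Rightarrow> 'a \<Rightarrow> real" where
  "Q_row E x v = (\<Sum>e\<in>{e\<in>E. v \<in> e}. \<Sum>u\<in>e. x u)"

definition norm_sq :: "'a set \<Rightarrow> ('a \<Rightarrow> real) \<Rightarrow> real" where
  "norm_sq V x = (\<Sum>v\<in>V. (x v)\<^sup>2)"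

definition edge_set :: "'a set \<Rightarrow> 'a set set \<Rightarrow> bool" where
  "edge_set V E \<longleftrightarrow> finite V \<and> (\<forall>e\<in>E. e \<subseteq> V \<and> card e = 2)"

text \<open>
  The maximal Rayleigh quotient of \<open>Q\<close>. It is the signless Laplacian radius
  (\<open>signless_laplacian_radius_eq_mu\<close>), but it does not require the vertices to be matrix indices.
\<close>
definition mu :: "'a set \<Rightarrow> 'a set set \<Rightarrow> real" where
  "mu V E = Sup {energy E x |x. norm_sq V x = 1}"

lemma edge_set_finite: "edge_set V E \<Longrightarrow> finite E"
  unfolding edge_set_def by (meson Pow_iff finite_Pow_iff finite_subset subsetI)

lemma edge_setD: "edge_set V E \<Longrightarrow> e \<in> E \<Longrightarrow> e \<subseteq> V \<and> finite e \<and> card e = 2"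
  unfolding edge_set_def using finite_subset by blast

lemma norm_sq_nonneg: "norm_sq V x \<ge> 0"
  by (simp add: norm_sq_def sum_nonneg)

lemma energy_cong:
  assumes "edge_set V E" "\<And>v. v \<in> V \<Longrightarrow> x v = y v"
  shows "energy E x = energy E y"
  unfolding energy_def
  by (rule sum.cong[OF refl]) (metis (no_types, lifting) assms edge_setD subsetD sum.cong)

lemma energy_scale: "energy E (\<lambda>v. c * x v) = c\<^sup>2 * energy E x"
  by (simp add: energy_def sum_distrib_left[symmetric] power_mult_distrib)

lemma norm_sq_scale: "norm_sq V (\<lambda>v. c * x v) = c\<^sup>2 * norm_sq V x"
  by (simp add: norm_sq_def sum_distrib_left power_mult_distrib)

text \<open>
  The unit sphere is not compact as a set of functions, because the coordinates outside \<open>V\<close> are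
  unconstrained. Fixing those coordinates to be \<open>0\<close> turns it into a closed subset of a product of
  compact intervals.
\<close>
lemma energy_max_exists:
  fixes V :: "'a set"
  assumes E: "edge_set V E" and "V \<noteq> {}"
  shows "\<exists>x. norm_sq V x = 1 \<and> (\<forall>y. norm_sq V y = 1 \<longrightarrow> energy E y \<le> energy E x)"
proof -
  have finV: "finite V" using E by (simp add: edge_set_def)
  define K0 where "K0 = Pi\<^sub>E UNIV (\<lambda>v. if v \<in> V then {-1..1::real} else {0})"
  have K0: "compact K0"
  proof -
    have "compactin (product_topology (\<lambda>_. euclidean) UNIV) K0"
      unfolding K0_def compactin_PiE by auto
    then show ?thesis by (simp add: euclidean_product_topology compactin_euclidean_iff)
  qed
  have cont: "continuous_on UNIV (\<lambda>x :: 'a \<Rightarrow> real. x v)" for v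
    by (simp add: continuous_on_product_coordinates)
  have cn: "continuous_on UNIV (norm_sq V)"
    unfolding norm_sq_def by (intro continuous_intros continuous_on_power cont)
  have ce: "continuous_on UNIV (energy E)"
    unfolding energy_def by (intro continuous_intros continuous_on_power cont)
  define K where "K = K0 \<inter> {x. norm_sq V x = 1}"
  have "closed {x. norm_sq V x = 1}"
    using closed_vimage[OF closed_singleton[of 1] cn] by (simp add: vimage_def)
  then have K: "compact K" unfolding K_def using K0 by (rule compact_Int_closed[rotated])
  obtain v0 where v0: "v0 \<in> V" using assms by auto
  have "(\<lambda>v. if v = v0 then 1 else 0) \<in> K"
    unfolding K_def K0_def norm_sq_def using v0 finV
    by (auto simp: if_distrib[of "\<lambda>x. x\<^sup>2"] cong: if_cong)
  then have "K \<noteq> {}" by auto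
  then obtain x where x: "x \<in> K" "\<And>y. y \<in> K \<Longrightarrow> energy E y \<le> energy E x"
    using continuous_attains_sup[OF K, of "energy E"] continuous_on_subset[OF ce] by blast
  have "energy E y \<le> energy E x" if y: "norm_sq V y = 1" for y
  proof -
    let ?y = "\<lambda>v. if v \<in> V then y v else 0"
    have n: "norm_sq V ?y = 1" using y by (simp add: norm_sq_def)
    have "\<bar>y v\<bar> \<le> 1" if "v \<in> V" for v
    proof -
      have "(y v)\<^sup>2 \<le> norm_sq V y" unfolding norm_sq_def
        using finV that by (intro member_le_sum) auto
      then show ?thesis using y by (simp add: abs_square_le_1)
    qed
    then have "?y \<in> K" unfolding K_def K0_def using n by (auto simp: abs_le_iff minus_le_iff)
    then have "energy E ?y \<le> energy E x" using x by blast
    also have "energy E ?y = energy E y" by (rule energy_cong[OF E]) auto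
    finally show ?thesis .
  qed
  then show ?thesis using x(1) unfolding K_def by blast
qed

lemma mu_attained:
  assumes E: "edge_set V E" and V: "V \<noteq> {}"
  shows "\<exists>x. norm_sq V x = 1 \<and> energy E x = mu V E"
    and "energy E y \<le> mu V E * norm_sq V y"
proof -
  obtain x where x: "norm_sq V x = 1" "\<And>y. norm_sq V y = 1 \<Longrightarrow> energy E y \<le> energy E x"
    using energy_max_exists[OF assms] by blast
  have mu: "mu V E = energy E x"
    unfolding mu_def by (rule cSup_eq_maximum) (use x in auto)
  then show "\<exists>x. norm_sq V x = 1 \<and> energy E x = mu V E" using x by metis
  show "energy E y \<le> mu V E * norm_sq V y"
  proof (cases "norm_sq V y = 0")
    case True
    then have "\<And>v. v \<in> V \<Longrightarrow> y v = 0"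
      using E by (simp add: norm_sq_def sum_nonneg_eq_0_iff edge_set_def)
    then have "energy E y = energy E (\<lambda>v. 0)" by (intro energy_cong[OF E]) auto
    also have "\<dots> = 0" by (simp add: energy_def)
    finally show ?thesis using True by simp
  next
    case False
    let ?s = "norm_sq V y"
    have s: "?s > 0" using False norm_sq_nonneg[of V y] by linarith
    have "norm_sq V (\<lambda>v. (1 / sqrt ?s) * y v) = 1"
      unfolding norm_sq_scale using s by (simp add: power_divide)
    then have "energy E (\<lambda>v. (1 / sqrt ?s) * y v) \<le> mu V E" using x mu by metis
    then show ?thesis unfolding energy_scale using s by (simp add: power_divide field_simps)
  qed
qed

lemma mu_nonneg: "edge_set V E \<Longrightarrow> V \<noteq> {} \<Longrightarrow> mu V E \<ge> 0"
  by (metis mu_attained(1) energy_def sum_nonneg zero_le_power2)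

lemma sum_row:
  assumes E: "edge_set V E"
  shows "(\<Sum>v\<in>V. y v * Q_row E x v) = (\<Sum>e\<in>E. (\<Sum>u\<in>e. y u) * (\<Sum>u\<in>e. x u))"
proof -
  have finV: "finite V" and finE: "finite E" using E edge_set_finite by (auto simp: edge_set_def)
  have "(\<Sum>v\<in>V. y v * Q_row E x v) = (\<Sum>v\<in>V. \<Sum>e\<in>E. if v \<in> e then y v * (\<Sum>u\<in>e. x u) else 0)"
    unfolding Q_row_def sum_distrib_left using finE
    by (intro sum.cong refl sum.inter_filter)
  also have "\<dots> = (\<Sum>e\<in>E. \<Sum>v\<in>V. if v \<in> e then y v * (\<Sum>u\<in>e. x u) else 0)"
    by (rule sum.swap)
  also have "\<dots> = (\<Sum>e\<in>E. (\<Sum>u\<in>e. y u) * (\<Sum>u\<in>e. x u))"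
  proof (rule sum.cong[OF refl])
    fix e assume "e \<in> E"
    then have "V \<inter> e = e" using edge_setD[OF E] by blast
    then show "(\<Sum>v\<in>V. if v \<in> e then y v * (\<Sum>u\<in>e. x u) else 0) = (\<Sum>u\<in>e. y u) * (\<Sum>u\<in>e. x u)"
      using finV by (simp add: sum.If_cases sum_distrib_right)
  qed
  finally show ?thesis .
qed

lemma energy_row: "edge_set V E \<Longrightarrow> energy E x = (\<Sum>v\<in>V. x v * Q_row E x v)"
  by (simp add: sum_row energy_def power2_eq_square)

lemma energy_eq_of_rows:
  assumes "edge_set V E" "\<And>v. v \<in> V \<Longrightarrow> Q_row E x v = c * x v"
  shows "energy E x = c * norm_sq V x"
  using assms by (simp add: energy_row norm_sq_def sum_distrib_left power2_eq_square algebra_simps)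

text \<open>
  For small \<open>t\<close> of the right sign a nonzero linear term would dominate the quadratic one.
\<close>
lemma quadratic_perturbation_zero:
  fixes b c :: real
  assumes "\<And>t. 2 * t * b \<le> t\<^sup>2 * c"
  shows "b = 0"
proof (rule ccontr)
  assume b: "b \<noteq> 0"
  define t where "t = b / (\<bar>c\<bar> + 1)"
  have "2 * t * b = 2 * b\<^sup>2 / (\<bar>c\<bar> + 1)" by (simp add: t_def power2_eq_square)
  moreover have "t\<^sup>2 * c = (b\<^sup>2 / (\<bar>c\<bar> + 1)) * (c / (\<bar>c\<bar> + 1))"
    by (simp add: t_def power2_eq_square)
  moreover have "\<dots> \<le> (b\<^sup>2 / (\<bar>c\<bar> + 1)) * 1"
    by (intro mult_left_mono) (auto simp: divide_le_eq)
  ultimately have "2 * b\<^sup>2 / (\<bar>c\<bar> + 1) \<le> b\<^sup>2 / (\<bar>c\<bar> + 1)" using assms[of t] by linarith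
  then show False using b by (simp add: divide_le_cancel)
qed

text \<open>
  A maximiser of the Rayleigh quotient is an eigenvector: when it is perturbed in the coordinate \<open>v\<close>,
  the linear term of \<open>\<mu> |x|\<^sup>2 - x\<^sup>T Q x \<ge> 0\<close> has to vanish.
\<close>
lemma row_eq_of_energy_eq:
  assumes E: "edge_set V E" and v: "v \<in> V" and eq: "energy E x = mu V E * norm_sq V x"
  shows "Q_row E x v = mu V E * x v"
proof -
  have finV: "finite V" using E by (simp add: edge_set_def)
  define y where "y = (\<lambda>u. if u = v then 1 else (0::real))"
  define b where "b = Q_row E x v - mu V E * x v"
  define c where "c = mu V E * norm_sq V y - energy E y"
  have e: "energy E (\<lambda>u. x u + t * y u) = energy E x + 2 * t * Q_row E x v + t\<^sup>2 * energy E y" for t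
  proof -
    have "(\<Sum>u\<in>V. y u * Q_row E x u) = Q_row E x v"
      unfolding y_def using v finV by (simp add: if_distrib[of "\<lambda>a. a * _"] cong: if_cong)
    then have r: "(\<Sum>e\<in>E. (\<Sum>u\<in>e. y u) * (\<Sum>u\<in>e. x u)) = Q_row E x v" using sum_row[OF E] by metis
    have "energy E (\<lambda>u. x u + t * y u) =
       (\<Sum>e\<in>E. (\<Sum>u\<in>e. x u)\<^sup>2 + 2 * t * ((\<Sum>u\<in>e. y u) * (\<Sum>u\<in>e. x u)) + t\<^sup>2 * (\<Sum>u\<in>e. y u)\<^sup>2)"
      unfolding energy_def
      by (intro sum.cong refl)
        (simp add: sum.distrib sum_distrib_left[symmetric] power2_eq_square algebra_simps)
    then show ?thesis by (simp add: sum.distrib sum_distrib_left[symmetric] r energy_def)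
  qed
  have n: "norm_sq V (\<lambda>u. x u + t * y u) = norm_sq V x + 2 * t * x v + t\<^sup>2 * norm_sq V y" for t
  proof -
    have "(\<Sum>u\<in>V. y u * x u) = x v"
      unfolding y_def using v finV by (simp add: if_distrib[of "\<lambda>a. a * _"] cong: if_cong)
    then have "(\<Sum>u\<in>V. 2 * t * (y u * x u)) = 2 * t * x v" by (metis sum_distrib_left)
    moreover have "norm_sq V (\<lambda>u. x u + t * y u)
        = (\<Sum>u\<in>V. (x u)\<^sup>2 + 2 * t * (y u * x u) + t\<^sup>2 * (y u)\<^sup>2)"
      unfolding norm_sq_def by (intro sum.cong refl) (simp add: power2_eq_square algebra_simps)
    ultimately show ?thesis
      by (simp add: sum.distrib norm_sq_def flip: sum_distrib_left)
  qed
  have "2 * t * b \<le> t\<^sup>2 * c" for t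
    using mu_attained(2)[OF E, of "\<lambda>u. x u + t * y u"] v eq unfolding e n b_def c_def
    by (auto simp: algebra_simps)
  then have "b = 0" by (rule quadratic_perturbation_zero)
  then show ?thesis by (simp add: b_def)
qed

text \<open>
  Taking absolute values does not lower the energy, so some maximiser is nonnegative. At a vertex
  where it vanishes, its eigenvalue equation is a vanishing sum of nonnegative terms, hence it
  vanishes at all neighbours, and by connectivity everywhere.
\<close>
lemma perron_vector_exists:
  assumes E: "edge_set V E" and V: "V \<noteq> {}"
    and conn: "\<And>u v. u \<in> V \<Longrightarrow> v \<in> V \<Longrightarrow> (u, v) \<in> {(u, v). {u, v} \<in> E}\<^sup>*"
  shows "\<exists>x. (\<forall>v\<in>V. x v > 0 \<and> Q_row E x v = mu V E * x v) \<and> norm_sq V x = 1"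
proof -
  obtain z where z: "norm_sq V z = 1" "energy E z = mu V E" using mu_attained(1)[OF E V] by blast
  define x where "x = (\<lambda>v. \<bar>z v\<bar>)"
  have nx: "norm_sq V x = 1" using z(1) by (simp add: norm_sq_def x_def)
  have "energy E z \<le> energy E x" unfolding energy_def
  proof (rule sum_mono)
    fix e assume "e \<in> E"
    have "\<bar>\<Sum>u\<in>e. z u\<bar> \<le> (\<Sum>u\<in>e. x u)" unfolding x_def by (rule sum_abs)
    then show "(\<Sum>u\<in>e. z u)\<^sup>2 \<le> (\<Sum>u\<in>e. x u)\<^sup>2" by (metis abs_ge_zero power2_abs power_mono)
  qed
  with mu_attained(2)[OF E V, of x] z nx have eq: "energy E x = mu V E * norm_sq V x" by simp
  have r: "Q_row E x v = mu V E * x v" if "v \<in> V" for v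
    by (rule row_eq_of_energy_eq[OF E that eq])
  have x0: "x v \<ge> 0" for v by (simp add: x_def)
  have step: "x w = 0" if "{v, w} \<in> E" "x v = 0" for v w
  proof -
    have "v \<in> V" using edge_setD[OF E that(1)] by auto
    then have "Q_row E x v = 0" using r that by simp
    then have "\<forall>e\<in>{e\<in>E. v \<in> e}. (\<Sum>u\<in>e. x u) = 0" unfolding Q_row_def
      using edge_set_finite[OF E] x0
      by (subst (asm) sum_nonneg_eq_0_iff) (auto intro: sum_nonneg)
    then have "(\<Sum>u\<in>{v, w}. x u) = 0" using that by blast
    then show ?thesis using x0 by (subst (asm) sum_nonneg_eq_0_iff) auto
  qed
  have "x v > 0" if v: "v \<in> V" for v
  proof (rule ccontr)
    assume "\<not> x v > 0"
    then have v0: "x v = 0" using x0[of v] by linarith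
    have "x w = 0" if w: "w \<in> V" for w
      using conn[OF v w] by (induction rule: rtrancl_induct) (use v0 step in auto)
    then have "norm_sq V x = 0" by (simp add: norm_sq_def)
    then show False using nx by simp
  qed
  then show ?thesis using r nx by blast
qed

lemma signless_laplacian_carrier:
  assumes "verts G = {0..<n}"
  shows "signless_laplacian G \<in> carrier_mat n n"
  using assms by (simp add: signless_laplacian_def degree_matrix_def adjacency_matrix_def)

lemma signless_laplacian_entry:
  assumes V: "verts G = {0..<n}" and "i < n" "j < n"
  shows "signless_laplacian G $$ (i, j) =
    (if i = j then of_nat (vertex_degree G i) else 0) + (if {i, j} \<in> edges G then 1 else 0)"
  using assms by (simp add: signless_laplacian_def degree_matrix_def adjacency_matrix_def)

lemma edge_containing:
  assumes "card e = 2" "v \<in> e"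
  obtains u where "u \<noteq> v" "e = {v, u}"
  using assms by (metis card_2_iff doubleton_eq_iff insertE singletonD)

lemma sum_row_neighbours:
  fixes f :: "'a \<Rightarrow> 'b::comm_ring_1"
  assumes E: "edge_set V E" and v: "v \<in> V"
  shows "(\<Sum>e\<in>{e\<in>E. v \<in> e}. \<Sum>u\<in>e. f u) =
     of_nat (card {e\<in>E. v \<in> e}) * f v + (\<Sum>u\<in>{u\<in>V. {v, u} \<in> E}. f u)"
proof -
  have bij: "bij_betw (\<lambda>u. {v, u}) {u\<in>V. {v, u} \<in> E} {e\<in>E. v \<in> e}"
  proof (rule bij_betwI')
    fix u w assume "u \<in> {u\<in>V. {v, u} \<in> E}" "w \<in> {u\<in>V. {v, u} \<in> E}"
    then show "({v, u} = {v, w}) = (u = w)"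
      by (auto simp: doubleton_eq_iff)
  next
    fix e assume e: "e \<in> {e\<in>E. v \<in> e}"
    then obtain u where "u \<noteq> v" "e = {v, u}"
      using edge_containing[of e v] edge_setD[OF E, of e] by auto
    then show "\<exists>u\<in>{u\<in>V. {v, u} \<in> E}. e = {v, u}" using e edge_setD[OF E, of e] by auto
  qed auto
  have "(\<Sum>e\<in>{e\<in>E. v \<in> e}. \<Sum>u\<in>e. f u) = (\<Sum>u\<in>{u\<in>V. {v, u} \<in> E}. \<Sum>w\<in>{v, u}. f w)"
    using sum.reindex_bij_betw[OF bij, of "\<lambda>e. \<Sum>u\<in>e. f u"] by simp
  also have "\<dots> = (\<Sum>u\<in>{u\<in>V. {v, u} \<in> E}. f v + f u)"
  proof (rule sum.cong[OF refl])
    fix u assume "u \<in> {u\<in>V. {v, u} \<in> E}"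
    then have "u \<noteq> v" using edge_setD[OF E, of "{v, u}"] by auto
    then show "(\<Sum>w\<in>{v, u}. f w) = f v + f u" by simp
  qed
  also have "\<dots> = of_nat (card {u\<in>V. {v, u} \<in> E}) * f v + (\<Sum>u\<in>{u\<in>V. {v, u} \<in> E}. f u)"
    by (simp add: sum.distrib)
  finally show ?thesis using bij_betw_same_card[OF bij] by simp
qed

lemma signless_laplacian_mult:
  assumes V: "verts G = {0..<n}" and E: "edge_set {0..<n} (edges G)"
    and z: "z \<in> carrier_vec n" and i: "i < n"
  shows "(signless_laplacian G *\<^sub>v z) $ i = (\<Sum>e\<in>{e\<in>edges G. i \<in> e}. \<Sum>u\<in>e. z $ u)"
proof -
  have "(signless_laplacian G *\<^sub>v z) $ i = (\<Sum>j = 0..<n. signless_laplacian G $$ (i, j) * z $ j)"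
    using signless_laplacian_carrier[OF V] z i by (simp add: scalar_prod_def)
  also have "\<dots> = (\<Sum>j = 0..<n. (if i = j then of_nat (vertex_degree G i) * z $ j else 0)
      + (if {i, j} \<in> edges G then z $ j else 0))"
    by (intro sum.cong refl) (auto simp: signless_laplacian_entry[OF V i] algebra_simps)
  also have "\<dots> = of_nat (vertex_degree G i) * z $ i + (\<Sum>u\<in>{u\<in>{0..<n}. {i, u} \<in> edges G}. z $ u)"
    using i by (simp add: sum.distrib sum.If_cases Int_def)
  also have "\<dots> = (\<Sum>e\<in>{e\<in>edges G. i \<in> e}. \<Sum>u\<in>e. z $ u)"
    using sum_row_neighbours[OF E, of i "\<lambda>u. z $ u"] i by (simp add: vertex_degree_def)
  finally show ?thesis .
qed

text \<open>
  A real maximiser of the Rayleigh quotient is an eigenvector of the complex matrix. Conversely, if \<open>z\<close>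
  is an eigenvector for \<open>k\<close>, the triangle inequality in each row shows that the Rayleigh quotient of
  the vector of absolute values of \<open>z\<close> is at least \<open>|k|\<close>.
\<close>
theorem signless_laplacian_radius_eq_mu:
  fixes G :: "nat ugraph"
  assumes V: "verts G = {0..<n}" and n: "n > 0" and E: "edge_set {0..<n} (edges G)"
  shows "signless_laplacian_radius G = mu {0..<n} (edges G)"
proof (rule antisym)
  let ?Q = "signless_laplacian G" and ?V = "{0..<n}" and ?E = "edges G"
  note carr = signless_laplacian_carrier[OF V]
  have ne: "?V \<noteq> {}" using n by simp
  show "mu ?V ?E \<le> signless_laplacian_radius G"
  proof -
    obtain x where x: "norm_sq ?V x = 1" "energy ?E x = mu ?V ?E"
      using mu_attained(1)[OF E ne] by blast
    then have r: "Q_row ?E x i = mu ?V ?E * x i" if "i < n" for i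
      using row_eq_of_energy_eq[OF E, of i x] that by simp
    define z where "z = vec n (\<lambda>i. complex_of_real (x i))"
    have zc: "z \<in> carrier_vec n" by (simp add: z_def)
    have "?Q *\<^sub>v z = complex_of_real (mu ?V ?E) \<cdot>\<^sub>v z"
    proof (rule eq_vecI)
      fix i assume "i < dim_vec (complex_of_real (mu ?V ?E) \<cdot>\<^sub>v z)"
      then have i: "i < n" by (simp add: z_def)
      have "(\<Sum>e\<in>{e\<in>?E. i \<in> e}. \<Sum>u\<in>e. z $ u) = complex_of_real (Q_row ?E x i)"
        unfolding Q_row_def of_real_sum
      proof (intro sum.cong refl)
        fix e u assume "e \<in> {e\<in>?E. i \<in> e}" "u \<in> e"
        then have "u < n" using edge_setD[OF E, of e] by auto
        then show "z $ u = complex_of_real (x u)" by (simp add: z_def)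
      qed
      then show "(?Q *\<^sub>v z) $ i = (complex_of_real (mu ?V ?E) \<cdot>\<^sub>v z) $ i"
        using signless_laplacian_mult[OF V E zc i] r[OF i] i by (simp add: z_def)
    qed (use carr in \<open>simp add: z_def\<close>)
    moreover have "z \<noteq> 0\<^sub>v n"
    proof
      assume "z = 0\<^sub>v n"
      then have "x i = 0" if "i < n" for i using that by (metis index_vec index_zero_vec(1) of_real_eq_0_iff z_def)
      then have "norm_sq ?V x = 0" by (simp add: norm_sq_def)
      then show False using x by simp
    qed
    ultimately have "eigenvalue ?Q (complex_of_real (mu ?V ?E))"
      unfolding eigenvalue_def eigenvector_def using carr zc by auto
    then have "norm (complex_of_real (mu ?V ?E)) \<in> norm ` spectrum ?Q"
      unfolding spectrum_def by (intro imageI) simp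
    then have "norm (complex_of_real (mu ?V ?E)) \<le> spectral_radius ?Q"
      by (rule spectral_radius_mem_max(2)[OF carr n])
    then show ?thesis using mu_nonneg[OF E ne] by (simp add: signless_laplacian_radius_def)
  qed
  show "signless_laplacian_radius G \<le> mu ?V ?E"
  proof -
    obtain k where k: "k \<in> spectrum ?Q" "spectral_radius ?Q = norm k"
      using spectral_radius_mem_max(1)[OF carr n] by auto
    then obtain z where z: "z \<in> carrier_vec n" "z \<noteq> 0\<^sub>v n" "?Q *\<^sub>v z = k \<cdot>\<^sub>v z"
      using carr by (auto simp: spectrum_def eigenvalue_def eigenvector_def)
    define x where "x = (\<lambda>i. norm (z $ i))"
    have le: "norm k * x i \<le> Q_row ?E x i" if i: "i \<in> ?V" for i
    proof -
      have "k * z $ i = (\<Sum>e\<in>{e\<in>?E. i \<in> e}. \<Sum>u\<in>e. z $ u)"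
        using signless_laplacian_mult[OF V E z(1), of i] z i by auto
      then have "norm k * x i = norm (\<Sum>e\<in>{e\<in>?E. i \<in> e}. \<Sum>u\<in>e. z $ u)"
        unfolding x_def by (metis norm_mult)
      also have "\<dots> \<le> Q_row ?E x i"
        unfolding Q_row_def x_def by (intro sum_norm_le norm_sum)
      finally show ?thesis .
    qed
    have "norm k * norm_sq ?V x = (\<Sum>i\<in>?V. x i * (norm k * x i))"
      by (simp add: norm_sq_def sum_distrib_left power2_eq_square algebra_simps)
    also have "\<dots> \<le> (\<Sum>i\<in>?V. x i * Q_row ?E x i)"
      by (intro sum_mono mult_left_mono le) (auto simp: x_def)
    also have "\<dots> = energy ?E x" by (rule energy_row[OF E, symmetric])
    also have "\<dots> \<le> mu ?V ?E * norm_sq ?V x" by (rule mu_attained(2)[OF E ne])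
    finally have le2: "norm k * norm_sq ?V x \<le> mu ?V ?E * norm_sq ?V x" .
    have "norm_sq ?V x > 0"
    proof -
      have "\<exists>i<n. z $ i \<noteq> 0"
      proof (rule ccontr)
        assume "\<not> ?thesis"
        then have "z = 0\<^sub>v n" using z(1) by (intro eq_vecI) auto
        then show False using z by simp
      qed
      then obtain i where i: "i < n" "z $ i \<noteq> 0" by blast
      have "0 < (x i)\<^sup>2" using i by (simp add: x_def)
      also have "(x i)\<^sup>2 \<le> norm_sq ?V x" unfolding norm_sq_def
        using i by (intro member_le_sum) auto
      finally show ?thesis .
    qed
    with le2 have "norm k \<le> mu ?V ?E" by simp
    then show ?thesis using k by (simp add: signless_laplacian_radius_def)
  qed
qed

lemma energy_bij:
  assumes E: "edge_set V E" and f: "bij_betw f V W"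
  shows "energy ((`) f ` E) x = energy E (x \<circ> f)"
proof -
  have inj: "inj_on f V" using f by (simp add: bij_betw_def)
  have "inj_on ((`) f) E"
    using inj_on_image[of f "E"] edge_setD[OF E] inj
    by (metis (no_types, lifting) Sup_le_iff inj_on_subset)
  then have "energy ((`) f ` E) x = (\<Sum>e\<in>E. (\<Sum>u\<in>f ` e. x u)\<^sup>2)"
    unfolding energy_def by (simp add: sum.reindex)
  also have "\<dots> = energy E (x \<circ> f)" unfolding energy_def
  proof (rule sum.cong[OF refl])
    fix e assume "e \<in> E"
    then have "inj_on f e" using edge_setD[OF E] inj inj_on_subset by blast
    then show "(\<Sum>u\<in>f ` e. x u)\<^sup>2 = (\<Sum>u\<in>e. (x \<circ> f) u)\<^sup>2" by (simp add: sum.reindex)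
  qed
  finally show ?thesis .
qed

lemma edge_set_image:
  assumes E: "edge_set V E" and f: "bij_betw f V W"
  shows "edge_set W ((`) f ` E)"
  unfolding edge_set_def
proof (intro conjI ballI)
  show "finite W" using E f bij_betw_finite edge_set_def by blast
  fix e' assume "e' \<in> (`) f ` E"
  then obtain e where e: "e \<in> E" "e' = f ` e" by auto
  then have s: "e \<subseteq> V" "card e = 2" using edge_setD[OF E] by auto
  then show "e' \<subseteq> W" using e f by (auto simp: bij_betw_def)
  show "card e' = 2" using e s f by (metis bij_betw_def card_image inj_on_subset)
qed

lemma mu_bij_le:
  assumes E: "edge_set V E" and V: "V \<noteq> {}" and f: "bij_betw f V W"
  shows "mu W ((`) f ` E) \<le> mu V E"
proof -
  have W: "W \<noteq> {}" using f V by (auto simp: bij_betw_def)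
  obtain x where x: "norm_sq W x = 1" "energy ((`) f ` E) x = mu W ((`) f ` E)"
    using mu_attained(1)[OF edge_set_image[OF E f] W] by blast
  have "norm_sq V (x \<circ> f) = norm_sq W x" unfolding norm_sq_def
    using sum.reindex_bij_betw[OF f, of "\<lambda>v. (x v)\<^sup>2"] by simp
  then show ?thesis using mu_attained(2)[OF E V, of "x \<circ> f"] x energy_bij[OF E f, of x] by simp
qed

lemma mu_bij:
  assumes E: "edge_set V E" and V: "V \<noteq> {}" and f: "bij_betw f V W"
  shows "mu W ((`) f ` E) = mu V E"
proof (rule antisym[OF mu_bij_le[OF assms]])
  let ?g = "the_inv_into V f"
  have g: "bij_betw ?g W V" using f by (rule bij_betw_the_inv_into)
  have W: "W \<noteq> {}" using f V by (auto simp: bij_betw_def)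
  have "(`) ?g ` ((`) f ` E) = E"
  proof -
    have "?g ` f ` e = e" if "e \<in> E" for e
    proof -
      have "e \<subseteq> V" using edge_setD[OF E that] by simp
      then show ?thesis using f by (force simp: bij_betw_def the_inv_into_f_f image_image)
    qed
    then show ?thesis by (simp add: image_image)
  qed
  then show "mu V E \<le> mu W ((`) f ` E)"
    using mu_bij_le[OF edge_set_image[OF E f] W g] by simp
qed

text \<open>
  If an eigenvector \<open>x\<close> of \<open>E\<close> has at least as much energy on \<open>E'\<close>, whose maximum is not larger, then \<open>x\<close>
  attains that maximum and so is an eigenvector of \<open>E'\<close> as well. In contrapositive form this is how
  strict inequalities are obtained: it suffices to find one vertex at which the rows differ.
\<close>
lemma rows_eq_of_comparison:
  assumes E: "edge_set V E" and E': "edge_set V E'"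
    and rows: "\<And>v. v \<in> V \<Longrightarrow> Q_row E x v = mu V E * x v"
    and le: "energy E x \<le> energy E' x" and mu: "mu V E' \<le> mu V E" and v: "v \<in> V"
  shows "Q_row E' x v = Q_row E x v" and "mu V E' * norm_sq V x = mu V E * norm_sq V x"
proof -
  have ne: "V \<noteq> {}" using v by auto
  have "mu V E * norm_sq V x = energy E x" by (rule energy_eq_of_rows[OF E rows, symmetric])
  moreover have "energy E' x \<le> mu V E' * norm_sq V x" by (rule mu_attained(2)[OF E' ne])
  moreover have "mu V E' * norm_sq V x \<le> mu V E * norm_sq V x"
    by (intro mult_right_mono mu norm_sq_nonneg)
  ultimately have eq: "energy E' x = mu V E' * norm_sq V x" "mu V E' * norm_sq V x = mu V E * norm_sq V x" using le by linarith+
  show "mu V E' * norm_sq V x = mu V E * norm_sq V x" by (rule eq)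
  have "Q_row E' x v = mu V E' * x v" by (rule row_eq_of_energy_eq[OF E' v eq(1)])
  moreover have "norm_sq V x = 0 \<Longrightarrow> x v = 0"
    using v E by (simp add: norm_sq_def sum_nonneg_eq_0_iff edge_set_def)
  then have "mu V E' * x v = mu V E * x v" using eq(2) by auto
  ultimately show "Q_row E' x v = Q_row E x v" using rows[OF v] by simp
qed

section \<open>Graphs with a hub on a path\<close>

fun adj_sum :: "('a \<Rightarrow> 'a \<Rightarrow> real) \<Rightarrow> 'a list \<Rightarrow> real" where
  "adj_sum f (a # b # xs) = f a b + adj_sum f (b # xs)"
| "adj_sum f _ = 0"

lemma adj_sum_append:
  "xs \<noteq> [] \<Longrightarrow> ys \<noteq> [] \<Longrightarrow>
    adj_sum f (xs @ ys) = adj_sum f xs + f (last xs) (hd ys) + adj_sum f ys"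
proof (induction f xs rule: adj_sum.induct)
  case ("2_2" f v) then show ?case by (cases ys) auto
qed auto

lemma adj_sum_Cons: "ys \<noteq> [] \<Longrightarrow> adj_sum f (a # ys) = f a (hd ys) + adj_sum f ys"
  using adj_sum_append[of "[a]" ys f] by simp

lemma adj_sum_rev:
  assumes "\<And>a b. f a b = f b a"
  shows "adj_sum f (rev xs) = adj_sum f xs"
proof (induction xs)
  case (Cons a xs)
  show ?case
  proof (cases "xs = []")
    case False
    then show ?thesis using Cons assms[of a "hd xs"]
      by (simp add: adj_sum_append adj_sum_Cons last_rev)
  qed simp
qed simp

lemma path_edges_simps [simp]:
  "path_edges [] = {}" "path_edges [a] = {}"
  "path_edges (a # b # xs) = insert {a, b} (path_edges (b # xs))"
proof -
  show "path_edges [] = {}" "path_edges [a] = {}" by (simp_all add: path_edges_def)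
  show "path_edges (a # b # xs) = insert {a, b} (path_edges (b # xs))"
  proof (rule Set.set_eqI)
    fix e
    have "e \<in> path_edges (a # b # xs) \<longleftrightarrow>
        (\<exists>i < Suc (length xs). e = {(a # b # xs) ! i, (b # xs) ! i})"
      by (auto simp: path_edges_def)
    also have "\<dots> \<longleftrightarrow> e = {a, b} \<or> (\<exists>i < length xs. e = {(b # xs) ! i, xs ! i})"
      by (simp add: Ex_less_Suc2)
    also have "\<dots> \<longleftrightarrow> e \<in> insert {a, b} (path_edges (b # xs))"
      by (auto simp: path_edges_def)
    finally show "e \<in> path_edges (a # b # xs) \<longleftrightarrow> e \<in> insert {a, b} (path_edges (b # xs))" .
  qed
qed

lemma path_edges_append:
  "xs \<noteq> [] \<Longrightarrow> ys \<noteq> [] \<Longrightarrow>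
    path_edges (xs @ ys) = path_edges xs \<union> insert {last xs, hd ys} (path_edges ys)"
proof (induction xs rule: induct_list012)
  case (2 x) then show ?case by (cases ys) auto
qed auto

lemma path_edges_Cons: "ys \<noteq> [] \<Longrightarrow> path_edges (a # ys) = insert {a, hd ys} (path_edges ys)"
  using path_edges_append[of "[a]" ys] by simp

lemma path_edges_rev: "path_edges (rev xs) = path_edges xs"
proof (induction xs)
  case (Cons a xs)
  show ?case
  proof (cases "xs = []")
    case False
    then show ?thesis using Cons
      by (simp add: path_edges_append path_edges_Cons last_rev insert_commute)
  qed simp
qed simp

lemma path_edges_subset: "e \<in> path_edges xs \<Longrightarrow> e \<subseteq> set xs"
  by (auto simp: path_edges_def)

lemma path_edges_card: "distinct xs \<Longrightarrow> e \<in> path_edges xs \<Longrightarrow> card e = 2"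
  by (auto simp: path_edges_def nth_eq_iff_index_eq)

lemma finite_path_edges [simp]: "finite (path_edges xs)"
  by (induction xs rule: induct_list012) auto

lemma sum_path_edges:
  "distinct xs \<Longrightarrow> (\<Sum>e\<in>path_edges xs. \<phi> e) = adj_sum (\<lambda>a b. \<phi> {a, b}) xs"
proof (induction xs rule: induct_list012)
  case (3 a b xs)
  have "{a, b} \<notin> path_edges (b # xs)"
    using 3(3) path_edges_subset[of "{a, b}" "b # xs"] by auto
  then show ?case using 3 by simp
qed auto

definition off_path :: "'a set \<Rightarrow> 'a \<Rightarrow> 'a list \<Rightarrow> 'a list \<Rightarrow> 'a set" where
  "off_path V h A B = V - set (h # A @ B)"

text \<open>
  The lists \<open>A\<close> and \<open>B\<close> are the two tails of a path through the hub \<open>h\<close>, each listed from its vertex next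
  to \<open>h\<close> outwards. The edges in \<open>F\<close> are those that are neither on the path nor at the hub.
\<close>
definition hub_graph :: "'a set \<Rightarrow> 'a \<Rightarrow> 'a list \<Rightarrow> 'a list \<Rightarrow> 'a set set \<Rightarrow> 'a set set" where
  "hub_graph V h A B F =
     path_edges (h # A) \<union> path_edges (h # B) \<union> (\<lambda>u. {h, u}) ` off_path V h A B \<union> F"

text \<open>
  Requiring every edge of \<open>F\<close> to meet the complement of the path expresses that the path has no chord.
\<close>
definition hub_data :: "'a set \<Rightarrow> 'a \<Rightarrow> 'a list \<Rightarrow> 'a list \<Rightarrow> 'a set set \<Rightarrow> bool" where
  "hub_data V h A B F \<longleftrightarrow> finite V \<and> distinct (h # A @ B) \<and> set (h # A @ B) \<subseteq> V \<and>
     (\<forall>e\<in>F. card e = 2 \<and> e \<subseteq> V - {h} \<and> e \<inter> off_path V h A B \<noteq> {})"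

lemma hub_data_finite: "hub_data V h A B F \<Longrightarrow> finite F"
  unfolding hub_data_def by (intro finite_subset[of F "Pow V"]) auto

lemma sum_hub_graph:
  assumes D: "hub_data V h A B F"
  shows "(\<Sum>e\<in>hub_graph V h A B F. \<phi> e) = adj_sum (\<lambda>a b. \<phi> {a, b}) (h # A)
     + adj_sum (\<lambda>a b. \<phi> {a, b}) (h # B) + (\<Sum>u\<in>off_path V h A B. \<phi> {h, u}) + (\<Sum>e\<in>F. \<phi> e)"
proof -
  let ?O = "off_path V h A B"
  note d = D[unfolded hub_data_def]
  have dA: "distinct (h # A)" "distinct (h # B)" using d by auto
  have finO: "finite ?O" using d by (auto simp: off_path_def)
  have 1: "path_edges (h # A) \<inter> path_edges (h # B) = {}"
  proof (rule ccontr)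
    assume "\<not> ?thesis"
    then obtain e where e: "e \<in> path_edges (h # A)" "e \<in> path_edges (h # B)" by auto
    then have "e \<subseteq> set (h # A) \<inter> set (h # B)" using path_edges_subset by blast
    also have "\<dots> = {h}" using d by auto
    finally have "card e \<le> 1" using card_mono[of "{h}" e] by simp
    then show False using path_edges_card[OF dA(1) e(1)] by simp
  qed
  have 2: "(path_edges (h # A) \<union> path_edges (h # B)) \<inter> (\<lambda>u. {h, u}) ` ?O = {}"
    using path_edges_subset[of _ "h # A"] path_edges_subset[of _ "h # B"]
    by (fastforce simp: off_path_def)
  have 3: "(path_edges (h # A) \<union> path_edges (h # B) \<union> (\<lambda>u. {h, u}) ` ?O) \<inter> F = {}"
  proof -
    have "e \<notin> F" if "e \<in> path_edges (h # A) \<union> path_edges (h # B)" for e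
    proof -
      have "e \<subseteq> set (h # A @ B)" using that path_edges_subset[of e "h # A"] path_edges_subset[of e "h # B"] by auto
      then have "e \<inter> ?O = {}" by (auto simp: off_path_def)
      then show ?thesis using d by blast
    qed
    moreover have "{h, u} \<notin> F" for u using d by blast
    ultimately show ?thesis by blast
  qed
  have inj: "inj_on (\<lambda>u. {h, u}) ?O" by (auto simp: inj_on_def doubleton_eq_iff)
  show ?thesis unfolding hub_graph_def
    using 1 2 3 finO hub_data_finite[OF D]
    by (simp add: sum.union_disjoint sum_path_edges[OF dA(1)] sum_path_edges[OF dA(2)]
        sum.reindex[OF inj] del: path_edges_simps)
qed

definition path_energy :: "('a \<Rightarrow> real) \<Rightarrow> 'a list \<Rightarrow> real" where
  "path_energy x = adj_sum (\<lambda>a b. (x a + x b)\<^sup>2)"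

definition path_row :: "('a \<Rightarrow> real) \<Rightarrow> 'a \<Rightarrow> 'a list \<Rightarrow> real" where
  "path_row x v = adj_sum (\<lambda>a b. if v = a \<or> v = b then x a + x b else 0)"

lemma path_energy_simps [simp]:
  "path_energy x [] = 0" "path_energy x [a] = 0"
  "path_energy x (a # b # xs) = (x a + x b)\<^sup>2 + path_energy x (b # xs)"
  by (simp_all add: path_energy_def)

lemma path_energy_append:
  "xs \<noteq> [] \<Longrightarrow> ys \<noteq> [] \<Longrightarrow>
    path_energy x (xs @ ys) = path_energy x xs + (x (last xs) + x (hd ys))\<^sup>2 + path_energy x ys"
  by (simp add: path_energy_def adj_sum_append)

lemma path_energy_Cons:
  "ys \<noteq> [] \<Longrightarrow> path_energy x (a # ys) = (x a + x (hd ys))\<^sup>2 + path_energy x ys"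
  by (simp add: path_energy_def adj_sum_Cons)

lemma path_energy_rev: "path_energy x (rev xs) = path_energy x xs"
  unfolding path_energy_def by (rule adj_sum_rev) (simp add: add.commute)

lemma path_row_simps [simp]:
  "path_row x v [] = 0" "path_row x v [a] = 0"
  "path_row x v (a # b # xs) = (if v = a \<or> v = b then x a + x b else 0) + path_row x v (b # xs)"
  by (simp_all add: path_row_def)

lemma path_row_append:
  "xs \<noteq> [] \<Longrightarrow> ys \<noteq> [] \<Longrightarrow> path_row x v (xs @ ys) = path_row x v xs
     + (if v = last xs \<or> v = hd ys then x (last xs) + x (hd ys) else 0) + path_row x v ys"
  by (simp add: path_row_def adj_sum_append)

lemma path_row_Cons:
  "ys \<noteq> [] \<Longrightarrow> path_row x v (a # ys) =
     (if v = a \<or> v = hd ys then x a + x (hd ys) else 0) + path_row x v ys"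
  by (simp add: path_row_def adj_sum_Cons)

lemma path_row_notin: "v \<notin> set xs \<Longrightarrow> path_row x v xs = 0"
  by (induction xs rule: induct_list012) auto

lemma energy_path_edges: "distinct xs \<Longrightarrow> energy (path_edges xs) x = path_energy x xs"
proof -
  have "adj_sum (\<lambda>a b. (\<Sum>u\<in>{a, b}. x u)\<^sup>2) xs = path_energy x xs" if "distinct xs"
    using that by (induction xs rule: induct_list012) auto
  then show "distinct xs \<Longrightarrow> energy (path_edges xs) x = path_energy x xs"
    by (simp add: energy_def sum_path_edges)
qed

lemma row_eq_sum: "finite E \<Longrightarrow> Q_row E x v = (\<Sum>e\<in>E. if v \<in> e then \<Sum>u\<in>e. x u else 0)"
  by (simp add: Q_row_def sum.inter_filter)

lemma energy_hub_graph:
  assumes D: "hub_data V h A B F"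
  shows "energy (hub_graph V h A B F) x = path_energy x (h # A) + path_energy x (h # B)
     + (\<Sum>u\<in>off_path V h A B. (x h + x u)\<^sup>2) + energy F x"
proof -
  have d: "distinct (h # A)" "distinct (h # B)" using D by (auto simp: hub_data_def)
  have "(\<Sum>u\<in>off_path V h A B. (\<Sum>w\<in>{h, u}. x w)\<^sup>2) = (\<Sum>u\<in>off_path V h A B. (x h + x u)\<^sup>2)"
    by (rule sum.cong[OF refl]) (auto simp: off_path_def)
  then show ?thesis
    using sum_hub_graph[OF D, of "\<lambda>e. (\<Sum>u\<in>e. x u)\<^sup>2"]
      sum_path_edges[OF d(1), of "\<lambda>e. (\<Sum>u\<in>e. x u)\<^sup>2"] energy_path_edges[OF d(1)]
      sum_path_edges[OF d(2), of "\<lambda>e. (\<Sum>u\<in>e. x u)\<^sup>2"] energy_path_edges[OF d(2)]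
    by (simp add: energy_def)
qed

lemma hub_graph_edge_set:
  assumes D: "hub_data V h A B F"
  shows "edge_set V (hub_graph V h A B F)"
proof -
  note d = D[unfolded hub_data_def]
  have dA: "distinct (h # A)" "distinct (h # B)" using d by auto
  show ?thesis unfolding edge_set_def
  proof (intro conjI ballI)
    fix e assume "e \<in> hub_graph V h A B F"
    then consider "e \<in> path_edges (h # A)" | "e \<in> path_edges (h # B)"
      | u where "u \<in> off_path V h A B" "e = {h, u}" | "e \<in> F"
      unfolding hub_graph_def by blast
    then have "e \<subseteq> V \<and> card e = 2"
    proof cases
      case 1 then show ?thesis using path_edges_subset[OF 1] path_edges_card[OF dA(1) 1] d by auto
    next
      case 2 then show ?thesis using path_edges_subset[OF 2] path_edges_card[OF dA(2) 2] d by auto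
    next
      case 3 then show ?thesis using d by (auto simp: off_path_def)
    next
      case 4 then show ?thesis using d by blast
    qed
    then show "e \<subseteq> V" "card e = 2" by auto
  qed (use d in auto)
qed

lemma row_hub_graph:
  assumes D: "hub_data V h A B F"
  shows "Q_row (hub_graph V h A B F) x v = path_row x v (h # A) + path_row x v (h # B)
     + (\<Sum>u\<in>off_path V h A B. if v = h \<or> v = u then x h + x u else 0) + Q_row F x v"
proof -
  have d: "distinct (h # A)" "distinct (h # B)" using D by (auto simp: hub_data_def)
  let ?f = "\<lambda>e. if v \<in> e then \<Sum>u\<in>e. x u else 0"
  have p: "adj_sum (\<lambda>a b. ?f {a, b}) xs = path_row x v xs" if "distinct xs" for xs
    using that by (induction xs rule: induct_list012) auto
  have "(\<Sum>u\<in>off_path V h A B. ?f {h, u}) =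
      (\<Sum>u\<in>off_path V h A B. if v = h \<or> v = u then x h + x u else 0)"
    by (rule sum.cong[OF refl]) (auto simp: off_path_def)
  then show ?thesis
    using sum_hub_graph[OF D, of ?f] p[OF d(1)] p[OF d(2)]
      edge_set_finite[OF hub_graph_edge_set[OF D]] hub_data_finite[OF D]
    by (simp add: row_eq_sum)
qed

lemma row_hub_graph_hub:
  assumes D: "hub_data V h A B F"
  shows "Q_row (hub_graph V h A B F) x h =
     (if A = [] then 0 else x h + x (hd A)) + (if B = [] then 0 else x h + x (hd B))
     + (\<Sum>u\<in>off_path V h A B. x h + x u)"
proof -
  have h: "h \<notin> set A" "h \<notin> set B" using D by (auto simp: hub_data_def)
  have "Q_row F x h = 0"
  proof -
    have "{e \<in> F. h \<in> e} = {}" using D by (auto simp: hub_data_def)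
    then show ?thesis unfolding Q_row_def by (simp only: sum.empty)
  qed
  moreover have "path_row x h (h # A) = (if A = [] then 0 else x h + x (hd A))"
    using h by (cases A) (simp_all add: path_row_notin)
  moreover have "path_row x h (h # B) = (if B = [] then 0 else x h + x (hd B))"
    using h by (cases B) (simp_all add: path_row_notin)
  ultimately show ?thesis using row_hub_graph[OF D, of x h] by simp
qed

lemma reach_sym:
  assumes "(u, v) \<in> {(u, v). {u, v} \<in> E}\<^sup>*"
  shows "(v, u) \<in> {(u, v). {u, v} \<in> E}\<^sup>*"
proof -
  have "sym {(u, v). {u, v} \<in> E}" by (auto simp: sym_def insert_commute)
  then show ?thesis using assms by (meson sym_rtrancl symD)
qed

lemma reach_path:
  assumes "path_edges (h # A) \<subseteq> E" "v \<in> set (h # A)"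
  shows "(h, v) \<in> {(u, v). {u, v} \<in> E}\<^sup>*"
  using assms
proof (induction A arbitrary: h)
  case (Cons a A)
  show ?case
  proof (cases "v = h")
    case False
    then have "(a, v) \<in> {(u, v). {u, v} \<in> E}\<^sup>*" using Cons by auto
    moreover have "(h, a) \<in> {(u, v). {u, v} \<in> E}" using Cons by auto
    ultimately show ?thesis by (meson converse_rtrancl_into_rtrancl)
  qed simp
qed auto

lemma hub_graph_connected:
  assumes D: "hub_data V h A B F" and "u \<in> V" "v \<in> V"
  shows "(u, v) \<in> {(u, v). {u, v} \<in> hub_graph V h A B F}\<^sup>*"
proof -
  let ?R = "{(u, v). {u, v} \<in> hub_graph V h A B F}\<^sup>*"
  have "(h, v) \<in> ?R" if v: "v \<in> V" for v
  proof -
    consider "v \<in> set (h # A)" | "v \<in> set (h # B)" | "v \<in> off_path V h A B"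
      using v unfolding off_path_def by auto
    then show ?thesis
    proof cases
      case 1 then show ?thesis by (intro reach_path[of h A]) (auto simp: hub_graph_def)
    next
      case 2 then show ?thesis by (intro reach_path[of h B]) (auto simp: hub_graph_def)
    next
      case 3 then show ?thesis by (intro r_into_rtrancl) (auto simp: hub_graph_def)
    qed
  qed
  then have "(h, u) \<in> ?R" "(h, v) \<in> ?R" using assms by auto
  then show ?thesis using reach_sym[of h u] by (meson rtrancl_trans)
qed

lemma hub_graph_perron:
  assumes D: "hub_data V h A B F"
  obtains x where "\<And>v. v \<in> V \<Longrightarrow> x v > 0"
    "\<And>v. v \<in> V \<Longrightarrow> Q_row (hub_graph V h A B F) x v = mu V (hub_graph V h A B F) * x v"
proof -
  have "V \<noteq> {}" using D by (auto simp: hub_data_def)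
  then show thesis
    using perron_vector_exists[OF hub_graph_edge_set[OF D] _ hub_graph_connected[OF D]] that by blast
qed

section \<open>Balancing the tails\<close>

lemma mu_less_of_comparison:
  assumes E: "edge_set V E" and E': "edge_set V E'"
    and rows: "\<And>v. v \<in> V \<Longrightarrow> Q_row E x v = mu V E * x v"
    and le: "energy E x \<le> energy E' x" and v: "v \<in> V" "Q_row E x v \<noteq> Q_row E' x v"
  shows "mu V E < mu V E'"
  using rows_eq_of_comparison(1)[OF E E' rows le _ v(1)] v(2) by force

text \<open>
  The graph \<open>\<Theta>\<^sub>3(s; a, b)\<close>, with \<open>w\<^sub>2 = h\<close> and \<open>w\<^sub>4 = c\<close>, whose pendant paths are \<open>A\<close> and \<open>C\<close>, and with \<open>a1\<close>
  and \<open>a2\<close> in the places of \<open>w\<^sub>1\<close> and \<open>w\<^sub>3\<close>. The other vertices off the path are the \<open>s\<close> pendant ones.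
\<close>
definition theta_graph :: "'a set \<Rightarrow> 'a \<Rightarrow> 'a list \<Rightarrow> 'a \<Rightarrow> 'a list \<Rightarrow> 'a \<Rightarrow> 'a \<Rightarrow> 'a set set" where
  "theta_graph V h A c C a1 a2 = hub_graph V h A (c # C) {{a1, c}, {a2, c}}"

definition theta_data :: "'a set \<Rightarrow> 'a \<Rightarrow> 'a list \<Rightarrow> 'a \<Rightarrow> 'a list \<Rightarrow> 'a \<Rightarrow> 'a \<Rightarrow> bool" where
  "theta_data V h A c C a1 a2 \<longleftrightarrow> finite V \<and> distinct (h # A @ c # C) \<and> set (h # A @ c # C) \<subseteq> V \<and>
     a1 \<noteq> a2 \<and> {a1, a2} \<subseteq> off_path V h A (c # C)"

definition is_theta :: "'a set \<Rightarrow> nat \<Rightarrow> nat \<Rightarrow> 'a set set \<Rightarrow> bool" where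
  "is_theta V a b E \<longleftrightarrow> (\<exists>h A c C a1 a2. theta_data V h A c C a1 a2 \<and>
     length A = a \<and> length C = b \<and> E = theta_graph V h A c C a1 a2)"

lemma theta_hub_data:
  "theta_data V h A c C a1 a2 \<Longrightarrow> hub_data V h A (c # C) {{a1, c}, {a2, c}}"
  by (auto simp: theta_data_def hub_data_def off_path_def)

lemma theta_edge_set: "theta_data V h A c C a1 a2 \<Longrightarrow> edge_set V (theta_graph V h A c C a1 a2)"
  unfolding theta_graph_def by (intro hub_graph_edge_set theta_hub_data)

lemma sum_off_path_split:
  fixes f :: "'a \<Rightarrow> real"
  assumes "theta_data V h A c C a1 a2"
  shows "(\<Sum>u\<in>off_path V h A (c # C). f u) =
    (\<Sum>u\<in>off_path V h A (c # C) - {a1, a2}. f u) + f a1 + f a2"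
proof -
  let ?O = "off_path V h A (c # C)"
  have "finite ?O" using assms by (auto simp: theta_data_def off_path_def)
  moreover have a: "a1 \<in> ?O" "a2 \<in> ?O - {a1}" using assms by (auto simp: theta_data_def)
  moreover have "?O - {a1} - {a2} = ?O - {a1, a2}" by auto
  ultimately show ?thesis
    using sum.remove[of ?O a1 f] sum.remove[of "?O - {a1}" a2 f] by simp
qed

lemma energy_theta:
  assumes D: "theta_data V h A c C a1 a2"
  shows "energy (theta_graph V h A c C a1 a2) x =
     path_energy x (h # A) + (x h + x c)\<^sup>2 + path_energy x (c # C)
     + (\<Sum>u\<in>off_path V h A (c # C) - {a1, a2}. (x h + x u)\<^sup>2)
     + (x h + x a1)\<^sup>2 + (x h + x a2)\<^sup>2 + (x c + x a1)\<^sup>2 + (x c + x a2)\<^sup>2"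
proof -
  have d: "a1 \<noteq> a2" "c \<noteq> a1" "c \<noteq> a2" using D by (auto simp: theta_data_def off_path_def)
  then have "energy {{a1, c}, {a2, c}} x = (x c + x a1)\<^sup>2 + (x c + x a2)\<^sup>2"
    by (simp add: energy_def doubleton_eq_iff add.commute)
  then show ?thesis
    unfolding theta_graph_def energy_hub_graph[OF theta_hub_data[OF D]]
    by (simp add: sum_off_path_split[OF D])
qed

lemma row_theta:
  assumes D: "theta_data V h A c C a1 a2"
  shows "Q_row (theta_graph V h A c C a1 a2) x v =
     path_row x v (h # A) + (if v = h \<or> v = c then x h + x c else 0) + path_row x v (c # C)
     + (\<Sum>u\<in>off_path V h A (c # C) - {a1, a2}. if v = h \<or> v = u then x h + x u else 0)
     + (if v = h \<or> v = a1 then x h + x a1 else 0) + (if v = h \<or> v = a2 then x h + x a2 else 0)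
     + (if v = c \<or> v = a1 then x c + x a1 else 0) + (if v = c \<or> v = a2 then x c + x a2 else 0)"
proof -
  have d: "a1 \<noteq> a2" "c \<noteq> a1" "c \<noteq> a2" using D by (auto simp: theta_data_def off_path_def)
  then have "Q_row {{a1, c}, {a2, c}} x v =
     (if v = c \<or> v = a1 then x c + x a1 else 0) + (if v = c \<or> v = a2 then x c + x a2 else 0)"
    by (subst row_eq_sum) (auto simp: doubleton_eq_iff)
  then show ?thesis
    unfolding theta_graph_def row_hub_graph[OF theta_hub_data[OF D]]
    by (simp add: sum_off_path_split[OF D])
qed

lemma theta_perron:
  assumes D: "theta_data V h A c C a1 a2"
  obtains x where "\<And>v. v \<in> V \<Longrightarrow> x v > 0"
    "\<And>v. v \<in> V \<Longrightarrow> Q_row (theta_graph V h A c C a1 a2) x v = mu V (theta_graph V h A c C a1 a2) * x v"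
  using hub_graph_perron[OF theta_hub_data[OF D]] that unfolding theta_graph_def by blast

text \<open>
  Compare the lists entry by entry, beginning with \<open>x (hd X) \<le> x (hd Y)\<close>. Either this order persists
  until \<open>Y\<close> is exhausted, or there is a first position where it is reversed; cut both lists there.
\<close>
lemma tail_split:
  fixes x :: "'a \<Rightarrow> real"
  assumes "length Y < length X" "Y \<noteq> []" "x (hd X) \<le> x (hd Y)"
  shows "\<exists>X1 X2 Y1 Y2. X = X1 @ X2 \<and> Y = Y1 @ Y2 \<and> length X1 = length Y1 \<and> X1 \<noteq> [] \<and> X2 \<noteq> [] \<and>
     x (last X1) \<le> x (last Y1) \<and> (Y2 = [] \<or> x (hd Y2) < x (hd X2))"
  using assms
proof (induction Y arbitrary: X)
  case (Cons y Y)
  obtain z X' where X: "X = z # X'" using Cons.prems by (cases X) auto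
  then have "X' \<noteq> []" using Cons.prems by auto
  note X = X this
  show ?case
  proof (cases "Y = [] \<or> x (hd Y) < x (hd X')")
    case True
    then show ?thesis using Cons.prems X
      by (intro exI[of _ "[z]"] exI[of _ X'] exI[of _ "[y]"] exI[of _ Y]) auto
  next
    case False
    then obtain X1 X2 Y1 Y2 where "X' = X1 @ X2" "Y = Y1 @ Y2" "length X1 = length Y1" "X1 \<noteq> []" "X2 \<noteq> []"
      "x (last X1) \<le> x (last Y1)" "Y2 = [] \<or> x (hd Y2) < x (hd X2)"
      using Cons.IH[of X'] Cons.prems X by auto
    then show ?thesis using X
      by (intro exI[of _ "z # X1"] exI[of _ X2] exI[of _ "y # Y1"] exI[of _ Y2]) auto
  qed
qed simp

text \<open>
  The rearrangement inequality for two products.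
\<close>
lemma swap_squares:
  fixes l m y z :: real
  assumes "l \<le> m" "z \<le> y"
  shows "(l + y)\<^sup>2 + (m + z)\<^sup>2 \<le> (l + z)\<^sup>2 + (m + y)\<^sup>2"
proof -
  have "(l + z)\<^sup>2 + (m + y)\<^sup>2 - ((l + y)\<^sup>2 + (m + z)\<^sup>2) = 2 * ((m - l) * (y - z))"
    by (simp add: power2_eq_square algebra_simps)
  moreover have "(m - l) * (y - z) \<ge> 0" using assms by simp
  ultimately show ?thesis by linarith
qed

text \<open>
  Exchanging the end pieces \<open>X2\<close> and \<open>Y2\<close> only replaces the two edges in front of them.
\<close>
lemma swap_path_energy:
  fixes x :: "'a \<Rightarrow> real"
  assumes "X1 \<noteq> []" "X2 \<noteq> []" "Y1 \<noteq> []" "x (last X1) \<le> x (last Y1)" "Y2 = [] \<or> x (hd Y2) \<le> x (hd X2)"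
    and pos: "x (last X1) > 0" "x (hd X2) > 0"
  shows "path_energy x (X1 @ X2) + path_energy x (Y1 @ Y2) \<le> path_energy x (X1 @ Y2) + path_energy x (Y1 @ X2)"
proof (cases "Y2 = []")
  case True
  have "(x (last X1) + x (hd X2))\<^sup>2 \<le> (x (last Y1) + x (hd X2))\<^sup>2"
    using assms by (intro power_mono) auto
  then show ?thesis using assms True by (simp add: path_energy_append)
next
  case False
  then show ?thesis using assms swap_squares[of "x (last X1)" "x (last Y1)" "x (hd Y2)" "x (hd X2)"]
    by (simp add: path_energy_append)
qed

lemma swap_path_row:
  fixes x :: "'a \<Rightarrow> real"
  assumes "X1 \<noteq> []" "X2 \<noteq> []" "Y1 \<noteq> []" "Y2 = [] \<or> x (hd Y2) < x (hd X2)"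
    and dist: "distinct ((X1 @ X2) @ (Y1 @ Y2))" and pos: "x (last Y1) > 0" "x (hd X2) > 0"
    and v: "v = last Y1"
  shows "path_row x v (X1 @ X2) + path_row x v (Y1 @ Y2) < path_row x v (X1 @ Y2) + path_row x v (Y1 @ X2)"
proof -
  have vY: "v \<in> set Y1" using assms by simp
  then have n: "v \<notin> set X1" "v \<notin> set X2" "v \<notin> set Y2" using dist by auto
  then have "v \<noteq> last X1" "v \<noteq> hd X2" "Y2 \<noteq> [] \<Longrightarrow> v \<noteq> hd Y2"
    using assms by (metis last_in_set, metis hd_in_set, metis hd_in_set)
  then show ?thesis using assms n
    by (cases "Y2 = []") (auto simp: path_row_append path_row_notin)
qed

lemma theta_swap_tails:
  assumes D: "theta_data V h A c C a1 a2" 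
    and lists: "h # A = P1 @ P2" "c # C = Q1 @ Q2" "P1 \<noteq> []" "Q1 \<noteq> []"
      "h # A' = P1 @ Q2" "c # C' = Q1 @ P2"
  shows "theta_data V h A' c C' a1 a2" "off_path V h A' (c # C') = off_path V h A (c # C)"
proof -
  have s: "set (h # A' @ c # C') = set (h # A @ c # C)"
  proof -
    have "set (h # A' @ c # C') = set (h # A') \<union> set (c # C')"
      "set (h # A @ c # C) = set (h # A) \<union> set (c # C)" by auto
    then show ?thesis unfolding lists by auto
  qed
  then show o: "off_path V h A' (c # C') = off_path V h A (c # C)" unfolding off_path_def by simp
  have "distinct ((h # A) @ (c # C))" using D by (simp add: theta_data_def)
  then have "distinct ((h # A') @ (c # C'))" unfolding lists by auto
  then show "theta_data V h A' c C' a1 a2"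
    using D s o unfolding theta_data_def by simp
qed

text \<open>
  Let \<open>p\<close> be the neighbour of \<open>h\<close> on the tail \<open>A\<close>. If \<open>x c < x p\<close>, let \<open>p\<close> and \<open>c\<close> exchange their roles
  by moving the edges to \<open>a1\<close> and \<open>a2\<close>. Otherwise compare the tail \<open>A\<close>, starting at \<open>p\<close>, with the shorter
  list \<open>c # C\<close> and exchange the end pieces at the place provided by \<open>tail_split\<close>. In both cases the
  new tail lengths are \<open>b + 1\<close> and \<open>a - 1\<close>.
\<close>
lemma theta_balance_hub_tail:
  assumes T: "is_theta V a b E" and ab: "a \<ge> b + 2"
  shows "\<exists>E'. is_theta V (b + 1) (a - 1) E' \<and> mu V E < mu V E'"
proof -
  obtain h A c C a1 a2 where D: "theta_data V h A c C a1 a2" and len: "length A = a" "length C = b"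
    and E: "E = theta_graph V h A c C a1 a2" using T unfolding is_theta_def by blast
  obtain x where pos: "\<And>v. v \<in> V \<Longrightarrow> x v > 0"
    and rows: "\<And>v. v \<in> V \<Longrightarrow> Q_row E x v = mu V E * x v"
    using theta_perron[OF D] unfolding E by blast
  note d = D[unfolded theta_data_def off_path_def]
  have ES: "edge_set V E" unfolding E by (rule theta_edge_set[OF D])
  obtain p A1 where A: "A = p # A1" using len ab by (cases A) auto
  show ?thesis
  proof (cases "x (hd A) \<le> x c")
    case False
    then have pc: "x c < x p" by (simp add: A)
    let ?E' = "theta_graph V h (c # C) p A1 a1 a2"
    have O: "off_path V h (c # C) (p # A1) = off_path V h A (c # C)" by (auto simp: off_path_def A)
    have D': "theta_data V h (c # C) p A1 a1 a2"
      using D unfolding theta_data_def O by (auto simp: A)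
    have "energy E x \<le> energy ?E' x"
    proof -
      have "(x c + x u)\<^sup>2 \<le> (x p + x u)\<^sup>2" if "u = a1 \<or> u = a2" for u
        using pc pos[of u] pos[of c] that d by (intro power_mono) auto
      from this[of a1] this[of a2] show ?thesis
        unfolding E energy_theta[OF D] energy_theta[OF D'] O by (simp add: A)
    qed
    moreover have "Q_row E x p \<noteq> Q_row ?E' x p"
    proof -
      have ne: "p \<noteq> h" "p \<noteq> c" "p \<noteq> a1" "p \<noteq> a2" "p \<notin> set C" "p \<notin> off_path V h A (c # C)"
        using d by (auto simp: A off_path_def)
      have 0: "(\<Sum>u\<in>off_path V h A (c # C) - {a1, a2}. if p = h \<or> p = u then x h + x u else 0) = 0"
        using ne by (intro sum.neutral) auto
      have "x p + x a1 + (x p + x a2) > 0" using pos[of p] pos[of a1] pos[of a2] d by (simp add: A)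
      then show ?thesis unfolding E row_theta[OF D] row_theta[OF D'] O 0 using ne
        by (simp add: A path_row_notin add.commute)
    qed
    ultimately have "mu V E < mu V ?E'"
      using d by (intro mu_less_of_comparison[OF ES theta_edge_set[OF D'] rows, of p]) (auto simp: A)
    moreover have "is_theta V (b + 1) (a - 1) ?E'"
      unfolding is_theta_def using D' len A by fastforce
    ultimately show ?thesis by blast
  next
    case True
    then obtain X1 X2 Y1 Y2 where S: "A = X1 @ X2" "c # C = Y1 @ Y2" "length X1 = length Y1"
      "X1 \<noteq> []" "X2 \<noteq> []" "x (last X1) \<le> x (last Y1)" "Y2 = [] \<or> x (hd Y2) < x (hd X2)"
      using tail_split[of "c # C" A x] len ab by auto
    have Y1: "Y1 \<noteq> []" using S by auto
    then obtain C' where C': "c # C' = Y1 @ X2" using S(2) by (cases Y1) auto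
    let ?A' = "X1 @ Y2" and ?E' = "theta_graph V h (X1 @ Y2) c C' a1 a2"
    have L: "h # A = (h # X1) @ X2" "h # ?A' = (h # X1) @ Y2" using S by auto
    note D' = theta_swap_tails(1)[OF D L(1) S(2) _ Y1 L(2) C', simplified]
    note O = theta_swap_tails(2)[OF D L(1) S(2) _ Y1 L(2) C', simplified]
    have in_V: "last X1 \<in> V" "hd X2 \<in> V" "last Y1 \<in> V"
    proof -
      have "set A \<subseteq> V" "set (c # C) \<subseteq> V" using d by auto
      then show "last X1 \<in> V" "hd X2 \<in> V" "last Y1 \<in> V"
        using S Y1 last_in_set[of X1] hd_in_set[of X2] last_in_set[of Y1] by auto
    qed
    have "path_energy x (h # A) + path_energy x (c # C) \<le> path_energy x (h # ?A') + path_energy x (c # C')"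
      unfolding L C' S(2) using S Y1 in_V pos by (intro swap_path_energy) auto
    then have "energy E x \<le> energy ?E' x"
      unfolding E energy_theta[OF D] energy_theta[OF D'] O by simp
    moreover have "Q_row E x (last Y1) \<noteq> Q_row ?E' x (last Y1)"
    proof -
      have "distinct ((h # A) @ (c # C))" using d by simp
      then have "distinct (((h # X1) @ X2) @ (Y1 @ Y2))" by (simp only: L(1) S(2))
      then have "path_row x (last Y1) (h # A) + path_row x (last Y1) (c # C)
          < path_row x (last Y1) (h # ?A') + path_row x (last Y1) (c # C')"
        unfolding L C' S(2) using S Y1 in_V pos by (intro swap_path_row) auto
      then show ?thesis
        unfolding E row_theta[OF D] row_theta[OF D'] O by simp
    qed
    ultimately have "mu V E < mu V ?E'"
      using in_V by (intro mu_less_of_comparison[OF ES theta_edge_set[OF D'] rows]) auto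
    moreover have "is_theta V (b + 1) (a - 1) ?E'"
    proof -
      have "length ?A' = b + 1" "length C' = a - 1"
        using arg_cong[OF S(1), of length] arg_cong[OF S(2), of length] arg_cong[OF C', of length] S(3) len
        by auto
      then show ?thesis unfolding is_theta_def using D' by blast
    qed
    ultimately show ?thesis by blast
  qed
qed

text \<open>
  If \<open>x c \<le> x h\<close>, exchange end pieces of the lists \<open>c # C\<close> and \<open>h # A\<close>. If \<open>x h < x c\<close>, move the pendant
  vertices from \<open>h\<close> to \<open>c\<close>; when there are none, the graph already has the other shape with \<open>h\<close> and \<open>c\<close>
  exchanged, which is why the conclusion is a disjunction.
\<close>
lemma theta_balance_far_tail:
  assumes T: "is_theta V a b E" and ab: "a < b"
  shows "is_theta V b a E \<or> (\<exists>E'. is_theta V b a E' \<and> mu V E < mu V E')"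
proof -
  obtain h A c C a1 a2 where D: "theta_data V h A c C a1 a2" and len: "length A = a" "length C = b"
    and E: "E = theta_graph V h A c C a1 a2" using T unfolding is_theta_def by blast
  obtain x where pos: "\<And>v. v \<in> V \<Longrightarrow> x v > 0"
    and rows: "\<And>v. v \<in> V \<Longrightarrow> Q_row E x v = mu V E * x v"
    using theta_perron[OF D] unfolding E by blast
  note d = D[unfolded theta_data_def off_path_def]
  have ES: "edge_set V E" unfolding E by (rule theta_edge_set[OF D])
  show ?thesis
  proof (cases "x c \<le> x h")
    case False
    let ?E' = "theta_graph V c C h A a1 a2"
    let ?R = "off_path V h A (c # C) - {a1, a2}"
    have O: "off_path V c C (h # A) = off_path V h A (c # C)" by (auto simp: off_path_def)
    have D': "theta_data V c C h A a1 a2"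
      using D unfolding theta_data_def O by auto
    have T': "is_theta V b a ?E'" unfolding is_theta_def using D' len by blast
    show ?thesis
    proof (cases "?R = {}")
      case True
      have "off_path V h A (c # C) = {a1, a2}" using True D unfolding theta_data_def by blast
      then have "E = ?E'"
        unfolding E theta_graph_def hub_graph_def O
        by (auto simp: path_edges_Cons insert_commute)
      then show ?thesis using T' by simp
    next
      case False
      have in_V: "u \<in> V" if "u \<in> ?R" for u using that by (auto simp: off_path_def)
      have hc: "x h < x c" using \<open>\<not> x c \<le> x h\<close> by simp
      have hV: "h \<in> V" "c \<in> V" using d by auto
      have "(\<Sum>u\<in>?R. (x h + x u)\<^sup>2) \<le> (\<Sum>u\<in>?R. (x c + x u)\<^sup>2)"
        using hc pos[OF hV(1)] pos[OF in_V] by (intro sum_mono power_mono) (auto simp: less_imp_le)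
      then have "energy E x \<le> energy ?E' x"
        unfolding E energy_theta[OF D] energy_theta[OF D'] O by (simp add: add.commute)
      moreover have "Q_row E x c \<noteq> Q_row ?E' x c"
      proof -
        have ne: "c \<noteq> h" "c \<noteq> a1" "c \<noteq> a2" "c \<notin> set A" "c \<notin> ?R" using d by (auto simp: off_path_def)
        have 0: "(\<Sum>u\<in>?R. if c = h \<or> c = u then x h + x u else 0) = 0"
          using ne by (intro sum.neutral) auto
        have "finite ?R" using d by (auto simp: off_path_def)
        then have 1: "(\<Sum>u\<in>?R. x c + x u) > 0"
          using False pos[OF hV(2)] pos[OF in_V] by (intro sum_pos) (auto intro: add_pos_pos)
        have p: "path_row x c (h # A) = 0" using ne by (intro path_row_notin) auto
        show ?thesis
          unfolding E row_theta[OF D] row_theta[OF D'] O 0 p using ne 1 by simp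
      qed
      ultimately have "mu V E < mu V ?E'"
        using hV by (intro mu_less_of_comparison[OF ES theta_edge_set[OF D'] rows, of c]) auto
      then show ?thesis using T' by blast
    qed
  next
    case True
    then obtain X1 X2 Y1 Y2 where S: "c # C = X1 @ X2" "h # A = Y1 @ Y2" "length X1 = length Y1"
      "X1 \<noteq> []" "X2 \<noteq> []" "x (last X1) \<le> x (last Y1)" "Y2 = [] \<or> x (hd Y2) < x (hd X2)"
      using tail_split[of "h # A" "c # C" x] len ab by auto
    have Y1: "Y1 \<noteq> []" using S by auto
    obtain C' where C': "c # C' = X1 @ Y2" using S by (cases X1) auto
    obtain A' where A': "h # A' = Y1 @ X2" using S Y1 by (cases Y1) auto
    let ?E' = "theta_graph V h A' c C' a1 a2"
    note D' = theta_swap_tails(1)[OF D S(2) S(1) Y1 S(4) A' C', simplified]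
    note O = theta_swap_tails(2)[OF D S(2) S(1) Y1 S(4) A' C', simplified]
    have in_V: "last X1 \<in> V" "hd X2 \<in> V" "last Y1 \<in> V"
    proof -
      have "set (h # A) \<subseteq> V" "set (c # C) \<subseteq> V" using d by auto
      then show "last X1 \<in> V" "hd X2 \<in> V" "last Y1 \<in> V"
        unfolding S using S Y1 last_in_set[of X1] hd_in_set[of X2] last_in_set[of Y1] by auto
    qed
    have "path_energy x (c # C) + path_energy x (h # A) \<le> path_energy x (c # C') + path_energy x (h # A')"
      unfolding A' C' S(1,2) using S Y1 in_V pos by (intro swap_path_energy) auto
    then have "energy E x \<le> energy ?E' x"
      unfolding E energy_theta[OF D] energy_theta[OF D'] O by simp
    moreover have "Q_row E x (last Y1) \<noteq> Q_row ?E' x (last Y1)"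
    proof -
      have "distinct ((c # C) @ (h # A))" using d by auto
      then have "distinct ((X1 @ X2) @ (Y1 @ Y2))" by (simp only: S(1,2))
      then have "path_row x (last Y1) (c # C) + path_row x (last Y1) (h # A)
          < path_row x (last Y1) (c # C') + path_row x (last Y1) (h # A')"
        unfolding A' C' S(1,2) using S Y1 in_V pos by (intro swap_path_row) auto
      then show ?thesis
        unfolding E row_theta[OF D] row_theta[OF D'] O by simp
    qed
    ultimately have "mu V E < mu V ?E'"
      using in_V by (intro mu_less_of_comparison[OF ES theta_edge_set[OF D'] rows]) auto
    moreover have "is_theta V b a ?E'"
    proof -
      have "length A' = b" "length C' = a"
        using arg_cong[OF S(1), of length] arg_cong[OF S(2), of length] arg_cong[OF C', of length]
          arg_cong[OF A', of length] S(3) len by auto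
      then show ?thesis unfolding is_theta_def using D' by blast
    qed
    ultimately show ?thesis by blast
  qed
qed

section \<open>Fans lose against theta graphs\<close>

text \<open>
  The polynomial is the numerator that arises in \<open>response_compare\<close> after the substitution
  \<open>g1 = 1 + e\<close>, \<open>g2 = 1 + f\<close>. The dangerous term is \<open>-4 e P\<^sup>4\<close>: as \<open>e\<close> can be as large as \<open>1 / (P - 1)\<close>, it
  is of the same order as the leading term \<open>8 P\<^sup>3\<close>, but only about half as large.
\<close>
lemma response_numerator_pos:
  fixes P e f :: real
  assumes P: "P \<ge> 7/2" and e: "0 \<le> e" "e * (P - 1) \<le> 1" and f: "0 \<le> f" "f * (P - 1) \<le> 1"
  shows "8 * P^3 - 6 * P - 2 + f * (4 * P^4 + 6 * P^3 - 12 * P^2 - 7 * P) - f^2 * (3 * P^3 + 6 * P^2)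
    - e * (4 * P^4 - 2 * P^3 + 4 * P^2 + 3 * P) - e * f * (10 * P^2 - 6 * P - 4)
    + e * f^2 * (2 * P^2 + 7 * P) + 3 * e^2 * P^3 - e^2 * f * (2 * P^2 - 3 * P) - 2 * e^2 * f^2 > 0"
proof -
  have le: "t \<le> 2/5" if "0 \<le> t" "t * (P - 1) \<le> 1" for t
  proof -
    have "t * (5/2) \<le> t * (P - 1)" using that P by (intro mult_left_mono) auto
    then show ?thesis using that by linarith
  qed
  note e5 = le[OF e] and f5 = le[OF f]
  have P1: "P^2 \<ge> 7/2 * P" using P by (simp add: power2_eq_square)
  have P3: "P^3 \<ge> 7/2 * P^2" using P by (simp add: power3_eq_cube power2_eq_square)
  have P4: "P^4 \<ge> 7/2 * P^3" using P by (simp add: power_def eval_nat_numeral)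
  define a where "a = 4 * P^3 + 2 * P^2 + 6 * P + 9"
  have "e * (4 * P^4 - 2 * P^3 + 4 * P^2 + 3 * P) = e * (P - 1) * a + 9 * e"
    by (simp add: a_def algebra_simps power_def eval_nat_numeral)
  moreover have "e * (P - 1) * a \<le> 1 * a"
    using e P by (intro mult_right_mono) (auto simp: a_def)
  ultimately have 1: "e * (4 * P^4 - 2 * P^3 + 4 * P^2 + 3 * P) \<le> a + 4" using e5 by linarith
  have 2: "f * (f * (3 * P^3 + 6 * P^2)) \<le> f * (2/5 * (3 * P^3 + 6 * P^2))"
    using f f5 P by (intro mult_left_mono mult_right_mono) auto
  have 3: "f * (e * (10 * P^2)) \<le> f * (2/5 * (10 * P^2))"
    using f e e5 by (intro mult_left_mono mult_right_mono) auto
  have ee: "e * e \<le> 2/5 * (2/5)" using e5 e by (intro mult_mono) linarith+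
  have 4: "f * (e * e * (2 * P^2)) \<le> f * (2/5 * (2/5) * (2 * P^2))"
    using f ee by (intro mult_left_mono mult_right_mono) auto
  have 5: "f * (e * e * f * 2) \<le> f * (2/5 * (2/5) * (2/5) * 2)"
  proof -
    have "e * e * f \<le> 2/5 * (2/5) * (2/5)" using f by (intro mult_mono ee f5) auto
    then show ?thesis using f by (intro mult_left_mono) auto
  qed
  have "0 \<le> f * (4 * P^4 + 6 * P^3 - 12 * P^2 - 7 * P - 2/5 * (3 * P^3 + 6 * P^2) - 2/5 * (10 * P^2)
      - 2/5 * (2/5) * (2 * P^2) - 2/5 * (2/5) * (2/5) * 2)"
  proof (intro mult_nonneg_nonneg)
    show "0 \<le> 4 * P^4 + 6 * P^3 - 12 * P^2 - 7 * P - 2/5 * (3 * P^3 + 6 * P^2) - 2/5 * (10 * P^2)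
      - 2/5 * (2/5) * (2 * P^2) - 2/5 * (2/5) * (2/5) * 2" using P P1 P3 P4 unfolding distrib_left right_diff_distrib by linarith
  qed (use f in auto)
  then have 6: "0 \<le> f * (4 * P^4 + 6 * P^3 - 12 * P^2 - 7 * P) - f^2 * (3 * P^3 + 6 * P^2)
     - e * f * (10 * P^2) - e^2 * f * (2 * P^2) - 2 * e^2 * f^2"
    using 2 3 4 5 by (simp add: algebra_simps power2_eq_square)
  have 7: "0 \<le> e * f * (6 * P + 4) + e * f^2 * (2 * P^2 + 7 * P) + 3 * e^2 * P^3 + e^2 * f * (3 * P)"
    using e f P by (intro add_nonneg_nonneg mult_nonneg_nonneg) auto
  have "8 * P^3 - 6 * P - 2 - (a + 4) > 0"
    unfolding a_def using P P1 P3 by linarith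
  with 1 6 7 show ?thesis by (simp add: algebra_simps)
qed

text \<open>
  Fix an eigenvalue \<open>P + 2\<close> and the value \<open>1\<close> at the hub, and solve the eigenvalue equations at the
  other vertices. The final inequality compares the total values, increased by \<open>1\<close>, at those
  neighbours of the hub where a fan (left) and a theta graph (right) differ. The numbers \<open>g1\<close> and \<open>g2\<close>
  measure the effect of the tails: a tail at a vertex with value \<open>y\<close> adds \<open>g y\<close> to the corresponding
  entry of \<open>Q x\<close>. An absent tail has \<open>g = 0\<close>.
\<close>
lemma response_compare:
  fixes P g1 g2 :: real
  assumes P: "P \<ge> 7/2" and g1: "g1 = 0 \<or> (1 \<le> g1 \<and> (g1 - 1) * (P - 1) \<le> 1)"
    and g2: "1 \<le> g2" "(g2 - 1) * (P - 1) \<le> 1"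
  defines "u \<equiv> P - g1" and "v \<equiv> P - g2"
  shows "u \<ge> 2" "v \<ge> 2" "P * (v - 1) - 2 > 0" "(P - 1) * (u * v) - u - v > 0"
    "P * (u * v + u + v) / ((P - 1) * (u * v) - u - v) + 1 / (P + 1)
      < v * (P + 2) / (P * (v - 1) - 2) + 1 / (u + 1)"
proof -
  have le: "g \<le> 7/5" if "1 \<le> g" "(g - 1) * (P - 1) \<le> 1" for g
  proof -
    have "(g - 1) * (5/2) \<le> (g - 1) * (P - 1)" using that P by (intro mult_left_mono) auto
    then have "(g - 1) * (5/2) \<le> 1" using that(2) by (rule order_trans)
    then show ?thesis by simp
  qed
  have g1': "g1 \<le> 7/5" "g1 \<ge> 0" and g2': "g2 \<le> 7/5" using g1 g2 le by auto
  show u: "u \<ge> 2" and v: "v \<ge> 2" using g1' g2' P by (auto simp: u_def v_def)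
  have "P * 1 \<le> P * (v - 1)" using v P by (intro mult_left_mono) auto
  then show D1: "P * (v - 1) - 2 > 0" using P by linarith
  have uv: "u * v \<ge> 2 * u" "u * v \<ge> 2 * v" using u v by (auto intro: mult_left_mono mult_right_mono simp: mult.commute)
  then have "u * v \<ge> u + v" "u * v > 0" using u v by linarith+
  moreover have "(P - 1) * (u * v) \<ge> 5/2 * (u * v)" using P \<open>u * v > 0\<close> by (intro mult_right_mono) auto
  ultimately show D2: "(P - 1) * (u * v) - u - v > 0" by linarith
  define n1 n2 d1 d2 where "n1 = v * (P + 2)" "n2 = P * (u * v + u + v)"
    "d1 = P * (v - 1) - 2" "d2 = (P - 1) * (u * v) - u - v"
  note nd = n1_n2_d1_d2_def
  have "0 < g1 * d1 * d2 + (P + 1) * (u + 1) * (n1 * d2 - n2 * d1)"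
    using g1
  proof
    assume "g1 = 0"
    then have "u = P" by (simp add: u_def)
    define f where "f = g2 - 1"
    have vf: "v = P - 1 - f" by (simp add: v_def f_def)
    have f: "0 \<le> f" "f \<le> 2/5" using g2 g2' by (auto simp: f_def)
    have "n1 * d2 - n2 * d1 = 4 * P^2 + P - 2 + f * (4 * P^2 - 2 * P - 4 - f * (3 * P + 2))"
      unfolding nd vf \<open>u = P\<close> by (simp add: algebra_simps power2_eq_square power3_eq_cube)
    moreover have "4 * P^2 - 2 * P - 4 - f * (3 * P + 2) \<ge> 0"
    proof -
      define t where "t = f * (3 * P + 2)"
      have "t \<le> 2/5 * (3 * P + 2)" unfolding t_def using f P by (intro mult_right_mono) auto
      then have "t \<le> 6/5 * P + 4/5" by simp
      moreover have "P^2 \<ge> 7/2 * P" using P by (simp add: power2_eq_square)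
      ultimately show ?thesis unfolding t_def[symmetric] using P by linarith
    qed
    moreover have "4 * P^2 + P - 2 > 0"
    proof -
      have "P^2 \<ge> 0" by simp
      then show ?thesis using P by linarith
    qed
    ultimately have "n1 * d2 - n2 * d1 > 0" using f by (simp add: add_pos_nonneg)
    then show ?thesis using P u \<open>g1 = 0\<close> by simp
  next
    assume g: "1 \<le> g1 \<and> (g1 - 1) * (P - 1) \<le> 1"
    define e f where "e = g1 - 1" "f = g2 - 1"
    have uv: "u = P - 1 - e" "v = P - 1 - f" "g1 = 1 + e" by (auto simp: u_def v_def e_f_def)
    have "g1 * d1 * d2 + (P + 1) * (u + 1) * (n1 * d2 - n2 * d1) =
     8 * P^3 - 6 * P - 2 + f * (4 * P^4 + 6 * P^3 - 12 * P^2 - 7 * P) - f^2 * (3 * P^3 + 6 * P^2)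
    - e * (4 * P^4 - 2 * P^3 + 4 * P^2 + 3 * P) - e * f * (10 * P^2 - 6 * P - 4)
    + e * f^2 * (2 * P^2 + 7 * P) + 3 * e^2 * P^3 - e^2 * f * (2 * P^2 - 3 * P) - 2 * e^2 * f^2"
      unfolding nd uv by (simp add: algebra_simps power_def eval_nat_numeral)
    also have "\<dots> > 0"
      using response_numerator_pos[OF P, of e f] g g2 by (simp add: e_f_def)
    finally show ?thesis .
  qed
  then have "0 < (g1 * d1 * d2 + (P + 1) * (u + 1) * (n1 * d2 - n2 * d1)) / ((P + 1) * (u + 1) * d1 * d2)"
    using D1 D2 P u by (intro divide_pos_pos mult_pos_pos) (auto simp: nd)
  also have "\<dots> = n1 / d1 + 1 / (u + 1) - (n2 / d2 + 1 / (P + 1))"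
  proof -
    have nz: "d1 \<noteq> 0" "d2 \<noteq> 0" "P + 1 \<noteq> 0" "u + 1 \<noteq> 0" using D1 D2 P u by (auto simp: nd)
    have g: "g1 = (P + 1) - (u + 1)" by (simp add: u_def)
    have "((a - b) * d1 * d2 + a * b * (n1 * d2 - n2 * d1)) / (a * b * d1 * d2)
        = n1 / d1 + 1 / b - (n2 / d2 + 1 / a)" if "a \<noteq> 0" "b \<noteq> 0" for a b
      using nz(1,2) that by (simp add: field_simps)
    from this[OF nz(3,4)] show ?thesis unfolding g .
  qed
  finally show "P * (u * v + u + v) / ((P - 1) * (u * v) - u - v) + 1 / (P + 1)
      < v * (P + 2) / (P * (v - 1) - 2) + 1 / (u + 1)" unfolding nd by simp
qed

text \<open>
  In the fan, \<open>p1\<close> and \<open>p2\<close> are the values at the neighbours of the hub on the path, \<open>q\<close> the value at the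
  vertex adjacent to both of them, and \<open>r\<close> the value at a pendant vertex. In the theta graph, \<open>w\<close>
  is the value at the two vertices of degree 2, \<open>Q\<close> the value at \<open>w\<^sub>4\<close>, which carries the second tail,
  and \<open>r'\<close> the value at the pendant vertex that now carries the first tail.
\<close>
lemma neighbour_values_compare:
  fixes P g1 g2 M p1 p2 q r :: real
  assumes P: "P \<ge> 7/2" and g1: "g1 = 0 \<or> (1 \<le> g1 \<and> (g1 - 1) * (P - 1) \<le> 1)"
    and g2: "1 \<le> g2" "(g2 - 1) * (P - 1) \<le> 1" and M: "M > 0"
    and eqs: "p1 * (P - g1) = M + q" "p2 * (P - g2) = M + q" "q * (P - 1) = M + p1 + p2" "r * (P + 1) = M"
  shows "\<exists>w Q r'. w * P = M + Q \<and> Q * (P - 1 - g2) = M + 2 * w \<and> r' * (P + 1 - g1) = M \<and>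
     p1 + p2 + q + r < 2 * w + Q + r'"
proof -
  define u v where "u = P - g1" "v = P - g2"
  note uv = u_v_def
  note C = response_compare[OF P g1 g2, folded uv]
  define d1 d2 where "d1 = P * (v - 1) - 2" "d2 = (P - 1) * (u * v) - u - v"
  have d: "d1 > 0" "d2 > 0" using C by (auto simp: d1_d2_def)
  define A where "A = M + q"
  have p: "p1 = A / u" "p2 = A / v" using eqs(1,2) C(1,2) by (auto simp: uv A_def field_simps)
  have A: "A = M * (P * (u * v)) / d2"
  proof -
    have "(A - M) * (P - 1) = M + A / u + A / v" using eqs(3) unfolding p A_def by simp
    then have "(A - M) * (P - 1) * (u * v) = (M + A / u + A / v) * (u * v)" by simp
    also have "\<dots> = M * (u * v) + A * v + A * u" using C(1,2) by (simp add: field_simps)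
    finally have "A * d2 = M * (P * (u * v))" unfolding d1_d2_def by (simp add: algebra_simps)
    then show ?thesis using d by (simp add: field_simps)
  qed
  have r: "r = M * (1 / (P + 1))" using eqs(4) P by (simp add: field_simps)
  have old: "p1 + p2 + q + r = M * (P * (u * v + u + v) / d2 + 1 / (P + 1)) - M"
  proof -
    have "p1 + p2 + q = A * ((u * v + u + v) / (u * v)) - M"
      unfolding p using C(1,2) by (simp add: A_def[symmetric] field_simps) (simp add: A_def algebra_simps)
    also have "A * ((u * v + u + v) / (u * v)) = M * (P * (u * v + u + v) / d2)"
    proof -
      have "u * v \<noteq> 0" using C(1,2) by auto
      moreover have "M * (P * k) / d2 * (S / k) = M * (P * S / d2)" if "k \<noteq> 0" for k S
        using that by simp
      ultimately show ?thesis unfolding A by blast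
    qed
    finally show ?thesis unfolding r by (simp add: algebra_simps)
  qed
  define B where "B = M * (v * P) / d1"
  define w Q r' where "w = B / P" "Q = B - M" "r' = M / (u + 1)"
  note wq = w_Q_r'_def
  have Bd: "B * d1 = M * (v * P)" using d by (simp add: B_def)
  have "w * P = M + Q" using P by (simp add: wq)
  moreover have "Q * (P - 1 - g2) = M + 2 * w"
  proof -
    have "(B - M) * (v - 1) * P = (M + 2 * (B / P)) * P"
      using Bd P unfolding d1_d2_def by (simp add: algebra_simps)
    then have "(B - M) * (v - 1) = M + 2 * (B / P)" using P by simp
    moreover have "v - 1 = P - 1 - g2" by (simp add: uv)
    ultimately show ?thesis by (simp add: wq)
  qed
  moreover have "r' * (P + 1 - g1) = M"
  proof -
    have e: "P + 1 - g1 = u + 1" by (simp add: uv)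
    show ?thesis unfolding wq e using C(1) by simp
  qed
  moreover have "p1 + p2 + q + r < 2 * w + Q + r'"
  proof -
    have "2 * w + Q + r' = B * ((P + 2) / P) - M + M / (u + 1)"
      using P by (simp add: wq field_simps)
    also have "B * ((P + 2) / P) = M * (v * (P + 2) / d1)"
      using P by (simp add: B_def)
    finally have new: "2 * w + Q + r' = M * (v * (P + 2) / d1 + 1 / (u + 1)) - M"
      by (simp add: algebra_simps)
    show ?thesis unfolding old new using C(5) M by (simp add: d1_d2_def)
  qed
  ultimately show ?thesis by blast
qed


lemma path_energy_eq_map: "path_energy x xs = path_energy id (map x xs)"
  by (induction xs rule: induct_list012) auto

lemma path_energy_scaled:
  assumes "map y ys = map (\<lambda>v. k * x v) xs"
  shows "path_energy y ys = k\<^sup>2 * path_energy x xs"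
proof -
  have "path_energy (\<lambda>v. k * x v) xs = k\<^sup>2 * path_energy x xs"
  proof (induction xs rule: induct_list012)
    case (3 a b zs)
    have "(k * x a + k * x b)\<^sup>2 = k\<^sup>2 * (x a + x b)\<^sup>2"
      by (simp add: power_mult_distrib flip: distrib_left)
    then show ?case using 3 by (simp add: distrib_left)
  qed auto
  then show ?thesis using assms by (metis path_energy_eq_map)
qed

lemma path_energy_rows:
  assumes "distinct xs"
  shows "path_energy x xs = (\<Sum>v\<in>set xs. x v * path_row x v xs)"
  using assms
proof (induction xs rule: induct_list012)
  case (3 a b zs)
  let ?f = "\<lambda>v. if v = a \<or> v = b then x a + x b else 0"
  have "(\<Sum>v\<in>set (a # b # zs). x v * path_row x v (a # b # zs)) =
    (\<Sum>v\<in>set (a # b # zs). x v * ?f v) + (\<Sum>v\<in>set (a # b # zs). x v * path_row x v (b # zs))"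
    by (simp only: path_row_simps distrib_left sum.distrib)
  also have "(\<Sum>v\<in>set (a # b # zs). x v * path_row x v (b # zs)) = path_energy x (b # zs)"
    using 3 by (simp add: path_row_notin)
  also have "(\<Sum>v\<in>set (a # b # zs). x v * ?f v) = x a * (x a + x b) + (x b * (x a + x b)
      + (\<Sum>v\<in>set zs. x v * ?f v))"
    using 3 by simp
  also have "(\<Sum>v\<in>set zs. x v * ?f v) = 0" using 3(3) by (intro sum.neutral) auto
  finally show ?case by (simp add: power2_eq_square algebra_simps)
qed auto

text \<open>
  Multiply the eigenvalue equation at each tail vertex by the value there and add: beyond the
  term \<open>l |x|\<^sup>2\<close> the tail only contributes through its foot \<open>p\<close>. Since this contribution is
  quadratic, a tail can be moved to another foot by rescaling its values.
\<close>
lemma tail_energy: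
  assumes "distinct (p # S)" and "\<And>v. v \<in> set S \<Longrightarrow> path_row x v (p # S) = l * x v"
  shows "path_energy x (p # S) = x p * path_row x p (p # S) + l * (\<Sum>v\<in>set S. (x v)\<^sup>2)"
proof -
  have "path_energy x (p # S) = x p * path_row x p (p # S) + (\<Sum>v\<in>set S. x v * path_row x v (p # S))"
    using path_energy_rows[OF assms(1), of x] assms(1) by simp
  also have "(\<Sum>v\<in>set S. x v * path_row x v (p # S)) = l * (\<Sum>v\<in>set S. (x v)\<^sup>2)"
    unfolding sum_distrib_left
    by (rule sum.cong[OF refl]) (simp add: assms(2) power2_eq_square)
  finally show ?thesis .
qed

text \<open>
  Induction from the end of the tail: if each later value is at most the one before it, then the
  eigenvalue equation \<open>(l - 2) x s = x p + x t\<close> bounds \<open>x s\<close> in terms of \<open>x p\<close>.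
\<close>
lemma tail_decay:
  fixes l :: real
  assumes "distinct (p # S)" "S \<noteq> []" "l \<ge> 4" and pos: "\<And>v. v \<in> set (p # S) \<Longrightarrow> x v > 0"
    and "\<And>v. v \<in> set S \<Longrightarrow> path_row x v (p # S) = l * x v"
  shows "(l - 3) * x (hd S) \<le> x p"
  using assms
proof (induction S arbitrary: p)
  case (Cons s S)
  have r: "x p + x s + path_row x s (s # S) = l * x s" using Cons.prems(1) Cons.prems(5)[of s] by simp
  show ?case
  proof (cases S)
    case Nil
    then show ?thesis using r Cons.prems(4)[of s] by (simp add: algebra_simps)
  next
    case (Cons t S')
    have "(l - 3) * x (hd S) \<le> x s"
    proof (rule Cons.IH)
      fix v assume v: "v \<in> set S"
      then have "v \<noteq> p" "v \<noteq> s" using Cons.prems(1) by auto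
      then show "path_row x v (s # S) = l * x v" using Cons.prems(5)[of v] v by simp
    qed (use Cons.prems Cons in auto)
    moreover have "1 * x t \<le> (l - 3) * x t" using Cons.prems(3,4) Cons by (intro mult_right_mono) (auto simp: less_imp_le)
    ultimately have "x t \<le> x s" using Cons by simp
    moreover have "s \<notin> set S" using Cons.prems(1) by auto
    then have "path_row x s (s # S) = x s + x t" by (simp add: Cons path_row_notin)
    ultimately show ?thesis using r by (simp add: algebra_simps)
  qed
qed simp

definition fan_graph :: "'a set \<Rightarrow> 'a \<Rightarrow> 'a list \<Rightarrow> 'a list \<Rightarrow> 'a \<Rightarrow> 'a set set" where
  "fan_graph V h A B a = hub_graph V h A B {{a, hd A}, {a, hd B}}"

definition fan_data :: "'a set \<Rightarrow> 'a \<Rightarrow> 'a list \<Rightarrow> 'a list \<Rightarrow> 'a \<Rightarrow> bool" where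
  "fan_data V h A B a \<longleftrightarrow> finite V \<and> distinct (h # A @ B) \<and> set (h # A @ B) \<subseteq> V \<and>
     A \<noteq> [] \<and> B \<noteq> [] \<and> a \<in> off_path V h A B"

lemma fan_hub_data: "fan_data V h A B a \<Longrightarrow> hub_data V h A B {{a, hd A}, {a, hd B}}"
  unfolding fan_data_def hub_data_def off_path_def
  using hd_in_set[of A] hd_in_set[of B] by (auto simp: subset_iff card_insert_if)

lemma fan_swap:
  assumes "fan_data V h A B a"
  shows "fan_data V h B A a" "fan_graph V h B A a = fan_graph V h A B a"
proof -
  have "off_path V h B A = off_path V h A B" by (auto simp: off_path_def)
  then show "fan_data V h B A a" "fan_graph V h B A a = fan_graph V h A B a"
    using assms by (auto simp: fan_data_def fan_graph_def hub_graph_def)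
qed

lemma energy_fan:
  assumes D: "fan_data V h (p # S) (q # T) a" and o: "o' \<in> off_path V h (p # S) (q # T)" "o' \<noteq> a"
  shows "energy (fan_graph V h (p # S) (q # T) a) x =
    (x h + x p)\<^sup>2 + path_energy x (p # S) + (x h + x q)\<^sup>2 + path_energy x (q # T)
    + (x h + x a)\<^sup>2 + (x h + x o')\<^sup>2 + (x a + x p)\<^sup>2 + (x a + x q)\<^sup>2
    + (\<Sum>u\<in>off_path V h (p # S) (q # T) - {a, o'}. (x h + x u)\<^sup>2)"
proof -
  let ?O = "off_path V h (p # S) (q # T)"
  note d = D[unfolded fan_data_def off_path_def]
  have "finite ?O" "a \<in> ?O" using D by (auto simp: fan_data_def off_path_def)
  then have "(\<Sum>u\<in>?O. (x h + x u)\<^sup>2) = (x h + x a)\<^sup>2 + ((x h + x o')\<^sup>2 + (\<Sum>u\<in>?O - {a} - {o'}. (x h + x u)\<^sup>2))"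
    using o by (simp add: sum.remove[of ?O a] sum.remove[of "?O - {a}" o'])
  moreover have "?O - {a} - {o'} = ?O - {a, o'}" by auto
  moreover have "energy {{a, p}, {a, q}} x = (x a + x p)\<^sup>2 + (x a + x q)\<^sup>2"
  proof -
    have "p \<noteq> q" "a \<noteq> p" "a \<noteq> q" using d by auto
    then show ?thesis by (simp add: energy_def doubleton_eq_iff)
  qed
  ultimately show ?thesis
    unfolding fan_graph_def energy_hub_graph[OF fan_hub_data[OF D]] by simp
qed

lemma row_fan:
  assumes D: "fan_data V h (p # S) (q # T) a"
  shows "Q_row (fan_graph V h (p # S) (q # T) a) x v =
    (if v = h \<or> v = p then x h + x p else 0) + path_row x v (p # S)
    + (if v = h \<or> v = q then x h + x q else 0) + path_row x v (q # T)
    + (\<Sum>u\<in>off_path V h (p # S) (q # T). if v = h \<or> v = u then x h + x u else 0)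
    + (if v = a \<or> v = p then x a + x p else 0) + (if v = a \<or> v = q then x a + x q else 0)"
proof -
  have "p \<noteq> q" "a \<noteq> p" "a \<noteq> q" using D by (auto simp: fan_data_def off_path_def)
  then have "Q_row {{a, p}, {a, q}} x v =
    (if v = a \<or> v = p then x a + x p else 0) + (if v = a \<or> v = q then x a + x q else 0)"
    by (subst row_eq_sum) (auto simp: doubleton_eq_iff)
  then show ?thesis
    unfolding fan_graph_def row_hub_graph[OF fan_hub_data[OF D]] by simp
qed

lemma path_energy_nonneg: "path_energy x xs \<ge> 0"
  by (induction xs rule: induct_list012) auto

text \<open>
  The vector with values 4 at the hub, 3 at \<open>a\<close>, 2 at both neighbours of the hub on the path and 1 at a
  pendant vertex has Rayleigh quotient at least \<open>196 / 34 > 11 / 2\<close>. The bound keeps all denominators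
  in \<open>response_compare\<close> positive.
\<close>
lemma fan_mu_ge:
  assumes D: "fan_data V h (p # S) (q # T) a" and o: "o' \<in> off_path V h (p # S) (q # T)" "o' \<noteq> a"
  shows "mu V (fan_graph V h (p # S) (q # T) a) \<ge> 11 / 2"
proof -
  let ?E = "fan_graph V h (p # S) (q # T) a"
  have E: "edge_set V ?E" unfolding fan_graph_def by (intro hub_graph_edge_set fan_hub_data D)
  note d = D[unfolded fan_data_def off_path_def] o[unfolded off_path_def]
  define y where "y = (\<lambda>v. if v = h then 4 else if v = a then 3 else if v = p \<or> v = q then 2
    else if v = o' then 1 else (0::real))"
  have y: "y h = 4" "y a = 3" "y p = 2" "y q = 2" "y o' = 1" using d by (auto simp: y_def)
  have "energy ?E y \<ge> 196"
    unfolding energy_fan[OF D o] y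
    using path_energy_nonneg[of y "p # S"] path_energy_nonneg[of y "q # T"]
      sum_nonneg[of "off_path V h (p # S) (q # T) - {a, o'}" "\<lambda>u. (4 + y u)\<^sup>2"] by simp
  moreover have "norm_sq V y = 34"
  proof -
    have "norm_sq V y = (\<Sum>v\<in>{h, a, p, q, o'}. (y v)\<^sup>2)" unfolding norm_sq_def
      using d by (intro sum.mono_neutral_right) (auto simp: y_def)
    also have "\<dots> = 34" using d by (auto simp: y)
    finally show ?thesis .
  qed
  moreover have "energy ?E y \<le> mu V ?E * norm_sq V y"
    using d by (intro mu_attained(2)[OF E]) auto
  ultimately show ?thesis by simp
qed

text \<open>
  In the theta graph \<open>a\<close> plays the role of \<open>w\<^sub>4\<close> and receives the tail of \<open>q\<close>, the pendant vertex \<open>o'\<close>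
  receives the tail of \<open>p\<close>, and \<open>p\<close> and \<open>q\<close> become the vertices of degree 2. The test vector solves the
  eigenvalue equations of the theta graph, with the eigenvalue \<open>l\<close> of the fan, everywhere except at
  the hub. The excess of its energy over \<open>l |y|\<^sup>2\<close> is then the difference of the sums of the values
  at the neighbours of the hub, times the value there. The tail of \<open>q\<close> must be nonempty: with a tail
  only at \<open>p\<close>, the theta graph obtained in this way can have the smaller radius.
\<close>
lemma fan_less_theta:
  assumes D: "fan_data V h A B a" and o: "o' \<in> off_path V h A B" "o' \<noteq> a" and B2: "length B \<ge> 2"
  shows "\<exists>E'. is_theta V (length A) (length B - 1) E' \<and> mu V (fan_graph V h A B a) < mu V E'"
proof -
  obtain p S where A: "A = p # S" using D by (cases A) (auto simp: fan_data_def)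
  obtain q T where B: "B = q # T" using D by (cases B) (auto simp: fan_data_def)
  have T: "T \<noteq> []" using B2 B by auto
  note D = D[unfolded A B] and o = o[unfolded A B]
  let ?E = "fan_graph V h (p # S) (q # T) a"
  let ?O = "off_path V h (p # S) (q # T)"
  let ?R = "?O - {a, o'}"
  note d = D[unfolded fan_data_def off_path_def] o[unfolded off_path_def]
  have ES: "edge_set V ?E" unfolding fan_graph_def by (intro hub_graph_edge_set fan_hub_data D)
  obtain x where pos: "\<And>v. v \<in> V \<Longrightarrow> x v > 0"
    and rows: "\<And>v. v \<in> V \<Longrightarrow> Q_row ?E x v = mu V ?E * x v"
    using hub_graph_perron[OF fan_hub_data[OF D]] unfolding fan_graph_def by auto
  define l where "l = mu V ?E"
  define P where "P = l - 2"
  have P: "P \<ge> 7/2" using fan_mu_ge[OF D o] by (simp add: P_def l_def)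
  have inV: "h \<in> V" "p \<in> V" "q \<in> V" "a \<in> V" "o' \<in> V" using d by auto
  note xp = pos[OF inV(1)] pos[OF inV(2)] pos[OF inV(3)] pos[OF inV(4)] pos[OF inV(5)]
  have star0: "(\<Sum>u\<in>?O. if v = h \<or> v = u then x h + x u else 0) = 0" if "v \<notin> ?O" "v \<noteq> h" for v
    using that by (intro sum.neutral) auto
  have star1: "(\<Sum>u\<in>?O. if v = h \<or> v = u then x h + x u else 0) = x h + x v" if "v \<in> ?O" "v \<noteq> h" for v
    using that d by (simp add: off_path_def)
  \<comment> \<open>Eigenvalue equations of the fan, where \<open>g1\<close> and \<open>g2\<close> collect the contributions of the tails.\<close>
  have tS: "path_row x v (p # S) = l * x v" if "v \<in> set S" for v
  proof -
    have "v \<noteq> h" "v \<noteq> p" "v \<noteq> q" "v \<noteq> a" "v \<notin> set (q # T)" "v \<in> V" "v \<notin> ?O"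
      using that d by (auto simp: off_path_def)
    then show ?thesis using rows[of v] row_fan[OF D, of x v] star0[of v]
      by (simp add: l_def path_row_notin)
  qed
  have tT: "path_row x v (q # T) = l * x v" if "v \<in> set T" for v
  proof -
    have "v \<noteq> h" "v \<noteq> p" "v \<noteq> q" "v \<noteq> a" "v \<notin> set (p # S)" "v \<in> V" "v \<notin> ?O"
      using that d by (auto simp: off_path_def)
    then show ?thesis using rows[of v] row_fan[OF D, of x v] star0[of v]
      by (simp add: l_def path_row_notin)
  qed
  define g1 g2 where "g1 = path_row x p (p # S) / x p" "g2 = path_row x q (q # T) / x q"
  have gp: "path_row x p (p # S) = g1 * x p" "path_row x q (q # T) = g2 * x q"
    using xp by (auto simp: g1_g2_def)
  have eq1: "x p * (P - g1) = x h + x a"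
  proof -
    have "p \<noteq> h" "p \<noteq> q" "p \<noteq> a" "p \<notin> set (q # T)" "p \<notin> ?O" using d by (auto simp: off_path_def)
    then show ?thesis using rows[OF inV(2)] row_fan[OF D, of x p] star0[of p]
      by (simp add: path_row_notin gp P_def l_def[symmetric] algebra_simps)
  qed
  have eq2: "x q * (P - g2) = x h + x a"
  proof -
    have "q \<noteq> h" "p \<noteq> q" "q \<noteq> a" "q \<notin> set (p # S)" "q \<notin> ?O" using d by (auto simp: off_path_def)
    then show ?thesis using rows[OF inV(3)] row_fan[OF D, of x q] star0[of q]
      by (simp add: path_row_notin gp P_def l_def[symmetric] algebra_simps)
  qed
  have eq3: "x a * (P - 1) = x h + x p + x q"
  proof -
    have "a \<noteq> h" "p \<noteq> a" "q \<noteq> a" "a \<notin> set (p # S)" "a \<notin> set (q # T)" "a \<in> ?O" using d D by (auto simp: fan_data_def)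
    then show ?thesis using rows[OF inV(4)] row_fan[OF D, of x a] star1[of a]
      by (simp add: path_row_notin P_def l_def[symmetric] algebra_simps)
  qed
  have eq4: "x o' * (P + 1) = x h"
  proof -
    have "o' \<noteq> h" "p \<noteq> o'" "q \<noteq> o'" "o' \<noteq> a" "o' \<notin> set (p # S)" "o' \<notin> set (q # T)" using d by auto
    then show ?thesis using rows[OF inV(5)] row_fan[OF D, of x o'] star1[of o'] o
      by (simp add: path_row_notin P_def l_def[symmetric] algebra_simps)
  qed
  have gbound: "1 \<le> g \<and> (g - 1) * (P - 1) \<le> 1"
    if g: "path_row x r (r # Z) = g * x r" and Z: "Z \<noteq> []" "distinct (r # Z)" "set (r # Z) \<subseteq> V"
      and t: "\<And>v. v \<in> set Z \<Longrightarrow> path_row x v (r # Z) = l * x v" for g r Z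
  proof -
    obtain z Z' where Zc: "Z = z # Z'" using Z by (cases Z) auto
    have "r \<notin> set Z" using Z by auto
    then have r: "x r + x z = g * x r" using g by (simp add: Zc path_row_notin)
    have pr: "x r > 0" "x z > 0" using pos Z by (auto simp: Zc)
    have "(l - 3) * x z \<le> x r"
      using tail_decay[OF Z(2,1) _ _ t] P pos Z by (auto simp: P_def Zc)
    have "x z = (g - 1) * x r" using r by (simp add: algebra_simps)
    then have "g - 1 > 0" using pr by (metis zero_less_mult_pos2)
    moreover have "((g - 1) * (P - 1)) * x r \<le> 1 * x r"
      using \<open>(l - 3) * x z \<le> x r\<close> unfolding \<open>x z = (g - 1) * x r\<close> P_def by (simp add: algebra_simps)
    then have "(g - 1) * (P - 1) \<le> 1" using pr by simp
    ultimately show ?thesis by simp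
  qed
  have g1: "g1 = 0 \<or> (1 \<le> g1 \<and> (g1 - 1) * (P - 1) \<le> 1)"
  proof (cases "S = []")
    case True then show ?thesis by (simp add: g1_g2_def)
  next
    case False
    then show ?thesis using gbound[OF gp(1) False _ _ tS] d by auto
  qed
  have g2: "1 \<le> g2" "(g2 - 1) * (P - 1) \<le> 1"
    using gbound[OF gp(2) T _ _ tT] d by auto
  obtain w Q r' where wQ: "w * P = x h + Q" "Q * (P - 1 - g2) = x h + 2 * w" "r' * (P + 1 - g1) = x h"
    "x p + x q + x a + x o' < 2 * w + Q + r'"
    using neighbour_values_compare[OF P g1 g2 xp(1) eq1 eq2 eq3 eq4] by blast
  let ?E' = "theta_graph V h (o' # S) a T p q"
  have D': "theta_data V h (o' # S) a T p q"
    using d by (auto simp: theta_data_def off_path_def)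
  have R': "off_path V h (o' # S) (a # T) - {p, q} = ?R" using d by (auto simp: off_path_def)
  have T': "is_theta V (length A) (length B - 1) ?E'"
    unfolding is_theta_def A B using D' by (intro exI[of _ h] exI[of _ "o' # S"] exI[of _ a] exI[of _ T] exI[of _ p] exI[of _ q]) auto
  define y where "y = (\<lambda>v. if v = p \<or> v = q then w else if v = a then Q else if v = o' then r'
    else if v \<in> set S then (r' / x p) * x v else if v \<in> set T then (Q / x q) * x v else x v)"
  have y: "y h = x h" "y p = w" "y q = w" "y a = Q" "y o' = r'" using d by (auto simp: y_def)
  have yR: "y v = x v" if "v \<in> ?R" for v using that d by (auto simp: y_def off_path_def)
  have yS: "y v = (r' / x p) * x v" if "v \<in> set S" for v using that d by (auto simp: y_def)
  have yT: "y v = (Q / x q) * x v" if "v \<in> set T" for v using that d by (auto simp: y_def)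
  have eS: "path_energy x (p # S) = g1 * (x p)\<^sup>2 + l * (\<Sum>v\<in>set S. (x v)\<^sup>2)"
    using tail_energy[OF _ tS] d gp by (simp add: power2_eq_square algebra_simps)
  have eT: "path_energy x (q # T) = g2 * (x q)\<^sup>2 + l * (\<Sum>v\<in>set T. (x v)\<^sup>2)"
    using tail_energy[OF _ tT] d gp by (simp add: power2_eq_square algebra_simps)
  have eS': "path_energy y (o' # S) = g1 * r'\<^sup>2 + l * (\<Sum>v\<in>set S. (y v)\<^sup>2)"
  proof -
    define k where "k = r' / x p"
    have k: "k * x p = r'" using xp by (simp add: k_def)
    have "path_energy y (o' # S) = k\<^sup>2 * path_energy x (p # S)"
      using k by (intro path_energy_scaled) (auto simp: y yS k_def)
    moreover have "(\<Sum>v\<in>set S. (y v)\<^sup>2) = k\<^sup>2 * (\<Sum>v\<in>set S. (x v)\<^sup>2)"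
      unfolding sum_distrib_left by (rule sum.cong[OF refl]) (simp add: yS k_def[symmetric] power_mult_distrib)
    moreover have "r'\<^sup>2 = k\<^sup>2 * (x p)\<^sup>2" unfolding k[symmetric] by (simp add: power_mult_distrib)
    ultimately show ?thesis unfolding eS by (simp add: algebra_simps)
  qed
  have eT': "path_energy y (a # T) = g2 * Q\<^sup>2 + l * (\<Sum>v\<in>set T. (y v)\<^sup>2)"
  proof -
    define k where "k = Q / x q"
    have k: "k * x q = Q" using xp by (simp add: k_def)
    have "path_energy y (a # T) = k\<^sup>2 * path_energy x (q # T)"
      using k by (intro path_energy_scaled) (auto simp: y yT k_def)
    moreover have "(\<Sum>v\<in>set T. (y v)\<^sup>2) = k\<^sup>2 * (\<Sum>v\<in>set T. (x v)\<^sup>2)"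
      unfolding sum_distrib_left by (rule sum.cong[OF refl]) (simp add: yT k_def[symmetric] power_mult_distrib)
    moreover have "Q\<^sup>2 = k\<^sup>2 * (x q)\<^sup>2" unfolding k[symmetric] by (simp add: power_mult_distrib)
    ultimately show ?thesis unfolding eT by (simp add: algebra_simps)
  qed
  have nsq: "norm_sq V z = (z h)\<^sup>2 + (z p)\<^sup>2 + (z q)\<^sup>2 + (z a)\<^sup>2 + (z o')\<^sup>2 + (\<Sum>v\<in>set S. (z v)\<^sup>2)
    + (\<Sum>v\<in>set T. (z v)\<^sup>2) + (\<Sum>v\<in>?R. (z v)\<^sup>2)" for z
  proof -
    have V: "V = {h, p, q, a, o'} \<union> set S \<union> set T \<union> ?R" using d D by (auto simp: off_path_def)
    have finR: "finite ?R" using d by (auto simp: off_path_def)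
    have "norm_sq V z = (\<Sum>v\<in>{h, p, q, a, o'} \<union> set S \<union> set T. (z v)\<^sup>2) + (\<Sum>v\<in>?R. (z v)\<^sup>2)"
      unfolding norm_sq_def
      by (subst V, rule sum.union_disjoint) (use d finR in \<open>auto simp: off_path_def\<close>)
    also have "(\<Sum>v\<in>{h, p, q, a, o'} \<union> set S \<union> set T. (z v)\<^sup>2) =
        (\<Sum>v\<in>{h, p, q, a, o'} \<union> set S. (z v)\<^sup>2) + (\<Sum>v\<in>set T. (z v)\<^sup>2)"
      by (rule sum.union_disjoint) (use d in auto)
    also have "(\<Sum>v\<in>{h, p, q, a, o'} \<union> set S. (z v)\<^sup>2) =
        (\<Sum>v\<in>{h, p, q, a, o'}. (z v)\<^sup>2) + (\<Sum>v\<in>set S. (z v)\<^sup>2)"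
      by (rule sum.union_disjoint) (use d in auto)
    also have "(\<Sum>v\<in>{h, p, q, a, o'}. (z v)\<^sup>2) = (z h)\<^sup>2 + (z p)\<^sup>2 + (z q)\<^sup>2 + (z a)\<^sup>2 + (z o')\<^sup>2"
      using d by auto
    finally show ?thesis by simp
  qed
  have sumR: "(\<Sum>v\<in>?R. (y v)\<^sup>2) = (\<Sum>v\<in>?R. (x v)\<^sup>2)"
    "(\<Sum>v\<in>?R. (y h + y v)\<^sup>2) = (\<Sum>v\<in>?R. (x h + x v)\<^sup>2)"
    using yR y by (auto intro!: sum.cong)
  define K where "K = (\<Sum>v\<in>?R. (x h + x v)\<^sup>2) - l * (\<Sum>v\<in>?R. (x v)\<^sup>2) - l * (x h)\<^sup>2"
  have old: "energy ?E x - l * norm_sq V x = K + 4 * (x h)\<^sup>2 + x h * (x p + x q + x a + x o')"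
  proof -
    have "energy ?E x - l * norm_sq V x = K + 4 * (x h)\<^sup>2 + x h * (x p + x q + x a + x o')
       + x p * (x h + x a - x p * (P - g1)) + x q * (x h + x a - x q * (P - g2))
       + x a * (x h + x p + x q - x a * (P - 1)) + x o' * (x h - x o' * (P + 1))"
      unfolding energy_fan[OF D o] nsq eS eT K_def P_def
      by (simp add: power2_eq_square algebra_simps)
    then show ?thesis unfolding eq1 eq2 eq3 eq4 by simp
  qed
  have new: "energy ?E' y - l * norm_sq V y = K + 4 * (x h)\<^sup>2 + x h * (2 * w + Q + r')"
  proof -
    have pe: "path_energy y (h # o' # S) = (y h + y o')\<^sup>2 + path_energy y (o' # S)" by simp
    have "energy ?E' y - l * norm_sq V y = K + 4 * (x h)\<^sup>2 + x h * (2 * w + Q + r')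
       + 2 * (w * (x h + Q - w * P)) + Q * (x h + 2 * w - Q * (P - 1 - g2)) + r' * (x h - r' * (P + 1 - g1))"
      unfolding energy_theta[OF D'] R' pe nsq eS' eT' sumR unfolding K_def P_def y
      by (simp add: power2_eq_square algebra_simps)
    then show ?thesis unfolding wQ by simp
  qed
  have "energy ?E x = l * norm_sq V x" unfolding l_def by (rule energy_eq_of_rows[OF ES rows])
  then have "K + 4 * (x h)\<^sup>2 + x h * (x p + x q + x a + x o') = 0" using old by simp
  moreover have "x h * (x p + x q + x a + x o') < x h * (2 * w + Q + r')" using wQ(4) xp by simp
  ultimately have "l * norm_sq V y < energy ?E' y" using new by linarith
  also have "\<dots> \<le> mu V ?E' * norm_sq V y"
    using inV by (intro mu_attained(2)[OF theta_edge_set[OF D']]) auto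
  finally have "l < mu V ?E'" using norm_sq_nonneg[of V y] by (meson mult_right_mono not_le)
  then show ?thesis using T' unfolding l_def A B by blast
qed

section \<open>Graphs with a hub are dominated by theta graphs or fans\<close>

lemma off_path_swap: "off_path V h B A = off_path V h A B"
  by (auto simp: off_path_def)

lemma hub_swap:
  "hub_graph V h B A F = hub_graph V h A B F" "hub_data V h B A F = hub_data V h A B F"
proof -
  show "hub_graph V h B A F = hub_graph V h A B F"
    unfolding hub_graph_def off_path_swap[of V h B A] by auto
  show "hub_data V h B A F = hub_data V h A B F"
    unfolding hub_data_def off_path_swap[of V h B A] by auto
qed

lemma hub_data_rearrange:
  assumes "hub_data V h A B F" "distinct (A' @ B')" "set A' \<union> set B' = set A \<union> set B"
  shows "hub_data V h A' B' F" "off_path V h A' B' = off_path V h A B"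
proof -
  have s: "set (h # A' @ B') = set (h # A @ B)" using assms(3) by auto
  then show o: "off_path V h A' B' = off_path V h A B" unfolding off_path_def by simp
  have "h \<notin> set A' \<union> set B'" using assms unfolding hub_data_def by auto
  then show "hub_data V h A' B' F" using assms o s unfolding hub_data_def by simp
qed

text \<open>
  Cut the tail \<open>B1 @ B2\<close> before \<open>B2\<close>, attach \<open>B2\<close> to the hub, and attach the other tail to the end of \<open>B1\<close>.
  The two new edges beat the two removed ones by the rearrangement inequality.
\<close>
lemma hub_move_tail:
  fixes x :: "'a \<Rightarrow> real"
  assumes D: "hub_data V h A (B1 @ B2) F" and ne: "B1 \<noteq> []" "B2 \<noteq> []"
    and A: "A = [] \<or> x (hd A) < x (hd B2)"
    and pos: "\<And>v. v \<in> V \<Longrightarrow> x v > 0" and hub: "\<And>v. v \<in> V \<Longrightarrow> x v \<le> x h"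
  shows "hub_data V h (B1 @ A) B2 F" "off_path V h (B1 @ A) B2 = off_path V h A (B1 @ B2)"
    "energy (hub_graph V h A (B1 @ B2) F) x \<le> energy (hub_graph V h (B1 @ A) B2 F) x"
    "Q_row (hub_graph V h A (B1 @ B2) F) x h < Q_row (hub_graph V h (B1 @ A) B2 F) x h"
proof -
  note d = D[unfolded hub_data_def]
  show D': "hub_data V h (B1 @ A) B2 F" and o: "off_path V h (B1 @ A) B2 = off_path V h A (B1 @ B2)"
    by (rule hub_data_rearrange[OF D]; use d in auto)+
  have inV: "last B1 \<in> V" "hd B2 \<in> V" "h \<in> V"
    using d last_in_set[OF ne(1)] hd_in_set[OF ne(2)] by auto
  have "path_energy x ((h # B1) @ B2) + path_energy x ([h] @ A)
      \<le> path_energy x ((h # B1) @ A) + path_energy x ([h] @ B2)"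
    using ne A inV pos hub by (intro swap_path_energy) auto
  then show "energy (hub_graph V h A (B1 @ B2) F) x \<le> energy (hub_graph V h (B1 @ A) B2 F) x"
    unfolding energy_hub_graph[OF D] energy_hub_graph[OF D'] o by simp
  show "Q_row (hub_graph V h A (B1 @ B2) F) x h < Q_row (hub_graph V h (B1 @ A) B2 F) x h"
    unfolding row_hub_graph_hub[OF D] row_hub_graph_hub[OF D'] o
    using ne A pos[OF inV(2)] pos[OF inV(3)] by auto
qed

lemma ex_max_on:
  fixes x :: "'a \<Rightarrow> real"
  assumes "finite S" "S \<noteq> {}"
  obtains s where "s \<in> S" "\<And>w. w \<in> S \<Longrightarrow> x w \<le> x s"
proof -
  have "Max (x ` S) \<in> x ` S" using assms by (intro Max_in) auto
  then obtain s where s: "s \<in> S" "x s = Max (x ` S)" by auto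
  then have "x w \<le> x s" if "w \<in> S" for w using assms that by auto
  then show thesis using s that by blast
qed

text \<open>
  If the largest value on the tails is not already next to the hub, cut the tail in front of it and
  apply \<open>hub_move_tail\<close>. The same operation makes an empty tail nonempty.
\<close>
lemma front_max:
  fixes x :: "'a \<Rightarrow> real"
  assumes D: "hub_data V h A B F" and len: "length A + length B \<ge> 2"
    and pos: "\<And>v. v \<in> V \<Longrightarrow> x v > 0" and hub: "\<And>v. v \<in> V \<Longrightarrow> x v \<le> x h"
  shows "\<exists>A' B'. hub_data V h A' B' F \<and> off_path V h A' B' = off_path V h A B \<and> A' \<noteq> [] \<and> B' \<noteq> [] \<and>
    length A' + length B' = length A + length B \<and>
    (\<forall>v\<in>set A' \<union> set B'. x v \<le> x (hd B')) \<and>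
    energy (hub_graph V h A B F) x \<le> energy (hub_graph V h A' B' F) x \<and>
    (hub_graph V h A B F = hub_graph V h A' B' F \<or>
     Q_row (hub_graph V h A B F) x h < Q_row (hub_graph V h A' B' F) x h)"
    (is "\<exists>A' B'. ?goal A B A' B'")
proof -
  have "finite (set A \<union> set B)" "set A \<union> set B \<noteq> {}" using len by auto
  then obtain v where v: "v \<in> set A \<union> set B" "\<And>w. w \<in> set A \<union> set B \<Longrightarrow> x w \<le> x v"
    using ex_max_on[of "set A \<union> set B" x] by blast
  \<comment> \<open>The claim is symmetric in the tails, so the maximum may be assumed to lie on the second one.\<close>
  have main: "\<exists>A' B'. ?goal A B A' B'"
    if D: "hub_data V h A B F" and len: "length A + length B \<ge> 2" and v: "v \<in> set B"
      "\<And>w. w \<in> set A \<union> set B \<Longrightarrow> x w \<le> x v" for A B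
  proof -
    obtain B1 B2 where B: "B = B1 @ v # B2" using v(1) by (meson split_list)
    consider (front) "A \<noteq> []" "B1 = []" | (other_front) "A \<noteq> []" "B1 \<noteq> []" "x (hd A) = x v"
      | (move) "B1 \<noteq> []" "A = [] \<or> x (hd A) \<noteq> x v" | (single) "A = []" "B1 = []" by blast
    then show ?thesis
    proof cases
      case front
      have "?goal A B A B" using D v front by (auto simp: B)
      then show ?thesis by blast
    next
      case other_front
      have "?goal A B B A"
        unfolding hub_swap[of V h B A F] off_path_swap[of V h B A]
        using D v other_front by (auto simp: B)
      then show ?thesis by blast
    next
      case move
      have a: "A = [] \<or> x (hd A) < x (hd (v # B2))"
        using move(2) v(2)[of "hd A"] by (cases A) auto
      note M = hub_move_tail[OF D[unfolded B] move(1) _ a pos hub, simplified]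
      have "?goal A B (B1 @ A) (v # B2)" unfolding B using M v(2) move(1) by (auto simp: B)
      then show ?thesis by blast
    next
      case single
      then obtain b B3 where B3: "B2 = b # B3" using len B by (cases B2) auto
      have D2: "hub_data V h [] ([v] @ B2) F" using D single by (simp add: B)
      have "B2 \<noteq> []" by (simp add: B3)
      note M = hub_move_tail[where A = "[]" and ?B1.0 = "[v]" and ?B2.0 = B2 and x = x, OF D2 _ this _ pos hub, simplified]
      have "?goal A B B2 [v]"
        unfolding hub_swap[of V h B2 "[v]" F] off_path_swap[of V h B2 "[v]"]
        using M v(2) single B3 by (auto simp: B)
      then show ?thesis by blast
    qed
  qed
  show ?thesis
  proof (cases "v \<in> set B")
    case True
    then show ?thesis using main[OF D len] v by blast
  next
    case False
    then have "v \<in> set A" using v by auto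
    have "\<exists>A' B'. ?goal B A A' B'"
      by (rule main) (use D len v \<open>v \<in> set A\<close> in \<open>auto simp: hub_swap(2)[of V h B A F]\<close>)
    then show ?thesis
      unfolding hub_swap[of V h B A F] off_path_swap[of V h B A] add.commute[of "length B"] .
  qed
qed

text \<open>
  Reversing the initial piece \<open>A1 @ [s]\<close> only replaces the two edges at its ends.
\<close>
lemma reverse_to_front:
  fixes x :: "'a \<Rightarrow> real"
  assumes A1: "A1 \<noteq> []" and pos: "x h > 0" "x s > 0" "x (hd A1) > 0"
    and max: "x (hd A1) \<le> x s" and hub: "A2 \<noteq> [] \<Longrightarrow> x (hd A2) \<le> x h"
  shows "path_energy x (h # A1 @ s # A2) \<le> path_energy x (h # s # rev A1 @ A2)"
proof -
  have l: "path_energy x (h # A1 @ s # A2) =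
      (x h + x (hd A1))\<^sup>2 + path_energy x A1 + (x (last A1) + x s)\<^sup>2 + path_energy x (s # A2)"
    using A1 by (simp add: path_energy_Cons path_energy_append)
  have r: "path_energy x (h # s # rev A1 @ A2) =
      (x h + x s)\<^sup>2 + (x s + x (last A1))\<^sup>2 + path_energy x (rev A1 @ A2)"
    using A1 by (simp add: path_energy_Cons hd_rev)
  show ?thesis
  proof (cases "A2 = []")
    case True
    have "(x h + x (hd A1))\<^sup>2 \<le> (x h + x s)\<^sup>2" using pos max by (intro power_mono) auto
    then show ?thesis unfolding l r using True by (simp add: path_energy_rev add.commute)
  next
    case False
    have "(x (hd A2) + x s)\<^sup>2 + (x h + x (hd A1))\<^sup>2 \<le> (x (hd A2) + x (hd A1))\<^sup>2 + (x h + x s)\<^sup>2"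
      using max hub False by (intro swap_squares) auto
    then show ?thesis unfolding l r
      using False A1 by (simp add: path_energy_append path_energy_Cons path_energy_rev last_rev add.commute)
  qed
qed

text \<open>
  A largest value among the remaining tail vertices is brought to the front of the other tail, by
  reversing an initial piece if it lies there and by \<open>hub_move_tail\<close> if it lies behind \<open>hd B\<close>.
\<close>
lemma front_two:
  fixes x :: "'a \<Rightarrow> real"
  assumes D: "hub_data V h A B F" and ne: "A \<noteq> []" "B \<noteq> []"
    and max: "\<forall>v\<in>set A \<union> set B. x v \<le> x (hd B)"
    and pos: "\<And>v. v \<in> V \<Longrightarrow> x v > 0" and hub: "\<And>v. v \<in> V \<Longrightarrow> x v \<le> x h"
  shows "\<exists>A' B'. hub_data V h A' B' F \<and> off_path V h A' B' = off_path V h A B \<and> A' \<noteq> [] \<and> B' \<noteq> [] \<and>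
    length A' + length B' = length A + length B \<and> set A' \<union> set B' = set A \<union> set B \<and>
    (\<forall>v\<in>set A \<union> set B. x v \<le> x (hd B')) \<and>
    (\<forall>v\<in>set A \<union> set B. v \<noteq> hd B' \<longrightarrow> x v \<le> x (hd A')) \<and>
    energy (hub_graph V h A B F) x \<le> energy (hub_graph V h A' B' F) x"
    (is "\<exists>A' B'. ?goal A' B'")
proof -
  obtain v B0 where B: "B = v # B0" using ne by (cases B) auto
  note d = D[unfolded hub_data_def]
  have "finite (set A \<union> set B0)" "set A \<union> set B0 \<noteq> {}" using ne by auto
  then obtain s where s: "s \<in> set A \<union> set B0" "\<And>w. w \<in> set A \<union> set B0 \<Longrightarrow> x w \<le> x s"
    using ex_max_on[of "set A \<union> set B0" x] by blast
  have le: "\<forall>u\<in>set A \<union> set B. u \<noteq> v \<longrightarrow> x u \<le> x s" using s B by auto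
  consider (front) "x (hd A) = x s" | (rev) "s \<in> set A" "x (hd A) \<noteq> x s"
    | (move) "s \<in> set B0" "x (hd A) < x s"
  proof -
    have "x (hd A) \<le> x s" using s(2)[of "hd A"] hd_in_set[OF ne(1)] by simp
    then show thesis using s(1) that by (cases "x (hd A) = x s") auto
  qed
  then show ?thesis
  proof cases
    case front
    have "?goal A B" using D ne max le front by (auto simp: B)
    then show ?thesis by blast
  next
    case rev
    obtain A1 A2 where A: "A = A1 @ s # A2" using rev(1) by (meson split_list)
    have A1: "A1 \<noteq> []" using rev(2) A by auto
    let ?A = "s # rev A1 @ A2"
    have set: "set ?A \<union> set B = set A \<union> set B" by (auto simp: A)
    have D': "hub_data V h ?A B F" "off_path V h ?A B = off_path V h A B"
      by (rule hub_data_rearrange[OF D _ set]; use d in \<open>auto simp: A\<close>)+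
    have inV: "h \<in> V" "s \<in> V" "hd A1 \<in> V" "A2 \<noteq> [] \<Longrightarrow> hd A2 \<in> V"
      using d hd_in_set[OF A1] hd_in_set[of A2] by (auto simp: A)
    have "x (hd A1) \<le> x s" using s(2)[of "hd A1"] hd_in_set[OF A1] by (simp add: A)
    then have "path_energy x (h # A) \<le> path_energy x (h # ?A)"
      unfolding A using A1 inV pos hub by (intro reverse_to_front) auto
    then have "energy (hub_graph V h A B F) x \<le> energy (hub_graph V h ?A B F) x"
      unfolding energy_hub_graph[OF D] energy_hub_graph[OF D'(1)] D'(2) by simp
    moreover have "length ?A = length A" by (simp add: A)
    ultimately have "?goal ?A B" using D' set max le ne by (simp add: B)
    then show ?thesis by blast
  next
    case move
    obtain B1 B2 where B0: "B0 = B1 @ s # B2" using move(1) by (meson split_list)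
    have D2: "hub_data V h A ((v # B1) @ (s # B2)) F" using D by (simp add: B B0)
    have "A = [] \<or> x (hd A) < x (hd (s # B2))" using move(2) by simp
    note M = hub_move_tail[OF D2 _ _ this pos hub, simplified]
    have "hub_data V h (s # B2) ((v # B1) @ A) F"
      "off_path V h (s # B2) ((v # B1) @ A) = off_path V h A B"
      "energy (hub_graph V h A B F) x \<le> energy (hub_graph V h (s # B2) ((v # B1) @ A) F) x"
      unfolding hub_swap[of V h "s # B2"] off_path_swap[of V h "s # B2"]
      using M by (simp_all add: B B0)
    then have "?goal (s # B2) ((v # B1) @ A)" using max le by (auto simp: B B0)
    then show ?thesis by blast
  qed
qed

text \<open>
  Distinct ends off the path can be chosen for the two edges, unless both have the same vertex \<open>a\<close> as
  their only end off the path.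
\<close>
lemma extra_edges_cases:
  assumes D: "hub_data V h A B F" and F: "card F = 2"
  obtains (good) a1 a2 b1 b2 where "a1 \<noteq> a2" "{a1, a2} \<subseteq> off_path V h A B" "F = {{a1, b1}, {a2, b2}}"
      "{b1, b2} \<subseteq> V - {h}" "a1 \<noteq> b1" "a2 \<noteq> b2" "{a1, b1} \<noteq> {a2, b2}"
  | (bad) a b1 b2 where "a \<in> off_path V h A B" "b1 \<noteq> b2" "{b1, b2} \<subseteq> set A \<union> set B"
      "F = {{a, b1}, {a, b2}}"
proof -
  let ?O = "off_path V h A B"
  obtain e1 e2 where e: "F = {e1, e2}" "e1 \<noteq> e2" using F by (auto simp: card_2_iff)
  have "\<exists>a b. e = {a, b} \<and> a \<in> ?O \<and> b \<in> V - {h} \<and> a \<noteq> b" if "e \<in> F" for e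
  proof -
    have "card e = 2" "e \<subseteq> V - {h}" "e \<inter> ?O \<noteq> {}" using D that unfolding hub_data_def by auto
    moreover then obtain a where "a \<in> e" "a \<in> ?O" by auto
    moreover obtain b where "b \<noteq> a" "e = {a, b}"
      using edge_containing[OF \<open>card e = 2\<close> \<open>a \<in> e\<close>] by blast
    ultimately show ?thesis by auto
  qed
  then obtain a1 b1 a2 b2 where 1: "e1 = {a1, b1}" "a1 \<in> ?O" "b1 \<in> V - {h}" "a1 \<noteq> b1"
    and 2: "e2 = {a2, b2}" "a2 \<in> ?O" "b2 \<in> V - {h}" "a2 \<noteq> b2" using e by (metis insertI1 insertI2)
  have O: "b \<in> ?O" if "b \<in> V - {h}" "b \<notin> set A \<union> set B" for b using that by (auto simp: off_path_def)
  have inV: "a1 \<in> V - {h}" "a2 \<in> V - {h}" using 1 2 by (auto simp: off_path_def)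
  show thesis
  proof (cases "a1 = a2")
    case False
    then show thesis using good[of a1 a2 b1 b2] 1 2 e by auto
  next
    case True
    then have b: "b1 \<noteq> b2" using 1 2 e by auto
    show thesis
    proof (cases "b1 \<in> ?O \<or> b2 \<in> ?O")
      case True
      then show thesis
      proof
        assume "b1 \<in> ?O"
        then show thesis
          using good[of b1 a2 a1 b2] 1 2 e b inV \<open>a1 = a2\<close> by (auto simp: insert_commute)
      next
        assume "b2 \<in> ?O"
        then show thesis
          using good[of a1 b2 b1 a2] 1 2 e b inV \<open>a1 = a2\<close> by (auto simp: insert_commute)
      qed
    next
      case False
      then show thesis using bad[of a1 b1 b2] 1 2 e b O \<open>a1 = a2\<close> by auto
    qed
  qed
qed

lemma energy_two_edges:
  assumes "a1 \<noteq> b1" "a2 \<noteq> b2" "{a1, b1} \<noteq> {a2, b2}"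
  shows "energy {{a1, b1}, {a2, b2}} x = (x a1 + x b1)\<^sup>2 + (x a2 + x b2)\<^sup>2"
  using assms by (simp add: energy_def)

lemma row_two_edges:
  assumes "a1 \<noteq> b1" "a2 \<noteq> b2" "{a1, b1} \<noteq> {a2, b2}"
  shows "Q_row {{a1, b1}, {a2, b2}} x v = (if v = a1 \<or> v = b1 then x a1 + x b1 else 0)
    + (if v = a2 \<or> v = b2 then x a2 + x b2 else 0)"
  using assms by (subst row_eq_sum) auto

lemma square_sum_mono:
  fixes s t s' t' :: real
  shows "0 \<le> s \<Longrightarrow> 0 \<le> t \<Longrightarrow> s \<le> s' \<Longrightarrow> t \<le> t' \<Longrightarrow> s\<^sup>2 + t\<^sup>2 \<le> s'\<^sup>2 + t'\<^sup>2"
  by (intro add_mono power_mono)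

text \<open>
  Here the vertex \<open>c\<close>, with the largest value apart from the hub, lies off the path and is going to
  replace the path vertex \<open>v\<close>. Ends of the two edges that become unavailable by this exchange are
  replaced by \<open>v\<close>, and this accounts for the cases.
\<close>
lemma redirect_extra_edges:
  fixes x :: "'a \<Rightarrow> real"
  assumes a: "a1 \<noteq> a2" "{a1, a2} \<subseteq> Out" and b: "{b1, b2} \<subseteq> W" and ab: "a1 \<noteq> b1" "a2 \<noteq> b2" "{a1, b1} \<noteq> {a2, b2}"
    and c: "c \<in> Out" and v: "v \<notin> Out" "v \<in> W" and sub: "Out \<subseteq> W"
    and pos: "\<And>u. u \<in> W \<Longrightarrow> x u > 0" and cmax: "\<And>u. u \<in> W \<Longrightarrow> x u \<le> x c"
    and vmax: "\<And>u. u \<in> W - Out \<Longrightarrow> x u \<le> x v"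
  shows "\<exists>a1' a2'. a1' \<noteq> a2' \<and> {a1', a2'} \<subseteq> insert v (Out - {c}) \<and>
    energy {{a1, b1}, {a2, b2}} x \<le> energy {{a1', c}, {a2', c}} x \<and>
    Q_row {{a1, b1}, {a2, b2}} x c \<le> Q_row {{a1', c}, {a2', c}} x c"
proof -
  let ?goal = "\<lambda>a1 b1 a2 b2 a1' a2'. a1' \<noteq> a2' \<and> {a1', a2'} \<subseteq> insert v (Out - {c}) \<and>
    energy {{a1, b1}, {a2, b2}} x \<le> energy {{a1', c}, {a2', c}} x \<and>
    Q_row {{a1, b1}, {a2, b2}} x c \<le> Q_row {{a1', c}, {a2', c}} x c"
  have new: "energy {{u, c}, {w, c}} x = (x u + x c)\<^sup>2 + (x w + x c)\<^sup>2"
    "Q_row {{u, c}, {w, c}} x c = (x u + x c) + (x w + x c)" if "u \<noteq> w" "{u, w} \<subseteq> insert v (Out - {c})" for u w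
  proof -
    have n: "u \<noteq> c" "w \<noteq> c" "{u, c} \<noteq> {w, c}" using that v c by (auto simp: doubleton_eq_iff)
    show "energy {{u, c}, {w, c}} x = (x u + x c)\<^sup>2 + (x w + x c)\<^sup>2" by (rule energy_two_edges[OF n])
    show "Q_row {{u, c}, {w, c}} x c = (x u + x c) + (x w + x c)" by (simp add: row_two_edges[OF n])
  qed
  have direct: "?goal a1 b1 a2 b2 a1' a2'"
    if "a1' \<noteq> a2'" "{a1', a2'} \<subseteq> insert v (Out - {c})"
      and W: "{a1, b1, a2, b2} \<subseteq> W" and ab: "a1 \<noteq> b1" "a2 \<noteq> b2" "{a1, b1} \<noteq> {a2, b2}"
      and le: "x a1 + x b1 \<le> x a1' + x c" "x a2 + x b2 \<le> x a2' + x c" for a1 b1 a2 b2 a1' a2'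
  proof -
    have p: "x a1 + x b1 > 0" "x a2 + x b2 > 0" using W pos by (auto intro: add_pos_pos)
    have "(x a1 + x b1)\<^sup>2 + (x a2 + x b2)\<^sup>2 \<le> (x a1' + x c)\<^sup>2 + (x a2' + x c)\<^sup>2"
      using p le by (intro square_sum_mono) auto
    then show ?thesis using that p
      unfolding new[OF that(1,2)] energy_two_edges[OF ab] row_two_edges[OF ab] by auto
  qed
  have main: "\<exists>a1' a2'. ?goal a1 b1 a2 b2 a1' a2'"
    if a: "a1 \<noteq> a2" "{a1, a2} \<subseteq> Out" and b: "{b1, b2} \<subseteq> W" and ab: "a1 \<noteq> b1" "a2 \<noteq> b2" "{a1, b1} \<noteq> {a2, b2}"
      and c2: "a2 \<noteq> c" for a1 a2 b1 b2
  proof -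
    have W: "{a1, b1, a2, b2} \<subseteq> W" using a b sub by auto
    have av: "a1 \<noteq> v" "a2 \<noteq> v" using a v by auto
    consider "a1 \<noteq> c" | "a1 = c" "b1 \<notin> Out" | "a1 = c" "b1 \<in> Out" "b1 \<noteq> a2"
      | "a1 = c" "b1 = a2" "b2 \<notin> Out" | "a1 = c" "b1 = a2" "b2 \<in> Out" by blast
    then show ?thesis
    proof cases
      case 1
      have "?goal a1 b1 a2 b2 a1 a2"
        by (rule direct) (use 1 a b ab c2 W cmax in auto)
      then show ?thesis by blast
    next
      case 2
      have "?goal a1 b1 a2 b2 v a2"
        by (rule direct) (use 2 a b ab c2 W cmax vmax av in auto)
      then show ?thesis by blast
    next
      case 3
      have "?goal a1 b1 a2 b2 b1 a2"
        by (rule direct) (use 3 a b ab c2 W cmax vmax av in auto)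
      then show ?thesis by blast
    next
      case 4
      have "x a2 \<le> x c" "x b2 \<le> x v" using 4 W cmax vmax by auto
      then have "?goal a1 b1 a2 b2 a2 v"
        by (intro direct) (use 4 a b ab c2 W av in auto)
      then show ?thesis by blast
    next
      case 5
      have "b2 \<noteq> c" using 5 ab by (auto simp: insert_commute)
      moreover have "x a2 \<le> x c" using W cmax by auto
      ultimately have "?goal a1 b1 a2 b2 a2 b2"
        by (intro direct) (use 5 a b ab c2 W in auto)
      then show ?thesis by blast
    qed
  qed
  show ?thesis
  proof (cases "a2 = c")
    case False
    then show ?thesis using main[OF a b ab] by blast
  next
    case True
    have "\<exists>a1' a2'. ?goal a2 b2 a1 b1 a1' a2'"
      by (rule main) (use a b ab True in auto)
    then show ?thesis by (simp add: insert_commute)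
  qed
qed


text \<open>
  After \<open>front_max\<close> the first vertex of the second tail carries the largest value on the path apart
  from the hub. If the two edges of \<open>F\<close> have distinct ends off the path, they are redirected to a
  vertex \<open>c\<close> next to the hub with the largest value of all: either this first vertex, or a vertex off the
  path that takes its place. In the second case the row at \<open>c\<close> grows by an edge of the path, unless
  nothing is left of that tail; hence the alternative \<open>b = 0\<close>.
\<close>
lemma hub_graph_dominated:
  fixes x :: "'a \<Rightarrow> real"
  assumes D: "hub_data V h A B F" and F: "card F = 2"
    and len: "length A + length B = d" "d \<ge> 2"
    and pos: "\<And>v. v \<in> V \<Longrightarrow> x v > 0" and hub: "\<And>v. v \<in> V \<Longrightarrow> x v \<le> x h"
  shows "(\<exists>a b E'. is_theta V a b E' \<and> a + b + 1 = d \<and>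
      energy (hub_graph V h A B F) x \<le> energy E' x \<and>
      Q_row (hub_graph V h A B F) x h \<le> Q_row E' x h \<and>
      (hub_graph V h A B F = E' \<or> b = 0 \<or> (\<exists>v\<in>V. Q_row (hub_graph V h A B F) x v \<noteq> Q_row E' x v)))
    \<or> (\<exists>A' B' a. fan_data V h A' B' a \<and> length A' + length B' = d \<and>
      energy (hub_graph V h A B F) x \<le> energy (fan_graph V h A' B' a) x)"
proof -
  let ?H = "hub_graph V h A B F"
  have "length A + length B \<ge> 2" using len by simp
  note fm = front_max[where x = x, OF D this pos hub, unfolded len(1)]
  obtain A1 B1 where D1: "hub_data V h A1 B1 F" "off_path V h A1 B1 = off_path V h A B"
      "A1 \<noteq> []" "B1 \<noteq> []" "length A1 + length B1 = d"
    and max: "\<forall>v\<in>set A1 \<union> set B1. x v \<le> x (hd B1)"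
    and e1: "energy ?H x \<le> energy (hub_graph V h A1 B1 F) x"
    and r1: "?H = hub_graph V h A1 B1 F \<or> Q_row ?H x h < Q_row (hub_graph V h A1 B1 F) x h"
    using fm by blast
  let ?H1 = "hub_graph V h A1 B1 F"
  let ?O = "off_path V h A1 B1"
  note d1 = D1(1)[unfolded hub_data_def]
  have hV: "h \<in> V" using d1 by auto
  have O_V: "?O \<subseteq> V - {h}" by (auto simp: off_path_def)
  have P_V: "set A1 \<union> set B1 \<subseteq> V - {h}" using d1 by auto
  from D1(1) F show ?thesis
  proof (cases rule: extra_edges_cases)
    case (bad a b1 b2)
    obtain A2 B2 where D2: "hub_data V h A2 B2 F" "off_path V h A2 B2 = ?O" "A2 \<noteq> []" "B2 \<noteq> []"
        "length A2 + length B2 = length A1 + length B1" "set A2 \<union> set B2 = set A1 \<union> set B1"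
      and m2: "\<forall>v\<in>set A1 \<union> set B1. x v \<le> x (hd B2)"
        "\<forall>v\<in>set A1 \<union> set B1. v \<noteq> hd B2 \<longrightarrow> x v \<le> x (hd A2)"
      and e2: "energy ?H1 x \<le> energy (hub_graph V h A2 B2 F) x"
      using front_two[OF D1(1,3,4) max pos hub] by metis
    have fan: "fan_data V h A2 B2 a"
      using D2 bad(1) by (simp add: fan_data_def hub_data_def)
    have aP: "a \<notin> set A1 \<union> set B1" using bad(1) by (auto simp: off_path_def)
    have fronts: "hd A2 \<in> set A1 \<union> set B1" "hd B2 \<in> set A1 \<union> set B1" "hd A2 \<noteq> hd B2"
    proof -
      show "hd A2 \<in> set A1 \<union> set B1" "hd B2 \<in> set A1 \<union> set B1"
        using hd_in_set[OF D2(3)] hd_in_set[OF D2(4)] D2(6) by blast+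
      have "set A2 \<inter> set B2 = {}" using D2(1) by (auto simp: hub_data_def)
      then show "hd A2 \<noteq> hd B2" using hd_in_set[OF D2(3)] hd_in_set[OF D2(4)] by auto
    qed
    have xpos: "x a > 0" "x b1 > 0" "x b2 > 0" using pos bad O_V P_V by auto
    have old: "energy F x = (x a + x b1)\<^sup>2 + (x a + x b2)\<^sup>2"
      unfolding bad(4) using bad aP by (intro energy_two_edges) (auto simp: doubleton_eq_iff)
    have new: "energy {{a, hd A2}, {a, hd B2}} x = (x a + x (hd A2))\<^sup>2 + (x a + x (hd B2))\<^sup>2"
      using fronts aP by (intro energy_two_edges) (auto simp: doubleton_eq_iff)
    have "energy F x \<le> energy {{a, hd A2}, {a, hd B2}} x"
    proof (cases "b1 = hd B2")
      case True
      then have "x b2 \<le> x (hd A2)" "x b1 \<le> x (hd B2)" using bad m2 by auto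
      then have "(x a + x b2)\<^sup>2 + (x a + x b1)\<^sup>2 \<le> (x a + x (hd A2))\<^sup>2 + (x a + x (hd B2))\<^sup>2"
        using xpos by (intro square_sum_mono) auto
      then show ?thesis unfolding old new by simp
    next
      case False
      then have "x b1 \<le> x (hd A2)" "x b2 \<le> x (hd B2)" using bad m2 by auto
      then show ?thesis unfolding old new using xpos by (intro square_sum_mono) auto
    qed
    then have "energy (hub_graph V h A2 B2 F) x \<le> energy (fan_graph V h A2 B2 a) x"
      unfolding fan_graph_def energy_hub_graph[OF D2(1)] energy_hub_graph[OF fan_hub_data[OF fan]] by simp
    then have "energy ?H x \<le> energy (fan_graph V h A2 B2 a) x" using e1 e2 by linarith
    then show ?thesis using fan D2(5) D1(5) by metis
  next
    case (good a1 a2 b1 b2)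
    have energyF: "energy F x = (x a1 + x b1)\<^sup>2 + (x a2 + x b2)\<^sup>2"
      unfolding good(3) by (rule energy_two_edges[OF good(5-7)])
    \<comment> \<open>It suffices to compare with the graph whose tails are already rearranged.\<close>
    have suffices: ?thesis
      if T: "is_theta V a b E'" "a + b + 1 = d" and e: "energy ?H1 x \<le> energy E' x"
        and r: "Q_row ?H1 x h \<le> Q_row E' x h" and
        c: "?H1 = E' \<or> b = 0 \<or> (\<exists>v\<in>V. Q_row ?H1 x v \<noteq> Q_row E' x v)" for a b E'
    proof -
      have "?H = E' \<or> b = 0 \<or> (\<exists>v\<in>V. Q_row ?H x v \<noteq> Q_row E' x v)"
      proof (cases "?H = ?H1")
        case False
        then have "Q_row ?H x h < Q_row E' x h" using r1 r by auto
        then show ?thesis using hV by (metis less_irrefl)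
      qed (use c in auto)
      moreover have "Q_row ?H x h \<le> Q_row E' x h" using r1 r by auto
      moreover have "energy ?H x \<le> energy E' x" using e e1 by linarith
      ultimately show ?thesis using T by blast
    qed
    show ?thesis
    proof (cases "\<forall>u\<in>?O. x u \<le> x (hd B1)")
      case True
      obtain c C where B1: "B1 = c # C" using D1(4) by (cases B1) auto
      have D': "theta_data V h A1 c C a1 a2"
        using d1 good(1,2) by (simp add: theta_data_def B1)
      let ?E' = "theta_graph V h A1 c C a1 a2"
      have W: "x u \<le> x c" if "u \<in> V - {h}" for u
        using that True max by (cases "u \<in> ?O") (auto simp: B1 off_path_def)
      have xpos: "x a1 > 0" "x b1 > 0" "x a2 > 0" "x b2 > 0" using pos good O_V by auto
      have ca: "c \<noteq> a1" "c \<noteq> a2" using good(2) by (auto simp: B1 off_path_def)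
      have cE: "energy {{a1, c}, {a2, c}} x = (x a1 + x c)\<^sup>2 + (x a2 + x c)\<^sup>2"
        using ca good(1) by (intro energy_two_edges) (auto simp: doubleton_eq_iff)
      have cR: "Q_row {{a1, c}, {a2, c}} x c = (x a1 + x c) + (x a2 + x c)"
        using ca good(1) by (subst row_two_edges) (auto simp: doubleton_eq_iff)
      have "energy F x \<le> energy {{a1, c}, {a2, c}} x"
        unfolding energyF cE using xpos W good(4) by (intro square_sum_mono) auto
      then have e: "energy ?H1 x \<le> energy ?E' x"
        unfolding theta_graph_def energy_hub_graph[OF D1(1)] energy_hub_graph[OF theta_hub_data[OF D']]
        by (simp add: B1)
      have r: "Q_row ?H1 x h \<le> Q_row ?E' x h"
        unfolding theta_graph_def row_hub_graph_hub[OF D1(1)] row_hub_graph_hub[OF theta_hub_data[OF D']]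
        by (simp add: B1)
      have c: "?H1 = ?E' \<or> Q_row ?H1 x c \<noteq> Q_row ?E' x c"
      proof (cases "b1 = c \<and> b2 = c")
        case True
        then have "?H1 = ?E'" by (simp add: theta_graph_def B1 good(3))
        then show ?thesis ..
      next
        case False
        then have "Q_row F x c < Q_row {{a1, c}, {a2, c}} x c"
          unfolding cR unfolding good(3) row_two_edges[OF good(5-7)] using ca xpos pos[of c] d1
          by (auto simp: B1)
        then show ?thesis
          unfolding theta_graph_def row_hub_graph[OF D1(1)] row_hub_graph[OF theta_hub_data[OF D']]
          by (simp add: B1)
      qed
      have "is_theta V (length A1) (length C) ?E'" unfolding is_theta_def using D' by blast
      then show ?thesis
      proof (rule suffices[OF _ _ e r])
        show "length A1 + length C + 1 = d" using D1(5) by (simp add: B1)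
        have "c \<in> V" using d1 by (simp add: B1)
        then show "?H1 = ?E' \<or> length C = 0 \<or> (\<exists>v\<in>V. Q_row ?H1 x v \<noteq> Q_row ?E' x v)"
          using c by blast
      qed
    next
      case False
      obtain v B2 where B1: "B1 = v # B2" using D1(4) by (cases B1) auto
      have "finite ?O" "?O \<noteq> {}" using d1 good(2) by (auto simp: off_path_def)
      then obtain c where c: "c \<in> ?O" "\<And>w. w \<in> ?O \<Longrightarrow> x w \<le> x c" using ex_max_on[of ?O x] by blast
      have cv: "x v < x c" using False c(2) by (force simp: B1)
      have vP: "v \<notin> ?O" "v \<in> V - {h}" "v \<noteq> c" using P_V c(1) by (auto simp: B1 off_path_def)
      have cmax: "x u \<le> x c" if "u \<in> V - {h}" for u
        using that c(2) max cv by (cases "u \<in> ?O") (force simp: B1 off_path_def)+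
      have vmax: "x u \<le> x v" if "u \<in> V - {h} - ?O" for u
        using that max by (auto simp: B1 off_path_def)
      obtain a1' a2' where a': "a1' \<noteq> a2'" "{a1', a2'} \<subseteq> insert v (?O - {c})"
        and eF: "energy F x \<le> energy {{a1', c}, {a2', c}} x"
        and rF: "Q_row F x c \<le> Q_row {{a1', c}, {a2', c}} x c"
        using redirect_extra_edges[of a1 a2 ?O b1 b2 "V - {h}" c v x] good c(1) vP O_V pos cmax vmax
        by (metis Diff_iff)
      let ?O' = "off_path V h A1 (c # B2)"
      have O': "?O' = insert v (?O - {c})" using vP c(1) d1 by (auto simp: off_path_def B1)
      have D': "theta_data V h A1 c B2 a1' a2'"
        using d1 a' c(1) unfolding theta_data_def O' by (auto simp: B1 off_path_def)
      let ?E' = "theta_graph V h A1 c B2 a1' a2'"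
      have sumO: "(\<Sum>u\<in>?O'. f u) = (\<Sum>u\<in>?O. f u) - f c + f v" for f :: "'a \<Rightarrow> real"
        unfolding O' using \<open>finite ?O\<close> c(1) vP by (simp add: sum_diff1)
      have inV: "c \<in> V" "v \<in> V" using c(1) O_V vP by auto
      have "path_energy x (h # v # B2) + (x h + x c)\<^sup>2 \<le> path_energy x (h # c # B2) + (x h + x v)\<^sup>2"
      proof (cases "B2 = []")
        case False
        have "hd B2 \<in> V" using d1 hd_in_set[OF False] by (auto simp: B1)
        then have "(x v + x (hd B2))\<^sup>2 \<le> (x c + x (hd B2))\<^sup>2"
          using cv pos inV by (intro power_mono) (auto simp: add_nonneg_nonneg less_imp_le)
        then show ?thesis using False by (simp add: path_energy_Cons)
      qed simp
      then have e: "energy ?H1 x \<le> energy ?E' x"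
        using eF unfolding theta_graph_def energy_hub_graph[OF D1(1)] energy_hub_graph[OF theta_hub_data[OF D']] sumO
        by (simp add: B1)
      have r: "Q_row ?H1 x h \<le> Q_row ?E' x h"
        using D1(3) unfolding theta_graph_def row_hub_graph_hub[OF D1(1)] row_hub_graph_hub[OF theta_hub_data[OF D']] sumO
        by (simp add: B1)
      have c': "B2 = [] \<or> Q_row ?H1 x c \<noteq> Q_row ?E' x c"
      proof (cases "B2 = []")
        case False
        have "hd B2 \<in> V" using d1 hd_in_set[OF False] by (auto simp: B1)
        then have p: "x c + x (hd B2) > 0" using pos inV by (simp add: add_pos_pos)
        have ne: "c \<noteq> h" "c \<notin> set A1" "c \<noteq> v" "c \<notin> set B2" using c(1) by (auto simp: off_path_def B1)
        have p1: "path_row x c (h # A1) = 0" "path_row x c (h # v # B2) = 0"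
          using ne by (auto intro!: path_row_notin)
        have p2: "path_row x c (h # c # B2) = (x h + x c) + (x c + x (hd B2))"
          using ne False by (simp add: path_row_Cons path_row_notin)
        have s1: "(\<Sum>u\<in>?O. if c = h \<or> c = u then x h + x u else 0) = x h + x c"
          using ne c(1) \<open>finite ?O\<close> by simp
        have s2: "(\<Sum>u\<in>?O'. if c = h \<or> c = u then x h + x u else 0) = 0"
          using ne vP by (intro sum.neutral) (auto simp: O')
        have "Q_row ?H1 x c < Q_row ?E' x c"
          using p rF unfolding theta_graph_def row_hub_graph[OF D1(1)] row_hub_graph[OF theta_hub_data[OF D']] s1 s2
          unfolding B1 p1 p2 by simp
        then show ?thesis by simp
      qed simp
      have "is_theta V (length A1) (length B2) ?E'" unfolding is_theta_def using D' by blast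
      then show ?thesis
      proof (rule suffices[OF _ _ e r])
        show "length A1 + length B2 + 1 = d" using D1(5) by (simp add: B1)
        show "?H1 = ?E' \<or> length B2 = 0 \<or> (\<exists>v\<in>V. Q_row ?H1 x v \<noteq> Q_row ?E' x v)"
          using c' inV by auto
      qed
    qed
  qed
qed

section \<open>Geodesics and the hub\<close>

lemma row_neighbours:
  assumes E: "edge_set V E" and v: "v \<in> V"
  shows "Q_row E x v = (\<Sum>u\<in>{u\<in>V. {v, u} \<in> E}. x v + x u)"
proof -
  let ?N = "{u\<in>V. {v, u} \<in> E}"
  have "(\<Sum>e\<in>{e\<in>E. v \<in> e}. \<Sum>u\<in>e. 1 :: real) = (\<Sum>e\<in>{e\<in>E. v \<in> e}. 2)"
    by (rule sum.cong[OF refl]) (use edge_setD[OF E] in auto)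
  then have "real (card {e\<in>E. v \<in> e}) = real (card ?N)"
    using sum_row_neighbours[OF E v, of "\<lambda>_. 1 :: real"] by simp
  then show ?thesis
    using sum_row_neighbours[OF E v, of x] by (simp add: Q_row_def sum.distrib)
qed

lemma row_less_of_more_neighbours:
  assumes E: "edge_set V E" and E': "edge_set V E'" and v: "v \<in> V"
    and sub: "\<And>u. {v, u} \<in> E \<Longrightarrow> {v, u} \<in> E'" and z: "{v, z} \<in> E'" "{v, z} \<notin> E"
    and pos: "\<And>u. u \<in> V \<Longrightarrow> x u > 0"
  shows "Q_row E x v < Q_row E' x v"
proof -
  have "z \<in> V" using edge_setD[OF E' z(1)] by simp
  have "(\<Sum>u\<in>{u\<in>V. {v, u} \<in> E}. x v + x u) < (\<Sum>u\<in>{u\<in>V. {v, u} \<in> E'}. x v + x u)"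
  proof (rule sum_strict_mono2[of _ _ z])
    show "finite {u \<in> V. {v, u} \<in> E'}" using E by (simp add: edge_set_def)
  qed (use sub z \<open>z \<in> V\<close> pos v in \<open>auto intro: add_pos_pos add_nonneg_nonneg less_imp_le\<close>)
  then show ?thesis unfolding row_neighbours[OF E v] row_neighbours[OF E' v] .
qed

lemma path_edges_split: "path_edges (L @ h # M) = path_edges (h # rev L) \<union> path_edges (h # M)"
proof (cases "L = []")
  case False
  then have "path_edges (h # rev L) = insert {h, last L} (path_edges L)"
    by (simp add: path_edges_Cons path_edges_rev hd_rev)
  then show ?thesis using False by (auto simp: path_edges_append insert_commute)
qed simp

lemma path_energy_split: "path_energy x (L @ h # M) = path_energy x (h # rev L) + path_energy x (h # M)"
proof (cases "L = []")
  case False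
  then show ?thesis
    by (simp add: path_energy_append path_energy_Cons path_energy_rev hd_rev add.commute)
qed simp

lemma card_path_edges:
  assumes "distinct P" "P \<noteq> []"
  shows "card (path_edges P) + 1 = length P"
proof -
  have "adj_sum (\<lambda>a b. 1) P = real (length P) - 1" if "P \<noteq> []" for P :: "'a list"
    using that by (induction P rule: induct_list012) auto
  then have "real (card (path_edges P)) = real (length P) - 1"
    using sum_path_edges[OF assms(1), of "\<lambda>_. 1"] assms(2) by simp
  then show ?thesis using assms(2) by (cases P) auto
qed

lemma path_energy_mono:
  assumes "\<And>v. v \<in> set P \<Longrightarrow> 0 \<le> x v \<and> x v \<le> y v"
  shows "path_energy x P \<le> path_energy y P"
  using assms
proof (induction P rule: induct_list012)
  case (3 a b P)
  have "(x a + x b)\<^sup>2 \<le> (y a + y b)\<^sup>2"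
    using 3(3)[of a] 3(3)[of b] by (intro power_mono add_mono) auto
  then show ?case using 3 by auto
qed auto

lemma energy_Un: "finite E \<Longrightarrow> finite F \<Longrightarrow> E \<inter> F = {} \<Longrightarrow> energy (E \<union> F) x = energy E x + energy F x"
  by (simp add: energy_def sum.union_disjoint)

locale connected_simple_graph =
  fixes G :: "'a ugraph"
  assumes simple: "simple_graph G" and connected: "connected_graph G"
begin

abbreviation "V \<equiv> verts G"
abbreviation "E \<equiv> edges G"
abbreviation "dist_G \<equiv> graph_dist G"

lemma ES: "edge_set V E"
  using simple by (auto simp: simple_graph_def edge_set_def)

lemma edge_in_V: "{u, v} \<in> E \<Longrightarrow> u \<in> V \<and> v \<in> V \<and> u \<noteq> v"
  using edge_setD[OF ES, of "{u, v}"] by (cases "u = v") auto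

lemma walk_dist: "(u, v) \<in> adj_rel G ^^ k \<Longrightarrow> dist_G u v \<le> k"
  unfolding graph_dist_def by (rule Least_le)

lemma dist_walk: "u \<in> V \<Longrightarrow> v \<in> V \<Longrightarrow> (u, v) \<in> adj_rel G ^^ dist_G u v"
  unfolding graph_dist_def
  by (rule LeastI_ex) (use connected in \<open>auto simp: connected_graph_def rtrancl_power\<close>)

lemma dist_refl [simp]: "dist_G u u = 0"
  using walk_dist[of u u 0] by simp

lemma dist_eq_0: "u \<in> V \<Longrightarrow> v \<in> V \<Longrightarrow> dist_G u v = 0 \<longleftrightarrow> u = v"
  using dist_walk[of u v] by auto

lemma adj_rel_sym: "(u, v) \<in> adj_rel G ^^ k \<Longrightarrow> (v, u) \<in> adj_rel G ^^ k"
proof (induction k arbitrary: v)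
  case (Suc k)
  then obtain w where "(u, w) \<in> adj_rel G ^^ k" "(w, v) \<in> adj_rel G" by auto
  then have "(w, u) \<in> adj_rel G ^^ k" "(v, w) \<in> adj_rel G"
    using Suc.IH by (auto simp: adj_rel_def insert_commute)
  then show ?case by (meson relpow_Suc_I2)
qed auto

lemma dist_sym: "u \<in> V \<Longrightarrow> v \<in> V \<Longrightarrow> dist_G u v = dist_G v u"
  using dist_walk adj_rel_sym walk_dist by (metis order_antisym)

lemma dist_triangle:
  assumes "u \<in> V" "v \<in> V" "w \<in> V"
  shows "dist_G u w \<le> dist_G u v + dist_G v w"
proof (rule walk_dist)
  show "(u, w) \<in> adj_rel G ^^ (dist_G u v + dist_G v w)"
    unfolding relpow_add using dist_walk[OF assms(1,2)] dist_walk[OF assms(2,3)] by blast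
qed

lemma dist_edge: "{u, v} \<in> E \<Longrightarrow> dist_G u v = 1"
proof -
  assume e: "{u, v} \<in> E"
  then have "dist_G u v \<le> 1" by (intro walk_dist) (simp add: adj_rel_def)
  moreover have "dist_G u v \<noteq> 0" using edge_in_V[OF e] dist_eq_0 by blast
  ultimately show ?thesis by linarith
qed

lemma dist_1_edge: "u \<in> V \<Longrightarrow> v \<in> V \<Longrightarrow> dist_G u v = 1 \<Longrightarrow> {u, v} \<in> E"
  using dist_walk[of u v] by (simp add: adj_rel_def)

lemma closer_neighbour:
  assumes "h \<in> V" "v \<in> V" "v \<noteq> h"
  shows "\<exists>w. {v, w} \<in> E \<and> dist_G h v = dist_G h w + 1"
proof -
  have "dist_G h v \<noteq> 0" using assms dist_eq_0 by blast
  then obtain k where k: "dist_G h v = Suc k" by (cases "dist_G h v") auto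
  then have "(h, v) \<in> adj_rel G ^^ Suc k" using dist_walk[OF assms(1,2)] by simp
  then obtain w where w: "(h, w) \<in> adj_rel G ^^ k" "{w, v} \<in> E" by (auto simp: adj_rel_def)
  have "dist_G h v \<le> dist_G h w + 1"
    using dist_triangle[OF assms(1) _ assms(2), of w] dist_edge[OF w(2)] edge_in_V[OF w(2)] by simp
  moreover have "dist_G h w \<le> k" by (rule walk_dist[OF w(1)])
  ultimately show ?thesis using w(2) k by (intro exI[of _ w]) (simp add: insert_commute)
qed

definition towards :: "'a \<Rightarrow> 'a \<Rightarrow> 'a" where
  "towards h v = (SOME w. {v, w} \<in> E \<and> dist_G h v = dist_G h w + 1)"

lemma towards:
  assumes "h \<in> V" "v \<in> V" "v \<noteq> h"
  shows "{v, towards h v} \<in> E" "dist_G h v = dist_G h (towards h v) + 1"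
  using someI_ex[OF closer_neighbour[OF assms]] unfolding towards_def by auto

lemma towards_adjacent:
  assumes "{h, v} \<in> E"
  shows "towards h v = h"
proof -
  have v: "h \<in> V" "v \<in> V" "v \<noteq> h" using edge_in_V[OF assms] by auto
  have "dist_G h (towards h v) = 0" using towards(2)[OF v] dist_edge[OF assms] by simp
  then show ?thesis using towards(1)[OF v] edge_in_V dist_eq_0 v by metis
qed

lemma inj_on_towards:
  assumes "h \<in> V"
  shows "inj_on (\<lambda>v. {v, towards h v}) (V - {h})"
proof (rule inj_onI)
  fix u v assume u: "u \<in> V - {h}" and v: "v \<in> V - {h}" and eq: "{u, towards h u} = {v, towards h v}"
  show "u = v"
  proof (rule ccontr)
    assume "u \<noteq> v"
    then have "u = towards h v" "v = towards h u" using eq by (auto simp: doubleton_eq_iff)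
    then show False using towards(2)[OF assms, of u] towards(2)[OF assms, of v] u v by auto
  qed
qed

definition geodesic :: "'a list \<Rightarrow> bool" where
  "geodesic P \<longleftrightarrow> P \<noteq> [] \<and> set P \<subseteq> V \<and> (\<forall>i. Suc i < length P \<longrightarrow> {P ! i, P ! Suc i} \<in> E) \<and>
     dist_G (P ! 0) (P ! (length P - 1)) = length P - 1"

lemma geodesic_dist_le:
  assumes "geodesic P" "i \<le> j" "j < length P"
  shows "dist_G (P ! i) (P ! j) \<le> j - i"
proof -
  have "(P ! i, P ! (i + k)) \<in> adj_rel G ^^ k" if "i + k < length P" for k
    using that
  proof (induction k)
    case (Suc k)
    then have "(P ! i, P ! (i + k)) \<in> adj_rel G ^^ k" by simp
    moreover have "(P ! (i + k), P ! (i + Suc k)) \<in> adj_rel G"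
      using assms(1) Suc.prems by (simp add: geodesic_def adj_rel_def)
    ultimately show ?case by (meson relpow_Suc_I)
  qed simp
  from this[of "j - i"] assms show ?thesis by (intro walk_dist) simp
qed

lemma geodesic_dist:
  assumes P: "geodesic P" and ij: "i \<le> j" "j < length P"
  shows "dist_G (P ! i) (P ! j) = j - i"
proof -
  let ?n = "length P - 1"
  have inV: "P ! k \<in> V" if "k < length P" for k using P that by (auto simp: geodesic_def)
  have "?n = dist_G (P ! 0) (P ! ?n)" using P by (simp add: geodesic_def)
  also have "\<dots> \<le> dist_G (P ! 0) (P ! j) + dist_G (P ! j) (P ! ?n)"
    using ij by (intro dist_triangle inV) auto
  also have "dist_G (P ! 0) (P ! j) \<le> dist_G (P ! 0) (P ! i) + dist_G (P ! i) (P ! j)"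
    using ij by (intro dist_triangle inV) auto
  also have "dist_G (P ! 0) (P ! i) \<le> i" using geodesic_dist_le[OF P, of 0 i] ij by simp
  also have "dist_G (P ! j) (P ! ?n) \<le> ?n - j" using geodesic_dist_le[OF P, of j ?n] ij by simp
  finally have "j - i \<le> dist_G (P ! i) (P ! j)" using ij by linarith
  then show ?thesis using geodesic_dist_le[OF P ij] by simp
qed

lemma geodesic_distinct: "geodesic P \<Longrightarrow> distinct P"
  unfolding distinct_conv_nth
proof (intro allI impI)
  fix i j assume P: "geodesic P" and ij: "i < length P" "j < length P" "i \<noteq> j"
  show "P ! i \<noteq> P ! j"
  proof (cases "i < j")
    case True
    then show ?thesis using geodesic_dist[OF P, of i j] ij dist_refl by (metis less_imp_le_nat zero_less_diff less_irrefl)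
  next
    case False
    then show ?thesis using geodesic_dist[OF P, of j i] ij dist_refl
      by (metis linorder_neqE_nat less_imp_le_nat zero_less_diff less_irrefl)
  qed
qed

lemma geodesic_chord:
  assumes P: "geodesic P" and e: "{u, v} \<in> E" "u \<in> set P" "v \<in> set P"
  shows "{u, v} \<in> path_edges P"
proof -
  have main: "{P ! i, P ! j} \<in> path_edges P" if "i < j" "j < length P" "{P ! i, P ! j} \<in> E" for i j
  proof -
    have "j - i = 1" using geodesic_dist[OF P, of i j] dist_edge[OF that(3)] that by simp
    then have "j = Suc i" using that by simp
    then show ?thesis using that by (auto simp: path_edges_def)
  qed
  obtain i j where ij: "i < length P" "j < length P" "u = P ! i" "v = P ! j"
    using e by (auto simp: in_set_conv_nth)
  have "i \<noteq> j" using edge_in_V[OF e(1)] ij by auto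
  then show ?thesis using main[of i j] main[of j i] ij e(1)
    by (cases "i < j") (auto simp: insert_commute)
qed

lemma geodesic_window:
  assumes P: "geodesic P" and ij: "i < j" "j < length P" and e: "{w, P ! i} \<in> E" "{w, P ! j} \<in> E"
  shows "j \<le> i + 2"
proof -
  have "dist_G (P ! i) (P ! j) \<le> dist_G (P ! i) w + dist_G w (P ! j)"
    using edge_in_V[OF e(1)] edge_in_V[OF e(2)] by (intro dist_triangle) auto
  moreover have "dist_G (P ! i) w = 1" using dist_edge[of "P ! i" w] e by (simp add: insert_commute)
  ultimately show ?thesis using geodesic_dist[OF P, of i j] ij dist_edge[OF e(2)] by simp
qed

lemma geodesic_replace:
  assumes P: "geodesic P" and i: "Suc (Suc i) < length P" and e: "{w, P ! i} \<in> E" "{w, P ! Suc (Suc i)} \<in> E"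
  shows "geodesic (P[Suc i := w])"
  unfolding geodesic_def
proof (intro conjI allI impI)
  show "set (P[Suc i := w]) \<subseteq> V"
    using P edge_in_V[OF e(1)] set_update_subset_insert[of P "Suc i" w] by (auto simp: geodesic_def)
  show "P[Suc i := w] \<noteq> []" using P by (auto simp: geodesic_def)
  fix k assume k: "Suc k < length (P[Suc i := w])"
  have "{P ! k, P ! Suc k} \<in> E" using P k by (simp add: geodesic_def)
  then show "{P[Suc i := w] ! k, P[Suc i := w] ! Suc k} \<in> E"
    using e k i by (cases "k = Suc i"; cases "k = i") (simp_all add: nth_list_update insert_commute)
next
  show "dist_G (P[Suc i := w] ! 0) (P[Suc i := w] ! (length (P[Suc i := w]) - 1)) = length (P[Suc i := w]) - 1"
    using P i by (simp add: geodesic_def nth_list_update)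
qed

lemma geodesic_rev:
  assumes P: "geodesic P"
  shows "geodesic (rev P)"
  unfolding geodesic_def
proof (intro conjI allI impI)
  let ?n = "length P - 1"
  have ne: "P \<noteq> []" using P by (simp add: geodesic_def)
  then show "rev P \<noteq> []" by simp
  show "set (rev P) \<subseteq> V" using P by (simp add: geodesic_def)
  fix i assume i: "Suc i < length (rev P)"
  then have "{P ! (length P - Suc (Suc i)), P ! Suc (length P - Suc (Suc i))} \<in> E"
    using P by (simp add: geodesic_def)
  moreover have "Suc (length P - Suc (Suc i)) = length P - Suc i" using i by simp
  ultimately show "{rev P ! i, rev P ! Suc i} \<in> E"
    using i by (simp add: rev_nth insert_commute)
next
  have ne: "P \<noteq> []" using P by (simp add: geodesic_def)
  then have inV: "P ! 0 \<in> V" "P ! (length P - 1) \<in> V" using P by (auto simp: geodesic_def)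
  have "rev P ! 0 = P ! (length P - 1)" "rev P ! (length (rev P) - 1) = P ! 0"
    using ne by (simp_all add: rev_nth)
  then show "dist_G (rev P ! 0) (rev P ! (length (rev P) - 1)) = length (rev P) - 1"
    using P dist_sym[OF inV] by (simp add: geodesic_def)
qed

lemma dist_set_finite: "finite {dist_G u v |u v. u \<in> V \<and> v \<in> V}"
proof -
  have "{dist_G u v |u v. u \<in> V \<and> v \<in> V} = (\<lambda>(u, v). dist_G u v) ` (V \<times> V)" by auto
  then show ?thesis using simple by (simp add: simple_graph_def)
qed

lemma diametral_geodesic: "\<exists>P. geodesic P \<and> length P = graph_diameter G + 1"
proof -
  let ?S = "{dist_G u v |u v. u \<in> V \<and> v \<in> V}"
  have "?S \<noteq> {}" using connected unfolding connected_graph_def by blast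
  then have "graph_diameter G \<in> ?S"
    unfolding graph_diameter_def using dist_set_finite by (rule Max_in[rotated])
  then obtain u v where uv: "u \<in> V" "v \<in> V" "dist_G u v = graph_diameter G" by auto
  let ?d = "graph_diameter G"
  have "(u, v) \<in> adj_rel G ^^ ?d" using dist_walk[OF uv(1,2)] uv(3) by simp
  then obtain f where f: "f 0 = u" "f ?d = v" "\<And>i. i < ?d \<Longrightarrow> (f i, f (Suc i)) \<in> adj_rel G"
    by (auto simp: relpow_fun_conv)
  let ?P = "map f [0..<Suc ?d]"
  have nth: "?P ! i = f i" if "i \<le> ?d" for i using that by (simp del: upt_Suc)
  have fV: "f i \<in> V" if "i \<le> ?d" for i
  proof (cases "i = ?d")
    case False
    then show ?thesis using f(3)[of i] that edge_in_V by (auto simp: adj_rel_def)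
  qed (use f uv in auto)
  have "geodesic ?P"
    unfolding geodesic_def
  proof (intro conjI allI impI)
    show "set ?P \<subseteq> V" using fV by auto
    fix i assume "Suc i < length ?P"
    then have i: "i < ?d" by simp
    then show "{?P ! i, ?P ! Suc i} \<in> E" using f(3)[OF i] nth[of i] nth[of "Suc i"] by (simp add: adj_rel_def del: upt_Suc)
  next
    have "?P ! (length ?P - 1) = v" using nth[of ?d] f(2) by (simp del: upt_Suc)
    moreover have "?P ! 0 = u" using nth[of 0] f(1) by (simp del: upt_Suc)
    ultimately show "dist_G (?P ! 0) (?P ! (length ?P - 1)) = length ?P - 1" using uv(3) by (simp del: upt_Suc)
  qed simp
  then show ?thesis by (intro exI[of _ ?P]) simp
qed


lemma geodesic_path_edges:
  assumes P: "geodesic P"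
  shows "path_edges P \<subseteq> E" "card (path_edges P) + 1 = length P"
    "\<And>e. e \<in> E - path_edges P \<Longrightarrow> e \<inter> (V - set P) \<noteq> {}"
proof -
  show "path_edges P \<subseteq> E" using P by (auto simp: geodesic_def path_edges_def)
  show "card (path_edges P) + 1 = length P"
    using card_path_edges[OF geodesic_distinct[OF P]] P by (simp add: geodesic_def)
  fix e assume e: "e \<in> E - path_edges P"
  then obtain u v where uv: "e = {u, v}" using edge_setD[OF ES, of e] by (auto simp: card_2_iff)
  then show "e \<inter> (V - set P) \<noteq> {}"
    using geodesic_chord[OF P, of u v] e edge_in_V[of u v] by auto
qed

text \<open>
  The vertices in \<open>U\<close> own the edges that lead towards \<open>h\<close>, different vertices owning different edges. By
  counting, exactly two edges are neither on the path nor owned. An owner adjacent to \<open>h\<close> owns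
  the edge to \<open>h\<close>, so that edge is not one of these two.
\<close>
lemma towards_edges:
  assumes P: "geodesic P" and h: "h \<in> V" and U: "U \<subseteq> V - {h}"
    and leave: "\<forall>v\<in>U. {v, towards h v} \<notin> path_edges P"
    and card: "card E = card V + 1" "card U + length P = card V"
  defines "F \<equiv> E - path_edges P - (\<lambda>v. {v, towards h v}) ` U"
  shows "card F = 2"
    "energy E x = path_energy x P + (\<Sum>v\<in>U. (x v + x (towards h v))\<^sup>2) + energy F x"
    "\<And>v. v \<in> U \<Longrightarrow> {h, v} \<notin> F"
proof -
  let ?T = "(\<lambda>v. {v, towards h v}) ` U"
  have finE: "finite E" by (rule edge_set_finite[OF ES])
  have inj: "inj_on (\<lambda>v. {v, towards h v}) U" by (rule inj_on_subset[OF inj_on_towards[OF h] U])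
  have T: "?T \<subseteq> E" using towards(1)[OF h] U by auto
  have disj: "path_edges P \<inter> ?T = {}" using leave by auto
  have finU: "finite U" using U ES finite_subset by (auto simp: edge_set_def)
  have "card F = card E - card (path_edges P \<union> ?T)"
  proof -
    have "F = E - (path_edges P \<union> ?T)" by (auto simp: F_def)
    then show ?thesis using finU T geodesic_path_edges(1)[OF P] by (simp add: card_Diff_subset)
  qed
  also have "card (path_edges P \<union> ?T) = card (path_edges P) + card U"
    using disj finU by (simp add: card_Un_disjoint card_image[OF inj])
  finally show "card F = 2" using card geodesic_path_edges(2)[OF P] by simp
  have "E = path_edges P \<union> ?T \<union> F" using T geodesic_path_edges(1)[OF P] by (auto simp: F_def)
  then have "energy E x = energy (path_edges P \<union> ?T \<union> F) x" by simp
  also have "\<dots> = energy (path_edges P) x + energy ?T x + energy F x"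
    using disj finU finE by (subst energy_Un; (subst energy_Un)?) (auto simp: F_def)
  also have "energy ?T x = (\<Sum>v\<in>U. (x v + x (towards h v))\<^sup>2)"
    unfolding energy_def sum.reindex[OF inj] comp_def
  proof (rule sum.cong[OF refl])
    fix v assume "v \<in> U"
    then have "v \<noteq> towards h v" using towards(1)[OF h, of v] U edge_in_V by blast
    then show "(\<Sum>u\<in>{v, towards h v}. x u)\<^sup>2 = (x v + x (towards h v))\<^sup>2" by simp
  qed
  finally show "energy E x = path_energy x P + (\<Sum>v\<in>U. (x v + x (towards h v))\<^sup>2) + energy F x"
    by (simp add: energy_path_edges geodesic_distinct[OF P])
  fix v assume v: "v \<in> U"
  show "{h, v} \<notin> F"
  proof
    assume "{h, v} \<in> F"
    then have "towards h v = h" by (intro towards_adjacent) (simp add: F_def)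
    then have "{h, v} \<in> ?T" using v by (auto intro!: image_eqI[of _ _ v])
    then show False using \<open>{h, v} \<in> F\<close> by (simp add: F_def)
  qed
qed

text \<open>
  All vertices off the path are owners. Redirecting their edges to the hub does not lower the energy,
  since the hub has the largest value, and the row at the hub grows unless nothing was redirected.
\<close>
lemma hub_on_geodesic:
  assumes P: "geodesic P" and h: "h \<in> set P" and card: "card E = card V + 1"
    and pos: "\<And>v. v \<in> V \<Longrightarrow> x v > 0" and hub: "\<And>v. v \<in> V \<Longrightarrow> x v \<le> x h"
  shows "\<exists>A B F. hub_data V h A B F \<and> card F = 2 \<and> length A + length B + 1 = length P \<and>
    energy E x \<le> energy (hub_graph V h A B F) x \<and>
    (E = hub_graph V h A B F \<or> Q_row E x h < Q_row (hub_graph V h A B F) x h)"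
proof -
  obtain L B where PL: "P = L @ h # B" using h by (meson split_list)
  let ?A = "rev L" and ?O = "V - set P"
  have PV: "set P \<subseteq> V" using P by (simp add: geodesic_def)
  then have hV: "h \<in> V" using h by auto
  have finV: "finite V" using ES by (simp add: edge_set_def)
  have dist: "distinct P" by (rule geodesic_distinct[OF P])
  have O: "off_path V h ?A B = ?O" by (auto simp: off_path_def PL)
  have leave: "\<forall>v\<in>?O. {v, towards h v} \<notin> path_edges P"
  proof
    fix v assume "v \<in> ?O"
    then show "{v, towards h v} \<notin> path_edges P" using path_edges_subset[of "{v, towards h v}" P] by auto
  qed
  have "card ?O + length P = card V"
    using card_Diff_subset[of "set P" V] card_mono[OF finV PV] PV distinct_card[OF dist] by simp
  note F = towards_edges[OF P hV _ leave card this]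
  define F where "F = E - path_edges P - (\<lambda>v. {v, towards h v}) ` ?O"
  have sub: "?O \<subseteq> V - {h}" using h by auto
  note F = F[OF sub, folded F_def]
  have D: "hub_data V h ?A B F"
    unfolding hub_data_def O
  proof (intro conjI ballI)
    fix e assume e: "e \<in> F"
    then have eE: "e \<in> E" "e \<notin> path_edges P" by (auto simp: F_def)
    then show meets: "e \<inter> ?O \<noteq> {}" using geodesic_path_edges(3)[OF P] by blast
    show "card e = 2" using edge_setD[OF ES eE(1)] by simp
    have "h \<notin> e"
    proof
      assume "h \<in> e"
      then obtain y where y: "e = {h, y}" using edge_containing[OF \<open>card e = 2\<close>] by metis
      then have "y \<in> ?O" using meets h by auto
      then show False using F(3) e y by blast
    qed
    then show "e \<subseteq> V - {h}" using edge_setD[OF ES eE(1)] by auto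
  next
    show "finite V" by (rule finV)
    show "distinct (h # ?A @ B)" using dist by (auto simp: PL)
    show "set (h # ?A @ B) \<subseteq> V" using PV by (auto simp: PL)
  qed
  let ?H = "hub_graph V h ?A B F"
  have e: "energy E x \<le> energy ?H x"
  proof -
    have "(\<Sum>v\<in>?O. (x v + x (towards h v))\<^sup>2) \<le> (\<Sum>v\<in>?O. (x h + x v)\<^sup>2)"
    proof (intro sum_mono power_mono)
      fix v assume v: "v \<in> ?O"
      then have "{v, towards h v} \<in> E" using towards(1)[OF hV, of v] h by auto
      then have t: "towards h v \<in> V" using edge_in_V by simp
      show "x v + x (towards h v) \<le> x h + x v" using hub[OF t] by simp
      show "0 \<le> x v + x (towards h v)" using pos[OF t] pos[of v] v by simp
    qed
    then show ?thesis
      unfolding F(2) energy_hub_graph[OF D] O by (simp add: PL path_energy_split)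
  qed
  have "E = ?H \<or> Q_row E x h < Q_row ?H x h"
  proof (cases "\<forall>v\<in>?O. towards h v = h")
    case True
    have T: "(\<lambda>v. {v, towards h v}) ` ?O = (\<lambda>u. {h, u}) ` ?O"
    proof (rule image_cong[OF refl])
      fix v assume "v \<in> ?O"
      then have "towards h v = h" using True by simp
      then show "{v, towards h v} = {h, v}" by (simp add: insert_commute)
    qed
    have "(\<lambda>v. {v, towards h v}) ` ?O \<subseteq> E"
      using towards(1)[OF hV] sub by (intro image_subsetI) auto
    then have S: "(\<lambda>u. {h, u}) ` ?O \<subseteq> E" unfolding T .
    have "E = ?H" unfolding hub_graph_def O F_def T path_edges_split[of L h B, folded PL, symmetric]
      using S geodesic_path_edges(1)[OF P] by auto
    then show ?thesis ..
  next
    case False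
    then obtain z where z: "z \<in> ?O" "towards h z \<noteq> h" by auto
    have "Q_row E x h < Q_row ?H x h"
    proof (rule row_less_of_more_neighbours[OF ES hub_graph_edge_set[OF D] hV _ _ _ pos])
      show "{h, z} \<in> ?H" using z by (auto simp: hub_graph_def O)
      show "{h, z} \<notin> E" using towards_adjacent z by blast
      fix u assume u: "{h, u} \<in> E"
      show "{h, u} \<in> ?H"
      proof (cases "u \<in> set P")
        case True
        then have "{h, u} \<in> path_edges P" using geodesic_chord[OF P u h] by simp
        then show ?thesis unfolding hub_graph_def PL path_edges_split by auto
      next
        case False
        then show ?thesis using edge_in_V[OF u] by (auto simp: hub_graph_def O)
      qed
    qed
    then show ?thesis ..
  qed
  then show ?thesis using D F(1) e 
    by (intro exI[of _ ?A] exI[of _ B] exI[of _ F]) (simp add: PL)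
qed


text \<open>
  The hub takes the place of the path vertex \<open>p\<close>, and \<open>p\<close> becomes a vertex off the path. As \<open>p\<close> is
  closest to the hub among the path vertices, its edge towards the hub leaves the path, so \<open>p\<close> can act
  as an owner in place of the hub. If the hub also is adjacent to the successor of \<open>p\<close>, that edge becomes
  part of the path, and the old path edge at \<open>p\<close> takes its place among the two further edges. The hub gains
  the neighbour \<open>z\<close> on the path, so the row there grows strictly.
\<close>
lemma hub_replaces_path_vertex:
  assumes P: "geodesic P" and PL: "P = L @ p # M" and h: "h \<in> V" "h \<notin> set P"
    and closest: "\<And>v. v \<in> set P \<Longrightarrow> dist_G h p \<le> dist_G h v"
    and nbrs: "\<And>v. v \<in> set P \<Longrightarrow> {h, v} \<in> E \<Longrightarrow> v = p \<or> (M \<noteq> [] \<and> v = hd M)"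
    and z: "(L \<noteq> [] \<and> z = last L) \<or> (M \<noteq> [] \<and> z = hd M)" "{h, z} \<notin> E"
    and card: "card E = card V + 1"
    and pos: "\<And>v. v \<in> V \<Longrightarrow> x v > 0" and hub: "\<And>v. v \<in> V \<Longrightarrow> x v \<le> x h"
  shows "\<exists>A B F. hub_data V h A B F \<and> card F = 2 \<and> length A + length B + 1 = length P \<and>
    energy E x \<le> energy (hub_graph V h A B F) x \<and>
    Q_row E x h < Q_row (hub_graph V h A B F) x h"
proof -
  let ?A = "rev L" and ?U = "insert p (V - set P - {h})"
  have PV: "set P \<subseteq> V" using P by (simp add: geodesic_def)
  have finV: "finite V" using ES by (simp add: edge_set_def)
  have dist: "distinct P" by (rule geodesic_distinct[OF P])
  have pV: "p \<in> V" "p \<noteq> h" "p \<in> set P" using PV h by (auto simp: PL)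
  have O: "off_path V h ?A M = ?U" using pV dist by (auto simp: off_path_def PL)
  have U: "?U \<subseteq> V - {h}" using pV by auto
  have leave: "\<forall>v\<in>?U. {v, towards h v} \<notin> path_edges P"
  proof
    fix v assume v: "v \<in> ?U"
    have "\<not> {v, towards h v} \<subseteq> set P"
    proof (cases "v = p")
      case True
      have "towards h p \<notin> set P"
        using closest[of "towards h p"] towards(2)[OF h(1) pV(1,2)] by auto
      then show ?thesis using True by simp
    qed (use v in auto)
    then show "{v, towards h v} \<notin> path_edges P" using path_edges_subset by blast
  qed
  have cardU: "card ?U + length P = card V"
  proof -
    have "card (V - set P - {h}) = card (V - set P) - 1" using h by simp
    moreover have "card (V - set P) = card V - length P"
      using card_Diff_subset[of "set P" V] PV distinct_card[OF dist] by simp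
    moreover have "card ?U = card (V - set P - {h}) + 1" using finV pV by simp
    moreover have "card (insert h (set P)) \<le> card V" using h PV finV by (intro card_mono) auto
    then have "length P + 1 \<le> card V" using h distinct_card[OF dist] by simp
    ultimately show ?thesis by simp
  qed
  define F where "F = E - path_edges P - (\<lambda>v. {v, towards h v}) ` ?U"
  note F = towards_edges[OF P h(1) U leave card cardU, folded F_def]
  have F_E: "e \<in> E" "e \<notin> path_edges P" if "e \<in> F" for e using that by (auto simp: F_def)
  have F_meets: "e \<inter> (V - set P) \<noteq> {}" if "e \<in> F" for e
    using geodesic_path_edges(3)[OF P, of e] F_E[OF that] by blast
  have F_hub: "M \<noteq> [] \<and> e = {h, hd M}" if e: "e \<in> F" "h \<in> e" for e
  proof -
    have "card e = 2" using edge_setD[OF ES F_E(1)[OF e(1)]] by simp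
    then obtain y where y: "e = {h, y}" "y \<noteq> h" using edge_containing[OF _ e(2)] by metis
    have "y \<in> V" using edge_in_V[of h y] F_E(1)[OF e(1)] y by simp
    moreover have "y \<notin> ?U" using F(3) e(1) y(1) by blast
    ultimately have "y \<in> set P" "y \<noteq> p" using y(2) by auto
    then show ?thesis using nbrs[of y] F_E(1)[OF e(1)] y by auto
  qed
  have star: "(\<Sum>v\<in>?U. (x v + x (towards h v))\<^sup>2) \<le> (\<Sum>v\<in>?U. (x h + x v)\<^sup>2)"
  proof (intro sum_mono power_mono)
    fix v assume v: "v \<in> ?U"
    then have "{v, towards h v} \<in> E" using towards(1)[OF h(1), of v] U by auto
    then have t: "towards h v \<in> V" "v \<in> V" using edge_in_V by auto
    show "x v + x (towards h v) \<le> x h + x v" using hub[OF t(1)] by simp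
    show "0 \<le> x v + x (towards h v)" using pos[OF t(1)] pos[OF t(2)] by simp
  qed
  have raise: "path_energy x (L @ p # N) \<le> path_energy x (L @ h # N)" if N: "set N \<subseteq> set M" for N
  proof -
    have n: "p \<notin> set L" "p \<notin> set N" using dist N by (auto simp: PL)
    have "path_energy x (L @ p # N) \<le> path_energy (x(p := x h)) (L @ p # N)"
      using pV hub pos PV N by (intro path_energy_mono) (auto simp: PL less_imp_le)
    also have "\<dots> = path_energy x (L @ h # N)"
      using n by (subst (1 2) path_energy_eq_map) simp
    finally show ?thesis .
  qed
  have "\<exists>F'. hub_data V h ?A M F' \<and> card F' = 2 \<and>
      path_energy x P + energy F x \<le> path_energy x (L @ h # M) + energy F' x"
  proof (cases "\<exists>e\<in>F. h \<in> e")
    case False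
    have "hub_data V h ?A M F"
      unfolding hub_data_def O
    proof (intro conjI ballI)
      show "finite V" by (rule finV)
      show "distinct (h # ?A @ M)" using dist h by (auto simp: PL)
      show "set (h # ?A @ M) \<subseteq> V" using PV h by (auto simp: PL)
      fix e assume e: "e \<in> F"
      show "card e = 2" using edge_setD[OF ES F_E(1)[OF e]] by simp
      show "e \<subseteq> V - {h}" using edge_setD[OF ES F_E(1)[OF e]] False e by auto
      then show "e \<inter> ?U \<noteq> {}" using F_meets[OF e] by blast
    qed
    then show ?thesis using F(1) raise[of M] by (intro exI[of _ F]) (simp add: PL)
  next
    case True
    then obtain e where e: "e \<in> F" "h \<in> e" by auto
    have M: "M \<noteq> []" and eq: "e = {h, hd M}" using F_hub[OF e] by auto
    let ?y = "hd M"
    let ?F' = "insert {p, ?y} (F - {e})"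
    have y: "?y \<in> set M" using M by simp
    then have yP: "?y \<in> V - {h}" "?y \<noteq> p" using PV h dist by (auto simp: PL)
    have py: "{p, ?y} \<in> path_edges P"
      using M by (cases M) (auto simp: PL path_edges_split)
    have py': "{p, ?y} \<notin> F" using py F_E(2) by blast
    have finF: "finite F" using edge_set_finite[OF ES] by (simp add: F_def)
    have only: "h \<notin> e'" if "e' \<in> F - {e}" for e' using F_hub[of e'] that eq by auto
    have "hub_data V h ?A M ?F'"
      unfolding hub_data_def O
    proof (intro conjI ballI)
      show "finite V" by (rule finV)
      show "distinct (h # ?A @ M)" using dist h by (auto simp: PL)
      show "set (h # ?A @ M) \<subseteq> V" using PV h by (auto simp: PL)
      fix e' assume e': "e' \<in> ?F'"
      then consider "e' = {p, ?y}" | "e' \<in> F - {e}" by blast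
      then have "card e' = 2 \<and> e' \<subseteq> V - {h} \<and> e' \<inter> ?U \<noteq> {}"
      proof cases
        case 1
        then show ?thesis using yP pV by auto
      next
        case 2
        then have "e' \<in> F" by simp
        moreover have "e' \<subseteq> V - {h}"
          using edge_setD[OF ES F_E(1)[OF \<open>e' \<in> F\<close>]] only[OF 2] by auto
        ultimately show ?thesis
          using edge_setD[OF ES F_E(1)[OF \<open>e' \<in> F\<close>]] F_meets[OF \<open>e' \<in> F\<close>] by blast
      qed
      then show "card e' = 2" "e' \<subseteq> V - {h}" "e' \<inter> ?U \<noteq> {}" by auto
    qed
    moreover have "card ?F' = 2" using F(1) finF py' e(1) by (simp add: card_Diff_singleton)
    moreover have "path_energy x P + energy F x \<le> path_energy x (L @ h # M) + energy ?F' x"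
    proof -
      have "energy F x = (x h + x ?y)\<^sup>2 + energy (F - {e}) x"
      proof -
        have "h \<noteq> ?y" using yP(1) by auto
        then have "(\<Sum>u\<in>e. x u) = x h + x ?y" by (simp add: eq)
        then show ?thesis using finF e(1) unfolding energy_def by (simp add: sum.remove[of F e])
      qed
      moreover have "energy ?F' x = (x p + x ?y)\<^sup>2 + energy (F - {e}) x"
        using finF py' yP(2) unfolding energy_def by (subst sum.insert) auto
      moreover have "path_energy x (L @ q # M) = path_energy x (L @ [q]) + (x q + x ?y)\<^sup>2 + path_energy x M" for q
        using M path_energy_append[of "L @ [q]" M x] by simp
      ultimately show ?thesis using raise[of "[]"] by (simp add: PL)
    qed
    ultimately show ?thesis by blast
  qed
  then obtain F' where F': "hub_data V h ?A M F'" "card F' = 2"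
    "path_energy x P + energy F x \<le> path_energy x (L @ h # M) + energy F' x" by blast
  let ?H = "hub_graph V h ?A M F'"
  have "energy E x \<le> energy ?H x"
    using F'(3) star unfolding F(2) energy_hub_graph[OF F'(1)] O by (simp add: path_energy_split)
  moreover have "Q_row E x h < Q_row ?H x h"
  proof (rule row_less_of_more_neighbours[OF ES hub_graph_edge_set[OF F'(1)] h(1) _ _ z(2) pos])
    have tails: "M \<noteq> [] \<Longrightarrow> {h, hd M} \<in> ?H" "L \<noteq> [] \<Longrightarrow> {h, last L} \<in> ?H"
      by (auto simp: hub_graph_def path_edges_Cons hd_rev)
    then show "{h, z} \<in> ?H" using z(1) by auto
    fix u assume u: "{h, u} \<in> E"
    show "{h, u} \<in> ?H"
    proof (cases "u \<in> ?U")
      case True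
      then have "{h, u} \<in> (\<lambda>u. {h, u}) ` off_path V h ?A M" unfolding O by (rule imageI)
      then show ?thesis by (simp add: hub_graph_def)
    next
      case False
      then have "u \<in> set P" "u \<noteq> p" using edge_in_V[OF u] by auto
      then show ?thesis using nbrs[of u] u tails by auto
    qed
  qed
  ultimately show ?thesis using F'(1,2)
    by (intro exI[of _ ?A] exI[of _ M] exI[of _ F']) (simp add: PL)
qed

text \<open>
  The neighbours of the hub on a geodesic are at distance at most 2 from each other; by hypothesis
  distance 2 does not occur, so there are at most two of them and they are consecutive. As the path has
  at least three vertices, one of them has a further neighbour on the path, and after reversing the path if
  necessary it comes before the other one. If there are fewer than two, a closest vertex of the path will do.
\<close>
lemma hub_off_geodesic:
  assumes P: "geodesic P" and h: "h \<in> V" "h \<notin> set P" and len: "length P \<ge> 3"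
    and no2: "\<And>i. Suc (Suc i) < length P \<Longrightarrow> {h, P ! i} \<in> E \<Longrightarrow> {h, P ! Suc (Suc i)} \<in> E \<Longrightarrow> False"
    and card: "card E = card V + 1"
    and pos: "\<And>v. v \<in> V \<Longrightarrow> x v > 0" and hub: "\<And>v. v \<in> V \<Longrightarrow> x v \<le> x h"
  shows "\<exists>A B F. hub_data V h A B F \<and> card F = 2 \<and> length A + length B + 1 = length P \<and>
    energy E x \<le> energy (hub_graph V h A B F) x \<and>
    Q_row E x h < Q_row (hub_graph V h A B F) x h"
proof -
  have near: "j = Suc i" if "i < j" "j < length P" "{h, P ! i} \<in> E" "{h, P ! j} \<in> E" for i j
  proof -
    have "j \<le> i + 2" by (rule geodesic_window[OF P that])
    moreover have "j \<noteq> Suc (Suc i)" using no2[of i] that by auto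
    ultimately show ?thesis using that(1) by simp
  qed
  have PV: "set P \<subseteq> V" using P by (simp add: geodesic_def)
  have far: "1 \<le> dist_G h v" if "v \<in> set P" for v
  proof -
    have "v \<in> V" "v \<noteq> h" using that h PV by auto
    then have "dist_G h v \<noteq> 0" using dist_eq_0[OF h(1)] by blast
    then show ?thesis by simp
  qed
  \<comment> \<open>Two neighbours on the path; taking the path as a parameter allows it to be reversed.\<close>
  have two: ?thesis
    if Q: "geodesic Q" "set Q = set P" "length Q = length P" and i: "0 < i" "Suc i < length Q"
      and e: "{h, Q ! i} \<in> E" "{h, Q ! Suc i} \<in> E"
      and only: "\<And>k. k < length Q \<Longrightarrow> {h, Q ! k} \<in> E \<Longrightarrow> k = i \<or> k = Suc i" for Q i
  proof -
    have QL: "Q = take i Q @ Q ! i # drop (Suc i) Q" using i by (simp add: id_take_nth_drop)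
    have M: "drop (Suc i) Q \<noteq> []" "hd (drop (Suc i) Q) = Q ! Suc i" using i by (auto simp: hd_drop_conv_nth)
    have L1: "take i Q \<noteq> []" using i by auto
    then have L: "take i Q \<noteq> []" "last (take i Q) = Q ! (i - 1)"
      using i by (simp_all add: last_conv_nth[OF L1] min_def)
    have zz: "{h, Q ! (i - 1)} \<notin> E"
    proof
      assume "{h, Q ! (i - 1)} \<in> E"
      then have "i - 1 = i \<or> i - 1 = Suc i" using i by (intro only) auto
      then show False using i by linarith
    qed
    have "h \<notin> set Q" using h Q by simp
    have c: "dist_G h (Q ! i) \<le> dist_G h v" if "v \<in> set Q" for v
      using dist_edge[OF e(1)] far[of v] that Q(2) by simp
    have n: "v = Q ! i \<or> (drop (Suc i) Q \<noteq> [] \<and> v = hd (drop (Suc i) Q))" if "v \<in> set Q" "{h, v} \<in> E" for v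
      using that only M by (auto simp: in_set_conv_nth)
    have "\<exists>A B F. hub_data V h A B F \<and> card F = 2 \<and> length A + length B + 1 = length Q \<and>
      energy E x \<le> energy (hub_graph V h A B F) x \<and>
      Q_row E x h < Q_row (hub_graph V h A B F) x h"
      by (rule hub_replaces_path_vertex[where x = x, OF Q(1) QL h(1) \<open>h \<notin> set Q\<close> c n _ zz card pos hub]) (use L in auto)
    then show ?thesis using Q(3) by simp
  qed
  show ?thesis
  proof (cases "\<exists>i j. i < j \<and> j < length P \<and> {h, P ! i} \<in> E \<and> {h, P ! j} \<in> E")
    case True
    then obtain i where i: "Suc i < length P" "{h, P ! i} \<in> E" "{h, P ! Suc i} \<in> E"
      using near by metis
    have only: "k = i \<or> k = Suc i" if "k < length P" "{h, P ! k} \<in> E" for k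
    proof (rule ccontr)
      assume k: "\<not> (k = i \<or> k = Suc i)"
      show False
      proof (cases "k < i")
        case True
        then show False using near[of k i] near[of k "Suc i"] i that by simp
      next
        case False
        then show False using near[of i k] near[of "Suc i" k] i that k by simp
      qed
    qed
    show ?thesis
    proof (cases "i = 0")
      case False
      then show ?thesis using two[OF P refl refl _ i(1,2,3)] only by simp
    next
      case True
      let ?Q = "rev P" and ?i = "length P - 2"
      have nth: "?Q ! k = P ! (length P - Suc k)" if "k < length P" for k using that by (simp add: rev_nth)
      have idx: "?Q ! ?i = P ! Suc 0" "?Q ! Suc ?i = P ! 0"
      proof -
        have "length P - Suc ?i = Suc 0" "length P - Suc (Suc ?i) = 0" using len by auto
        then show "?Q ! ?i = P ! Suc 0" "?Q ! Suc ?i = P ! 0" using nth[of ?i] nth[of "Suc ?i"] len by auto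
      qed
      show ?thesis
      proof (rule two[OF geodesic_rev[OF P]])
        show "{h, ?Q ! ?i} \<in> E" "{h, ?Q ! Suc ?i} \<in> E" unfolding idx using i True by auto
        fix k assume k: "k < length ?Q" "{h, ?Q ! k} \<in> E"
        then have "length P - Suc k = 0 \<or> length P - Suc k = Suc 0"
          using only[of "length P - Suc k"] nth[of k] True by auto
        then show "k = ?i \<or> k = Suc ?i" using k len by auto
      qed (use len in auto)
    qed
  next
    case False
    have "set P \<noteq> {}" using len by auto
    then obtain p where "p \<in> set P" "\<And>v. v \<in> set P \<Longrightarrow> - real (dist_G h v) \<le> - real (dist_G h p)"
      using ex_max_on[of "set P" "\<lambda>v. - real (dist_G h v)"] by blast
    then have p: "p \<in> set P" "\<And>v. v \<in> set P \<Longrightarrow> dist_G h p \<le> dist_G h v" by auto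
    have only: "v = p" if v: "v \<in> set P" "{h, v} \<in> E" for v
    proof -
      have "dist_G h p = 1" using p(2)[OF v(1)] dist_edge[OF v(2)] far[OF p(1)] by simp
      then have e: "{h, p} \<in> E" using dist_1_edge[OF h(1)] p(1) PV by auto
      obtain i j where ij: "i < length P" "j < length P" "v = P ! i" "p = P ! j"
        using v(1) p(1) by (auto simp: in_set_conv_nth)
      then show ?thesis using False e v(2) by (cases i j rule: linorder_cases) auto
    qed
    obtain L M where PL: "P = L @ p # M" using p(1) by (meson split_list)
    have dist: "distinct P" by (rule geodesic_distinct[OF P])
    obtain z where z: "(L \<noteq> [] \<and> z = last L) \<or> (M \<noteq> [] \<and> z = hd M)"
      using len PL by (cases "L = []"; cases "M = []") auto
    have "z \<in> set P" "z \<noteq> p"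
    proof -
      have "z \<in> set L \<union> set M" using z by auto
      then show "z \<in> set P" "z \<noteq> p" using dist by (auto simp: PL)
    qed
    then have "{h, z} \<notin> E" using only by blast
    then show ?thesis
      by (intro hub_replaces_path_vertex[where x = x, OF P PL h p(2) _ z _ card pos hub]) (use only in auto)
  qed
qed

text \<open>
  If the hub were adjacent to two vertices at distance 2 on a geodesic, it could replace the vertex between
  them. So a geodesic that cannot be chosen to contain the hub satisfies the hypothesis of
  \<open>hub_off_geodesic\<close>.
\<close>
lemma graph_dominated_by_hub_graph:
  assumes d: "graph_diameter G = d" "d \<ge> 2" and card: "card E = card V + 1" and h: "h \<in> V"
    and pos: "\<And>v. v \<in> V \<Longrightarrow> x v > 0" and hub: "\<And>v. v \<in> V \<Longrightarrow> x v \<le> x h"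
  shows "\<exists>A B F. hub_data V h A B F \<and> card F = 2 \<and> length A + length B = d \<and>
    energy E x \<le> energy (hub_graph V h A B F) x \<and>
    (E = hub_graph V h A B F \<or> Q_row E x h < Q_row (hub_graph V h A B F) x h)"
proof (cases "\<exists>P. geodesic P \<and> length P = d + 1 \<and> h \<in> set P")
  case True
  then obtain P where P: "geodesic P" "length P = d + 1" "h \<in> set P" by blast
  then show ?thesis using hub_on_geodesic[where x = x, OF P(1,3) card pos hub] by simp
next
  case False
  obtain P where P: "geodesic P" "length P = d + 1" using diametral_geodesic d by auto
  have n: "h \<notin> set P" using False P by blast
  have no2: False if "Suc (Suc i) < length P" "{h, P ! i} \<in> E" "{h, P ! Suc (Suc i)} \<in> E" for i
  proof -
    have "geodesic (P[Suc i := h])" by (rule geodesic_replace[OF P(1) that])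
    moreover have "h \<in> set (P[Suc i := h])" using that(1) by (intro set_update_memI) simp
    ultimately show False using False P(2) by (metis length_list_update)
  qed
  have "length P \<ge> 3" using P d by simp
  have "\<exists>A B F. hub_data V h A B F \<and> card F = 2 \<and> length A + length B + 1 = length P \<and>
    energy E x \<le> energy (hub_graph V h A B F) x \<and>
    Q_row E x h < Q_row (hub_graph V h A B F) x h"
    by (rule hub_off_geodesic[where x = x, OF P(1) h n \<open>length P \<ge> 3\<close> no2 card pos hub])
  then show ?thesis using P(2) by auto
qed

end

section \<open>The extremal graph\<close>

lemma path_edges_map: "path_edges (map f xs) = (`) f ` path_edges xs"
  by (induction xs rule: induct_list012) auto

lemma theta_graph_image:
  assumes D: "theta_data V h A c C a1 a2" and f: "bij_betw f V W"
  shows "theta_graph W (f h) (map f A) (f c) (map f C) (f a1) (f a2) = (`) f ` theta_graph V h A c C a1 a2"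
proof -
  have sub: "set (h # A @ c # C) \<subseteq> V" using D by (simp add: theta_data_def)
  have "f ` (V - set (h # A @ c # C)) = W - f ` set (h # A @ c # C)"
    using f sub inj_on_image_set_diff[of f V V "set (h # A @ c # C)"] by (auto simp: bij_betw_def)
  then have O: "off_path W (f h) (map f A) (f c # map f C) = f ` off_path V h A (c # C)"
    by (simp add: off_path_def image_Un)
  have "path_edges (f h # map f A) = (`) f ` path_edges (h # A)"
    "path_edges (f h # f c # map f C) = (`) f ` path_edges (h # c # C)"
    using path_edges_map[of f "h # A"] path_edges_map[of f "h # c # C"] by simp_all
  then show ?thesis
    unfolding theta_graph_def hub_graph_def O by (simp add: image_Un image_image)
qed

lemma bij_betw_of_lists:
  assumes "distinct xs" "distinct ys" "length xs = length ys"
  shows "\<exists>f. bij_betw f (set xs) (set ys) \<and> map f xs = ys"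
proof -
  define f where "f = (\<lambda>v. the (map_of (zip xs ys) v))"
  have f: "f (xs ! i) = ys ! i" if "i < length xs" for i
    using that assms by (simp add: f_def map_of_zip_nth)
  then have m: "map f xs = ys" using assms(3) by (intro nth_equalityI) auto
  then have "inj_on f (set xs)" using assms by (metis distinct_map)
  moreover have "f ` set xs = set ys" using m by (metis set_map)
  ultimately show ?thesis using m unfolding bij_betw_def by blast
qed

text \<open>
  The vertices that are named in the definition are matched in order, the remaining pendant vertices in any way.
\<close>
lemma is_theta_unique:
  assumes E: "is_theta V a b E" and E': "is_theta W a b E'" and card: "card V = card W"
  shows "\<exists>f. bij_betw f V W \<and> E' = (`) f ` E"
proof -
  obtain h A c C a1 a2 where D: "theta_data V h A c C a1 a2" "length A = a" "length C = b"
    "E = theta_graph V h A c C a1 a2" using E unfolding is_theta_def by blast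
  obtain h' A' c' C' a1' a2' where D': "theta_data W h' A' c' C' a1' a2'" "length A' = a" "length C' = b"
    "E' = theta_graph W h' A' c' C' a1' a2'" using E' unfolding is_theta_def by blast
  let ?xs = "h # c # a1 # a2 # A @ C" and ?ys = "h' # c' # a1' # a2' # A' @ C'"
  have x: "distinct ?xs" "set ?xs \<subseteq> V" "finite V" using D(1) by (auto simp: theta_data_def off_path_def)
  have y: "distinct ?ys" "set ?ys \<subseteq> W" "finite W" using D'(1) by (auto simp: theta_data_def off_path_def)
  obtain r where r: "set r = V - set ?xs" "distinct r" using x finite_distinct_list[of "V - set ?xs"] by auto
  obtain r' where r': "set r' = W - set ?ys" "distinct r'" using y finite_distinct_list[of "W - set ?ys"] by auto
  have X: "distinct (?xs @ r)" "set (?xs @ r) = V" using x r by auto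
  have Y: "distinct (?ys @ r')" "set (?ys @ r') = W" using y r' by auto
  have "length (?xs @ r) = length (?ys @ r')"
    using distinct_card[OF X(1)] distinct_card[OF Y(1)] card unfolding X(2) Y(2) by simp
  then obtain f where f: "bij_betw f V W" "map f (?xs @ r) = ?ys @ r'"
    using bij_betw_of_lists[OF X(1) Y(1)] unfolding X(2) Y(2) by blast
  have "map f ?xs = ?ys"
  proof -
    have "map f ?xs = take (length ?ys) (map f (?xs @ r))" using D(2,3) D'(2,3) by simp
    then show ?thesis unfolding f(2) by simp
  qed
  then have "f h = h'" "f c = c'" "f a1 = a1'" "f a2 = a2'" "map f A @ map f C = A' @ C'" by auto
  moreover from this(5) have "map f A = A'" "map f C = C'" using D(2) D'(2) by auto
  ultimately have "E' = (`) f ` E" using theta_graph_image[OF D(1) f(1)] D(4) D'(4) by simp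
  then show ?thesis using f(1) by blast
qed

lemma graph_iso_of_edge_image:
  assumes "edge_set (verts G) (edges G)" "bij_betw f (verts G) (verts H)" "edges H = (`) f ` edges G"
  shows "G \<cong>\<^sub>g H"
  unfolding graph_iso_def
proof (intro exI[of _ f] conjI ballI)
  fix u v assume uv: "u \<in> verts G" "v \<in> verts G"
  have inj: "inj_on f (verts G)" using assms(2) by (simp add: bij_betw_def)
  show "({u, v} \<in> edges G) = ({f u, f v} \<in> edges H)"
  proof
    assume "{u, v} \<in> edges G"
    then have "f ` {u, v} \<in> edges H" unfolding assms(3) by (rule imageI)
    then show "{f u, f v} \<in> edges H" by simp
  next
    assume "{f u, f v} \<in> edges H"
    then obtain e where e: "e \<in> edges G" "f ` {u, v} = f ` e" unfolding assms(3) by auto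
    then have "{u, v} = e" using inj_on_image_eq_iff[OF inj, of "{u, v}" e] uv edge_setD[OF assms(1) e(1)] by auto
    then show "{u, v} \<in> edges G" using e by simp
  qed
qed (rule assms(2))

lemma Theta3_is_theta: "is_theta {0..<4 + s + a + b} a b (edges (Theta3 s a b))"
proof -
  let ?V = "{0..<4 + s + a + b}" and ?A = "[4 + s..<4 + s + a]" and ?C = "[4 + s + a..<4 + s + a + b]"
  have O: "off_path ?V 1 ?A (3 # ?C) = {0, 2} \<union> {4..<4 + s}" by (auto simp: off_path_def)
  have D: "theta_data ?V 1 ?A 3 ?C 0 2" unfolding theta_data_def O by auto
  have perm: "{e1, e2, e3, e4, e5} \<union> X \<union> PA \<union> PC =
      PA \<union> insert e5 PC \<union> (insert e1 (insert e2 X)) \<union> {e4, e3}" for e1 e2 e3 e4 e5 :: "nat set" and X PA PC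
    by blast
  have star: "(\<lambda>u. {1, u}) ` ({0, 2} \<union> {4..<4 + s}) = insert {0, 1} (insert {1, 2} {{1, v} |v. v \<in> {4..<4 + s}})"
  proof -
    have "{{1, v} |v. v \<in> {4..<4 + s}} = (\<lambda>v. {1, v}) ` {4..<4 + s}" by (rule Setcompr_eq_image)
    moreover have "{1, 0} = {0, 1 :: nat}" by auto
    ultimately show ?thesis by (simp only: image_Un image_insert image_empty Un_insert_left Un_empty_left)
  qed
  have "edges (Theta3 s a b) = theta_graph ?V 1 ?A 3 ?C 0 2"
    unfolding theta_graph_def hub_graph_def O star path_edges_simps insert_commute[of 0 "3::nat"]
    by (simp only: Theta3_def Theta_edges_def ugraph.simps perm)
  then show ?thesis unfolding is_theta_def using D by (intro exI conjI) auto
qed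

lemma theta_card_edges:
  assumes "is_theta V a b E"
  shows "card E = card V + 1" "edge_set V E" "u \<in> V \<Longrightarrow> v \<in> V \<Longrightarrow> (u, v) \<in> {(u, v). {u, v} \<in> E}\<^sup>*" "V \<noteq> {}"
proof -
  obtain h A c C a1 a2 where D: "theta_data V h A c C a1 a2"
    and E: "E = theta_graph V h A c C a1 a2" using assms unfolding is_theta_def by blast
  note d = D[unfolded theta_data_def]
  note H = theta_hub_data[OF D]
  have adj: "adj_sum (\<lambda>a b. 1) P = real (length P) - 1" if "P \<noteq> []" for P :: "'a list"
    using that by (induction P rule: induct_list012) auto
  have "card {{a1, c}, {a2, c}} = 2" using d by (auto simp: doubleton_eq_iff off_path_def)
  then have "real (card E) = real (length A) + real (length (c # C)) + real (card (off_path V h A (c # C))) + 2"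
    using sum_hub_graph[OF H, of "\<lambda>_. 1"] adj[of "h # A"] adj[of "h # c # C"] by (simp add: E theta_graph_def)
  moreover have "card (off_path V h A (c # C)) + length (h # A @ c # C) = card V"
    using card_Diff_subset[of "set (h # A @ c # C)" V] card_mono[of V "set (h # A @ c # C)"]
      distinct_card[of "h # A @ c # C"] d unfolding off_path_def by simp
  ultimately show "card E = card V + 1" by simp
  show "edge_set V E" unfolding E by (rule theta_edge_set[OF D])
  show "V \<noteq> {}" using d by auto
  show "u \<in> V \<Longrightarrow> v \<in> V \<Longrightarrow> (u, v) \<in> {(u, v). {u, v} \<in> E}\<^sup>*"
    using hub_graph_connected[OF H] by (simp add: E theta_graph_def)
qed

lemma edge_set_simple: "edge_set (verts G) (edges G) \<longleftrightarrow> simple_graph G"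
  by (simp add: edge_set_def simple_graph_def)

lemma Theta3_bicyclic: "bicyclic (Theta3 s a b)"
proof -
  have V: "verts (Theta3 s a b) = {0..<4 + s + a + b}" by (simp add: Theta3_def)
  note T = theta_card_edges[OF Theta3_is_theta[of s a b]]
  show ?thesis unfolding bicyclic_def
  proof (intro conjI)
    show "simple_graph (Theta3 s a b)" using T(2) edge_set_simple[of "Theta3 s a b"] by (simp add: V)
    show "connected_graph (Theta3 s a b)" using T(3,4) by (simp add: connected_graph_def V adj_rel_def)
    show "card (edges (Theta3 s a b)) = card (verts (Theta3 s a b)) + 1" using T(1) by (simp add: V)
  qed
qed

lemma walk_lipschitz:
  fixes f :: "'a \<Rightarrow> int"
  assumes "(u, v) \<in> adj_rel G ^^ k" "\<And>x y. {x, y} \<in> edges G \<Longrightarrow> f y \<le> f x + 1"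
  shows "f v \<le> f u + int k"
  using assms(1)
proof (induction k arbitrary: v)
  case (Suc k)
  then obtain w where "(u, w) \<in> adj_rel G ^^ k" "{w, v} \<in> edges G" by (auto simp: adj_rel_def)
  then show ?case using Suc.IH[of w] assms(2)[of w v] by simp
qed auto

lemma path_walk:
  assumes "path_edges P \<subseteq> edges G" "i < length P"
  shows "(P ! 0, P ! i) \<in> adj_rel G ^^ i"
  using assms(2)
proof (induction i)
  case (Suc i)
  then have "(P ! 0, P ! i) \<in> adj_rel G ^^ i" by simp
  moreover have "(P ! i, P ! Suc i) \<in> adj_rel G"
    using assms(1) Suc.prems by (auto simp: adj_rel_def path_edges_def)
  ultimately show ?case by (meson relpow_Suc_I)
qed simp

lemma walk_join:
  assumes "(h, u) \<in> adj_rel G ^^ k" "(h, v) \<in> adj_rel G ^^ l"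
  shows "(u, v) \<in> adj_rel G ^^ (k + l)"
proof -
  have "(u, h) \<in> adj_rel G ^^ k" using assms(1)
  proof (induction k arbitrary: u)
    case (Suc k)
    then obtain w where "(h, w) \<in> adj_rel G ^^ k" "(w, u) \<in> adj_rel G" by auto
    then have "(w, h) \<in> adj_rel G ^^ k" "(u, w) \<in> adj_rel G"
      using Suc.IH by (auto simp: adj_rel_def insert_commute)
    then show ?case by (meson relpow_Suc_I2)
  qed auto
  then show ?thesis using assms(2) by (auto simp: relpow_add)
qed

text \<open>
  Vertices on the second tail (counted from vertex 3) are joined through 3, all other pairs through 1. For the lower
  bound, let the potential of a vertex be its position along the path that consists of both tails, with the
  vertices off the path placed at the position of 1. It changes by at most 1 along an edge, and
  by \<open>a + b + 1\<close> between the ends of the two tails.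
\<close>
lemma Theta3_diameter:
  assumes ab: "1 \<le> b" "b \<le> a" "a \<le> b + 1"
  shows "graph_diameter (Theta3 s a b) = a + b + 1"
proof -
  let ?G = "Theta3 s a b" and ?n = "4 + s + a + b"
  let ?A = "1 # [4 + s..<4 + s + a]" and ?C = "3 # [4 + s + a..<4 + s + a + b]"
  have V: "verts ?G = {0..<?n}" by (simp add: Theta3_def)
  have walk_le: "graph_dist ?G u v \<le> k" if "(u, v) \<in> adj_rel ?G ^^ l" "l \<le> k" for u v k l
    using Least_le[of "\<lambda>k. (u, v) \<in> adj_rel ?G ^^ k", OF that(1)] that(2) by (simp add: graph_dist_def)
  have E: "{1, 0} \<in> edges ?G" "{1, 2} \<in> edges ?G" "{1, 3} \<in> edges ?G"
    "\<And>v. v \<in> {4..<4 + s} \<Longrightarrow> {1, v} \<in> edges ?G" "path_edges ?A \<subseteq> edges ?G" "path_edges ?C \<subseteq> edges ?G"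
  proof -
    have c: "{1, 0} = {0, 1 :: nat}" by auto
    show "{1, 0} \<in> edges ?G" "{1, 2} \<in> edges ?G" "{1, 3} \<in> edges ?G"
      unfolding c by (simp_all add: Theta3_def Theta_edges_def)
    show "\<And>v. v \<in> {4..<4 + s} \<Longrightarrow> {1, v} \<in> edges ?G" by (simp add: Theta3_def) blast
    show "path_edges ?A \<subseteq> edges ?G" "path_edges ?C \<subseteq> edges ?G"
      by (simp_all add: Theta3_def subset_iff)
  qed
  have nA: "?A ! 0 = 1" "\<And>i. 0 < i \<Longrightarrow> i \<le> a \<Longrightarrow> ?A ! i = 3 + s + i"
    by (auto simp: nth_Cons')
  have nC: "?C ! 0 = 3" "\<And>i. 0 < i \<Longrightarrow> i \<le> b \<Longrightarrow> ?C ! i = 3 + s + a + i"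
    by (auto simp: nth_Cons')
  have wA: "(1, ?A ! i) \<in> adj_rel ?G ^^ i" if "i \<le> a" for i
    using path_walk[OF E(5), of i] that nA(1) by simp
  have wC: "(3, ?C ! i) \<in> adj_rel ?G ^^ i" if "i \<le> b" for i
    using path_walk[OF E(6), of i] that nC(1) by simp
  have wC1: "(1, ?C ! i) \<in> adj_rel ?G ^^ (Suc i)" if "i \<le> b" for i
    using wC[OF that] E(3) by (intro relpow_Suc_I2[of 1 3]) (auto simp: adj_rel_def)
  have wO: "(1, v) \<in> adj_rel ?G ^^ 1" if "v \<in> {0, 2} \<union> {4..<4 + s}" for v
    using that E(1,2,4) by (auto simp: adj_rel_def)
  have cases: "(\<exists>i\<le>a. v = ?A ! i) \<or> (\<exists>i\<le>b. v = ?C ! i) \<or> v \<in> {0, 2} \<union> {4..<4 + s}" if v: "v < ?n" for v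
  proof -
    consider "v = 1" | "v = 3" | "v \<in> {0, 2} \<union> {4..<4 + s}" | "4 + s \<le> v" "v < 4 + s + a"
      | "4 + s + a \<le> v" "v < ?n"
    proof -
      have "v = 0 \<or> v = 1 \<or> v = 2 \<or> v = 3 \<or> (4 \<le> v \<and> v < 4 + s) \<or> (4 + s \<le> v \<and> v < 4 + s + a)
        \<or> (4 + s + a \<le> v \<and> v < ?n)" using v by arith
      then show thesis using that by auto
    qed
    then show ?thesis
    proof cases
      case 1 then show ?thesis using nA(1) by (metis le0)
    next
      case 2 then show ?thesis using nC(1) by (metis le0)
    next
      case 4
      then have "v = ?A ! (v - (3 + s))" "v - (3 + s) \<le> a" using nA(2)[of "v - (3 + s)"] by auto
      then show ?thesis by blast
    next
      case 5
      then have "v = ?C ! (v - (3 + s + a))" "v - (3 + s + a) \<le> b" using nC(2)[of "v - (3 + s + a)"] by auto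
      then show ?thesis by blast
    qed blast
  qed
  have upper: "graph_dist ?G u v \<le> a + b + 1" if uv: "u < ?n" "v < ?n" for u v
  proof -
    consider (CC) i j where "u = ?C ! i" "v = ?C ! j" "i \<le> b" "j \<le> b"
      | (hub) k l where "(1, u) \<in> adj_rel ?G ^^ k" "(1, v) \<in> adj_rel ?G ^^ l" "k + l \<le> a + b + 1"
    proof -
      have depth: "\<exists>k. (1, w) \<in> adj_rel ?G ^^ k \<and> k \<le> a" if w: "\<not> (\<exists>i\<le>b. w = ?C ! i)" "w < ?n" for w
      proof -
        consider (tail) i where "i \<le> a" "w = ?A ! i" | (leaf) "w \<in> {0, 2} \<union> {4..<4 + s}"
          using cases[OF w(2)] w(1) by blast
        then show ?thesis
        proof cases
          case tail
          then show ?thesis using wA[OF tail(1)] by blast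
        next
          case leaf
          then show ?thesis using wO[OF leaf] ab by (intro exI[of _ 1]) simp
        qed
      qed
      have depthC: "\<exists>k. (1, w) \<in> adj_rel ?G ^^ k \<and> k \<le> b + 1" if w: "\<exists>i\<le>b. w = ?C ! i" for w
        
      proof -
        obtain i where i: "i \<le> b" "w = ?C ! i" using w by blast
        then show ?thesis using wC1[OF i(1)] by (intro exI[of _ "Suc i"]) simp
      qed
      show thesis
      proof (cases "\<exists>i\<le>b. u = ?C ! i")
        case True
        show thesis
        proof (cases "\<exists>i\<le>b. v = ?C ! i")
          case vC: True
          obtain i where i: "i \<le> b" "u = ?C ! i" using True by (elim exE conjE)
          obtain j where j: "j \<le> b" "v = ?C ! j" using vC by (elim exE conjE)
          show thesis by (rule CC[OF i(2) j(2) i(1) j(1)])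
        next
          case False
          then obtain k l where "(1, u) \<in> adj_rel ?G ^^ k" "k \<le> b + 1" "(1, v) \<in> adj_rel ?G ^^ l" "l \<le> a"
            using depth[OF False uv(2)] depthC[OF True] by blast
          then show thesis by (intro hub[of k l]) auto
        qed
      next
        case False
        then obtain k where k: "(1, u) \<in> adj_rel ?G ^^ k" "k \<le> a" using depth[OF False uv(1)] by blast
        have "\<exists>l. (1, v) \<in> adj_rel ?G ^^ l \<and> l \<le> b + 1"
        proof (cases "\<exists>i\<le>b. v = ?C ! i")
          case True
          then show ?thesis by (rule depthC)
        next
          case False
          then obtain l where "(1, v) \<in> adj_rel ?G ^^ l" "l \<le> a" using depth[OF False uv(2)] by blast
          then show ?thesis using ab by (intro exI[of _ l]) simp
        qed
        then obtain l where "(1, v) \<in> adj_rel ?G ^^ l" "l \<le> b + 1" by blast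
        then show thesis using k by (intro hub[of k l]) auto
      qed
    qed
    then show ?thesis
    proof cases
      case CC
      then have "(u, v) \<in> adj_rel ?G ^^ (i + j)"
        using walk_join[OF wC[OF CC(3)] wC[OF CC(4)]] by (simp only:)
      then show ?thesis by (rule walk_le) (use CC ab in simp)
    next
      case hub
      then show ?thesis using walk_le[OF walk_join[OF hub(1,2)]] by simp
    qed
  qed
  define pot :: "nat \<Rightarrow> int" where "pot = (\<lambda>v. if v < 4 + s then (if v = 3 then 1 else 0)
    else if v < 4 + s + a then - int (v - (3 + s)) else int (v - (3 + s + a)) + 1)"
  have lip: "pot y \<le> pot x + 1 \<and> pot x \<le> pot y + 1" if e: "{x, y} \<in> edges ?G" for x y
  proof -
    have main: "pot y \<le> pot x + 1 \<and> pot x \<le> pot y + 1"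
      if "{x, y} = {?A ! i, ?A ! Suc i} \<and> Suc i \<le> a \<or> {x, y} = {?C ! i, ?C ! Suc i} \<and> Suc i \<le> b" for i
    proof -
      have pA: "pot (?A ! j) = - int j" if "j \<le> a" for j
        using that nA(1) nA(2)[of j] by (cases "j = 0") (auto simp: pot_def)
      have pC: "pot (?C ! j) = int j + 1" if "j \<le> b" for j
        using that nC(1) nC(2)[of j] by (cases "j = 0") (auto simp: pot_def)
      show ?thesis using that pA[of i] pA[of "Suc i"] pC[of i] pC[of "Suc i"]
        by (auto simp: doubleton_eq_iff simp del: nth_Cons_Suc)
    qed
    consider "{x, y} \<in> Theta_edges" | v where "v \<in> {4..<4 + s}" "{x, y} = {1, v}"
      | "{x, y} \<in> path_edges ?A" | "{x, y} \<in> path_edges ?C"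
      using e unfolding Theta3_def by auto
    then show ?thesis
    proof cases
      case 1
      then show ?thesis unfolding Theta_edges_def by (auto simp: doubleton_eq_iff pot_def)
    next
      case 2
      then show ?thesis by (auto simp: doubleton_eq_iff pot_def)
    next
      case 3
      then obtain i where "{x, y} = {?A ! i, ?A ! Suc i}" "Suc i < length ?A" unfolding path_edges_def by blast
      then show ?thesis using main[of i] by simp
    next
      case 4
      then obtain i where "{x, y} = {?C ! i, ?C ! Suc i}" "Suc i < length ?C" unfolding path_edges_def by blast
      then show ?thesis using main[of i] by simp
    qed
  qed
  let ?u = "?A ! a" and ?v = "?C ! b"
  have uv: "?u = 3 + s + a" "?v = 3 + s + a + b" using nA(2)[of a] nC(2)[of b] ab by auto
  have "(?u, ?v) \<in> adj_rel ?G ^^ (a + Suc b)" using walk_join[OF wA wC1] by simp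
  then have "(?u, ?v) \<in> adj_rel ?G ^^ graph_dist ?G ?u ?v" unfolding graph_dist_def by (rule LeastI)
  then have "pot ?v \<le> pot ?u + int (graph_dist ?G ?u ?v)" by (rule walk_lipschitz) (use lip in blast)
  then have lower: "a + b + 1 \<le> graph_dist ?G ?u ?v" using ab unfolding uv by (simp add: pot_def)
  show ?thesis unfolding graph_diameter_def
  proof (rule Max_eqI)
    have "connected_simple_graph ?G"
      using Theta3_bicyclic by (simp add: bicyclic_def connected_simple_graph_def)
    then show "finite {graph_dist ?G u v |u v. u \<in> verts ?G \<and> v \<in> verts ?G}"
      by (rule connected_simple_graph.dist_set_finite)
    fix k assume "k \<in> {graph_dist ?G u v |u v. u \<in> verts ?G \<and> v \<in> verts ?G}"
    then show "k \<le> a + b + 1" using upper by (auto simp: V)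
  next
    have uv_V: "?u \<in> verts ?G" "?v \<in> verts ?G" unfolding uv V using ab by auto
    then have "graph_dist ?G ?u ?v \<le> a + b + 1" unfolding V by (intro upper) auto
    then have "a + b + 1 = graph_dist ?G ?u ?v" using lower by linarith
    with uv_V show "a + b + 1 \<in> {graph_dist ?G u v |u v. u \<in> verts ?G \<and> v \<in> verts ?G}" by blast
  qed
qed

lemma B3star_eq_Theta3:
  assumes d: "d \<ge> 3" and n: "n \<ge> d + 3"
  shows "B3star n d = Theta3 (n - d - 3) (d div 2) ((d - 1) div 2)"
  unfolding B3star_def
proof (rule the_equality)
  let ?a = "d div 2" and ?b = "(d - 1) div 2" and ?s = "n - d - 3"
  have ab: "1 \<le> ?b" "?b \<le> ?a" "?a \<le> ?b + 1" "d = ?a + ?b + 1" using d by presburger+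
  have "graph_diameter (Theta3 ?s ?a ?b) = d" using Theta3_diameter[OF ab(1-3)] ab(4) by simp
  moreover have "card (verts (Theta3 ?s ?a ?b)) = n" using ab(4) n by (simp add: Theta3_def)
  ultimately show "\<exists>s a b. Theta3 ?s ?a ?b = Theta3 s a b \<and> card (verts (Theta3 ?s ?a ?b)) = n \<and>
     graph_diameter (Theta3 ?s ?a ?b) = d \<and> b \<le> a \<and> a \<le> b + 1 \<and> d = a + b + 1" using ab by blast
  fix G assume "\<exists>s a b. G = Theta3 s a b \<and> card (verts G) = n \<and> graph_diameter G = d \<and> b \<le> a \<and> a \<le> b + 1 \<and> d = a + b + 1"
  then obtain s a b where G: "G = Theta3 s a b" "card (verts G) = n" "b \<le> a" "a \<le> b + 1" "d = a + b + 1" by blast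
  then have "a = ?a" "b = ?b" by presburger+
  moreover have "s = ?s" using G by (simp add: Theta3_def)
  ultimately show "G = Theta3 ?s ?a ?b" using G(1) by simp
qed


text \<open>
  A theta graph of maximal radius must be balanced by the two balancing lemmas, and all balanced ones
  are isomorphic.
\<close>
lemma theta_optimum:
  assumes T0: "is_theta V a0 b0 E0" and ab: "b0 \<le> a0" "a0 \<le> b0 + 1"
    and T: "is_theta V a b E" and sum: "a + b = a0 + b0"
  shows "mu V E \<le> mu V E0" "mu V E = mu V E0 \<Longrightarrow> is_theta V a0 b0 E"
proof -
  define Fam where "Fam = {E. \<exists>a b. is_theta V a b E \<and> a + b = a0 + b0}"
  have "Fam \<subseteq> Pow (Pow V)" using theta_card_edges(2) unfolding Fam_def edge_set_def by blast
  moreover have "finite V" using theta_card_edges(2)[OF T] by (simp add: edge_set_def)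
  ultimately have "finite Fam" using finite_subset by blast
  moreover have "E \<in> Fam" using T sum unfolding Fam_def by blast
  ultimately obtain M where M: "M \<in> Fam" "\<And>E'. E' \<in> Fam \<Longrightarrow> mu V E' \<le> mu V M"
    using ex_max_on[of Fam "mu V"] by blast
  have balanced: "is_theta V a0 b0 E'" if E': "E' \<in> Fam" "mu V M \<le> mu V E'" for E'
  proof -
    obtain a b where t: "is_theta V a b E'" "a + b = a0 + b0" using E' unfolding Fam_def by blast
    have max: "\<not> mu V E' < mu V E''" if "is_theta V a'' b'' E''" "a'' + b'' = a0 + b0" for a'' b'' E''
    proof -
      have "E'' \<in> Fam" using that unfolding Fam_def by blast
      then show ?thesis using M(2) E'(2) by force
    qed
    have le: "a \<le> b + 1" if ab': "is_theta V a b E'" "a + b = a0 + b0" for a b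
    proof (rule ccontr)
      assume "\<not> a \<le> b + 1"
      then obtain E'' where "is_theta V (b + 1) (a - 1) E''" "mu V E' < mu V E''"
        using theta_balance_hub_tail[OF ab'(1)] by auto
      moreover have "b + 1 + (a - 1) = a0 + b0" using ab'(2) \<open>\<not> a \<le> b + 1\<close> by simp
      ultimately show False using max by blast
    qed
    show ?thesis
    proof (cases "a < b")
      case True
      then have "is_theta V b a E'"
        using theta_balance_far_tail[OF t(1)] max[of b a] t(2) by (auto simp: add.commute)
      moreover have "b \<le> a + 1" using le[OF calculation] t(2) by simp
      then have "b = a0" "a = b0" using True ab t(2) by linarith+
      ultimately show ?thesis by simp
    next
      case False
      then have "a = a0" "b = b0" using le[OF t] ab t(2) by linarith+
      then show ?thesis using t(1) by simp
    qed
  qed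
  have "mu V E' = mu V E0" if t: "is_theta V a0 b0 E'" for E'
  proof -
    obtain f where "bij_betw f V V" "E' = (`) f ` E0" using is_theta_unique[OF T0 t refl] by blast
    then show ?thesis using mu_bij[OF theta_card_edges(2,4)[OF T0]] by simp
  qed
  then have M0: "mu V M = mu V E0" using balanced[OF M(1)] by simp
  then show "mu V E \<le> mu V E0" using M(2)[OF \<open>E \<in> Fam\<close>] by simp
  assume "mu V E = mu V E0"
  then show "is_theta V a0 b0 E" using balanced[OF \<open>E \<in> Fam\<close>] M0 by simp
qed

text \<open>
  As the tails have at least three vertices together, one of them has two, and by symmetry it may be the
  one that \<open>fan_less_theta\<close> moves to \<open>w\<^sub>4\<close>.
\<close>
lemma fan_below_theta:
  assumes T0: "is_theta V a0 b0 E0" and ab: "b0 \<le> a0" "a0 \<le> b0 + 1"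
    and D: "fan_data V h A B a" and sum: "length A + length B = a0 + b0 + 1" "a0 + b0 \<ge> 2"
    and card: "card (off_path V h A B) \<ge> 2"
  shows "mu V (fan_graph V h A B a) < mu V E0"
proof -
  have "off_path V h A B \<noteq> {a}" using card by auto
  moreover have "a \<in> off_path V h A B" using D by (simp add: fan_data_def)
  ultimately obtain o' where o: "o' \<in> off_path V h A B" "o' \<noteq> a" by blast
  have main: "mu V (fan_graph V h A B a) < mu V E0"
    if D: "fan_data V h A B a" and o: "o' \<in> off_path V h A B" and len: "length B \<ge> 2"
      and sum: "length A + length B = a0 + b0 + 1" for A B
  proof -
    obtain E' where E': "is_theta V (length A) (length B - 1) E'" "mu V (fan_graph V h A B a) < mu V E'"
      using fan_less_theta[OF D o \<open>o' \<noteq> a\<close> len] by blast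
    have "mu V E' \<le> mu V E0"
      using sum len by (intro theta_optimum(1)[OF T0 ab E'(1)]) simp
    then show ?thesis using E'(2) by simp
  qed
  show ?thesis
  proof (cases "length B \<ge> 2")
    case True
    then show ?thesis using main[OF D o(1) _ sum(1)] by simp
  next
    case False
    then have "length A \<ge> 2" using sum by simp
    then show ?thesis
      using main[OF fan_swap(1)[OF D], unfolded off_path_swap[of V h B A], OF o(1)] sum(1) fan_swap(2)[OF D] by simp
  qed
qed

theorem theorem5p3:
  fixes n d :: nat and H :: "nat ugraph"
  assumes "d \<ge> 3"
    and "n \<ge> d + 3"
    and "H \<in> bicyclic_graphs n d"
    and "\<forall>G\<in>bicyclic_graphs n d. signless_laplacian_radius G \<le> signless_laplacian_radius H"
  shows "H \<cong>\<^sub>g B3star n d"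
proof -
  let ?a = "d div 2" and ?b = "(d - 1) div 2" and ?s = "n - d - 3"
  let ?B = "Theta3 ?s ?a ?b" and ?V = "{0..<n}" and ?E = "edges H"
  have ab: "1 \<le> ?b" "?b \<le> ?a" "?a \<le> ?b + 1" "?a + ?b + 1 = d" using assms(1) by presburger+
  have Bstar: "B3star n d = ?B" by (rule B3star_eq_Theta3[OF assms(1,2)])
  have n: "4 + ?s + ?a + ?b = n" using ab(4) assms(2) by simp
  have "verts ?B = {0..<4 + ?s + ?a + ?b}" by (simp add: Theta3_def)
  then have BV: "verts ?B = ?V" unfolding n .
  have BT: "is_theta ?V ?a ?b (edges ?B)" using Theta3_is_theta[of ?s ?a ?b] unfolding n .
  have "?B \<in> bicyclic_graphs n d"
    using Theta3_bicyclic Theta3_diameter[OF ab(1-3)] BV ab(4) by (simp add: bicyclic_graphs_def)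
  then have "signless_laplacian_radius ?B \<le> signless_laplacian_radius H" using assms(4) by blast
  moreover have HV: "verts H = ?V" and Hb: "bicyclic H" and Hd: "graph_diameter H = d"
    using assms(3) by (auto simp: bicyclic_graphs_def)
  have HE: "edge_set ?V ?E" using Hb edge_set_simple[of H] by (simp add: bicyclic_def HV)
  have n0: "n > 0" using assms(2) by simp
  ultimately have opt: "mu ?V (edges ?B) \<le> mu ?V ?E"
    using signless_laplacian_radius_eq_mu[OF BV n0 theta_card_edges(2)[OF BT]]
      signless_laplacian_radius_eq_mu[OF HV n0 HE] by simp
  interpret connected_simple_graph H
    using Hb by unfold_locales (auto simp: bicyclic_def)
  have conn: "(u, v) \<in> {(u, v). {u, v} \<in> ?E}\<^sup>*" if "u \<in> ?V" "v \<in> ?V" for u v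
    using connected that by (simp add: connected_graph_def adj_rel_def HV)
  have V0: "?V \<noteq> {}" using n0 by simp
  obtain x where x: "\<And>v. v \<in> ?V \<Longrightarrow> x v > 0" "\<And>v. v \<in> ?V \<Longrightarrow> Q_row ?E x v = mu ?V ?E * x v"
    "norm_sq ?V x = 1"
    using perron_vector_exists[OF HE V0 conn] by blast
  obtain h where h: "h \<in> ?V" "\<And>v. v \<in> ?V \<Longrightarrow> x v \<le> x h"
    using ex_max_on[of ?V x] V0 by blast
  have "\<exists>A B F. hub_data (verts H) h A B F \<and> card F = 2 \<and> length A + length B = d \<and>
    energy ?E x \<le> energy (hub_graph (verts H) h A B F) x \<and>
    (?E = hub_graph (verts H) h A B F \<or> Q_row ?E x h < Q_row (hub_graph (verts H) h A B F) x h)"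
    by (rule graph_dominated_by_hub_graph) (use Hd assms(1) Hb h x(1) in \<open>auto simp: bicyclic_def HV\<close>)
  then obtain A B F where D: "hub_data ?V h A B F" "card F = 2" "length A + length B = d"
    and e: "energy ?E x \<le> energy (hub_graph ?V h A B F) x"
    and r: "?E = hub_graph ?V h A B F \<or> Q_row ?E x h < Q_row (hub_graph ?V h A B F) x h"
    unfolding HV by blast
  have xE: "energy ?E x = mu ?V ?E" using energy_eq_of_rows[OF HE x(2)] x(3) by simp
  have "2 \<le> d" using assms(1) by simp
  have "(\<exists>a b E'. is_theta ?V a b E' \<and> a + b + 1 = d \<and>
      energy (hub_graph ?V h A B F) x \<le> energy E' x \<and>
      Q_row (hub_graph ?V h A B F) x h \<le> Q_row E' x h \<and>
      (hub_graph ?V h A B F = E' \<or> b = 0 \<or> (\<exists>v\<in>?V. Q_row (hub_graph ?V h A B F) x v \<noteq> Q_row E' x v)))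
    \<or> (\<exists>A' B' a. fan_data ?V h A' B' a \<and> length A' + length B' = d \<and>
      energy (hub_graph ?V h A B F) x \<le> energy (fan_graph ?V h A' B' a) x)"
    by (rule hub_graph_dominated[where x = x, OF D \<open>2 \<le> d\<close> x(1) h(2)])
  then consider
    (theta) a b E' where "is_theta ?V a b E'" "a + b + 1 = d"
      "energy (hub_graph ?V h A B F) x \<le> energy E' x"
      "Q_row (hub_graph ?V h A B F) x h \<le> Q_row E' x h"
      "hub_graph ?V h A B F = E' \<or> b = 0 \<or> (\<exists>v\<in>?V. Q_row (hub_graph ?V h A B F) x v \<noteq> Q_row E' x v)"
  | (fan) A' B' a where "fan_data ?V h A' B' a" "length A' + length B' = d"
      "energy (hub_graph ?V h A B F) x \<le> energy (fan_graph ?V h A' B' a) x"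
    by blast
  then have "is_theta ?V ?a ?b ?E"
  proof cases
    case (fan A' B' a)
    note eF = fan(3)
    have fE: "edge_set ?V (fan_graph ?V h A' B' a)"
      unfolding fan_graph_def by (intro hub_graph_edge_set fan_hub_data fan(1))
    have "card (off_path ?V h A' B') + (d + 1) = n"
    proof -
      have "distinct (h # A' @ B')" "set (h # A' @ B') \<subseteq> ?V" using fan(1) by (auto simp: fan_data_def)
      then show ?thesis
        using card_Diff_subset[of "set (h # A' @ B')" ?V] card_mono[of ?V "set (h # A' @ B')"]
          distinct_card[of "h # A' @ B'"] fan(2) unfolding off_path_def by simp
    qed
    then have "mu ?V (fan_graph ?V h A' B' a) < mu ?V (edges ?B)"
      using fan(2) ab assms(1,2) by (intro fan_below_theta[OF BT ab(2,3) fan(1)]) auto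
    moreover have "mu ?V ?E \<le> mu ?V (fan_graph ?V h A' B' a)"
      using mu_attained(2)[OF fE V0, of x] e eF xE x(3) by simp
    ultimately show ?thesis using opt by simp
  next
    case (theta a b E')
    note T = theta(1,2) and e' = theta(3) and r' = theta(4) and alt = theta(5)
    have sum: "a + b = ?a + ?b" using T(2) ab(4) by simp
    note E'_le = theta_optimum(1)[OF BT ab(2,3) T(1) sum]
    have "energy ?E x \<le> energy E' x" using e e' by simp
    note cmp = rows_eq_of_comparison[OF HE theta_card_edges(2)[OF T(1)] x(2) this order_trans[OF E'_le opt]]
    have rows: "Q_row E' x v = Q_row ?E x v" if "v \<in> ?V" for v using cmp(1)[OF _ that] by simp
    have mu_eq: "mu ?V E' = mu ?V ?E" using cmp(2)[OF _ h(1)] x(3) by simp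
    then have opt_eq: "mu ?V E' = mu ?V (edges ?B)" using E'_le opt by simp
    have EH: "?E = hub_graph ?V h A B F" using r r' rows[OF h(1)] by auto
    have "b \<noteq> 0"
    proof
      assume b: "b = 0"
      then have "a \<ge> b + 2" using T(2) assms(1) by simp
      then obtain E'' where E'': "is_theta ?V (b + 1) (a - 1) E''" "mu ?V E' < mu ?V E''"
        using theta_balance_hub_tail[OF T(1)] by blast
      have "b + 1 + (a - 1) = ?a + ?b" using sum \<open>a \<ge> b + 2\<close> by simp
      then show False using theta_optimum(1)[OF BT ab(2,3) E''(1)] E''(2) opt_eq by simp
    qed
    then have "?E = E'" using alt rows EH by auto
    then show ?thesis using theta_optimum(2)[OF BT ab(2,3) T(1) sum opt_eq] by simp
  qed
  then obtain f where f: "bij_betw f ?V ?V" "edges ?B = (`) f ` ?E"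
    using is_theta_unique[OF _ BT refl] by blast
  show ?thesis unfolding Bstar
  proof (rule graph_iso_of_edge_image)
    show "edge_set (verts H) ?E" using HE by (simp only: HV)
    show "bij_betw f (verts H) (verts ?B)" using f(1) by (simp only: HV BV)
    show "edges ?B = (`) f ` ?E" by (rule f(2))
  qed
qed

end
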